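(* Let $a,b,c>0$, let $g_{abc}$ be the left-invariant Riemannian metric on $S^3$ with orthonormal basis $\{a\mathbf{i},b\mathbf{j},c\mathbf{k}\}$ of $T_1S^3$, and denote the induced metric on $\mathrm{SO}(3)=S^3/\{\pm1\}$ also by $g_{abc}$. Let $D$ denote the Dirac operator associated with $(S^3,g_{abc})$ (endowed with either orientation), and let $D^{\alpha_0}$ and $D^{\alpha_1}$ denote the Dirac operators associated with the trivial and the nontrivial spin structure, respectively, on the quotient manifold $(\mathrm{SO}(3),g_{abc})$. Let $$C:=\frac12\left(\frac{ab}{c}+\frac{bc}{a}+\frac{ca}{b}\right)\quad\text{and}\quad \mu:=a+b+c-C.$$ If the (constant) scalar curvature $\mathrm{scal}$ of $g_{abc}$ satisfies $\mathrm{scal}>0$, then $$\min\{|\lambda|\mid\lambda\in\mathrm{spec}(D)\}=\mu>0,$$ $$\min\{|\lambda|\mid\lambda\in\mathrm{spec}(D^{\alpha_0})\}=C\ge\mu,$$ $$\min\{|\lambda|\mid\lambda\in\mathrm{spec}(D^{\alpha_1})\}=\mu.$$ Moreover, the smallest eigenvalue of the squared operator $D^2$ has multiplicity $4$ if $a=b=c$ and multiplicity $2$ otherwise. The smallest eigenvalue of $(D^{\alpha_0})^2$ always has multiplicity $2$; the same holds for $(D^{\alpha_1})^2$.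
   Context: $S^3=\{x\in\mathbb{H}\mid x\bar x=1\}$ is the Lie group of unit quaternions, $\mathbb{H}=\mathrm{span}_{\mathbb{R}}\{1,\mathbf{i},\mathbf{j},\mathbf{k}\}$, and $T_1S^3=\mathrm{span}_{\mathbb{R}}\{\mathbf{i},\mathbf{j},\mathbf{k}\}$. Put $X_1=a\mathbf{i}$, $X_2=b\mathbf{j}$, $X_3=c\mathbf{k}$, also regarded as left-invariant vector fields on $S^3$; $g_{abc}$ is the left-invariant metric for which they are orthonormal. $D$ is the classical Dirac operator for the unique spin structure on the oriented manifold $(S^3,g_{abc})$. For the standard orientation ($\{\mathbf{i},\mathbf{j},\mathbf{k}\}$ positively oriented) the spinor bundle is trivialized by the left-invariant frame as $S^3\times\Sigma_3$, where $\Sigma_3\cong\mathbb{C}^2$ is the space of complex 3-spinors, and $$(D\varphi)(x)=\sum_{\ell=1}^3 e_\ell\cdot X_\ell|_x(\varphi)+C\,e_1\cdot e_2\cdot e_3\cdot\varphi(x)\qquad(\varphi\in C^\infty(S^3,\Sigma_3),\ x\in S^3),$$ where $\cdot$ is Clifford multiplication, which in a suitable basis of $\Sigma_3$ is given for $e_1,e_2,e_3$ by the matrices $\begin{pmatrix}i&0\\0&-i\end{pmatrix}$, $\begin{pmatrix}0&1\\-1&0\end{pmatrix}$, $\begin{pmatrix}0&i\\i&0\end{pmatrix}$, respectively (so $e_1\cdot e_2\cdot e_3\cdot$ is $-\mathrm{Id}$). Reversing the orientation replaces the Dirac operator by its negative. On $\mathrm{SO}(3)=S^3/\{\pm1\}$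 (with the orientation and metric inherited from $S^3$) there are exactly two spin structures, corresponding to the homomorphisms $\alpha_0,\alpha_1:\{\pm1\}\to\mathrm{Spin}(3)$ with $\alpha_0(\gamma)=1$ (trivial) and $\alpha_1(\gamma)=\gamma$ (nontrivial). The spinor bundle for $\alpha_j$ is $S^3\times_{\rho\circ\alpha_j}\Sigma_3$, where $\rho$ is the spin representation; its smooth sections are the smooth maps $\varphi:S^3\to\Sigma_3$ with $\varphi(-x)=\varphi(x)$ (for $\alpha_0$) or $\varphi(-x)=-\varphi(x)$ (for $\alpha_1$), and $D^{\alpha_j}$ is the restriction of $D$ to these maps. $\mathrm{spec}$ denotes the set of eigenvalues; multiplicities are complex dimensions of eigenspaces. *)

theory Defs
  imports "HOL-Analysis.Analysis" "HOL-Library.Function_Algebras"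
begin

section \<open>Unit quaternions\<close>

text \<open>The components of \<open>x :: quat\<close> are the coefficients of \<open>1\<close>, \<open>i\<close>, \<open>j\<close>, \<open>k\<close>, in this order.\<close>

type_synonym quat = "real ^ 4"

definition qmult :: "quat \<Rightarrow> quat \<Rightarrow> quat" (infixl "\<bullet>\<^sub>H" 70) where
  "x \<bullet>\<^sub>H y = vector
    [x$1 * y$1 - x$2 * y$2 - x$3 * y$3 - x$4 * y$4,
     x$1 * y$2 + x$2 * y$1 + x$3 * y$4 - x$4 * y$3,
     x$1 * y$3 - x$2 * y$4 + x$3 * y$1 + x$4 * y$2,
     x$1 * y$4 + x$2 * y$3 - x$3 * y$2 + x$4 * y$1]"

definition qone :: quat where "qone = vector [1, 0, 0, 0]"
definition qi :: quat where "qi = vector [0, 1, 0, 0]"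
definition qj :: quat where "qj = vector [0, 0, 1, 0]"
definition qk :: quat where "qk = vector [0, 0, 0, 1]"

definition qcnj :: "quat \<Rightarrow> quat" where
  "qcnj x = vector [x$1, - x$2, - x$3, - x$4]"

definition S3 :: "quat set" where
  "S3 = {x. x \<bullet>\<^sub>H qcnj x = qone}"


section \<open>Calculus on the sphere\<close>

text \<open>The tangent space of \<^term>\<open>S3\<close> at \<open>x\<close> is the orthogonal complement of \<open>x\<close> in
  \<^typ>\<open>quat\<close>. For \<open>v\<close> in it, \<open>t \<mapsto> sgn (x + t v)\<close> is a curve in \<^term>\<open>S3\<close> through \<open>x\<close> with
  velocity \<open>v\<close> at \<open>t = 0\<close>; hence only the values of \<open>f\<close> on \<^term>\<open>S3\<close> matter below.\<close>

definition tangent_deriv :: "(quat \<Rightarrow> 'b::real_normed_vector) \<Rightarrow> quat \<Rightarrow> quat \<Rightarrow> 'b" where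
  "tangent_deriv f x v = vector_derivative (\<lambda>t. f (sgn (x + t *\<^sub>R v))) (at 0)"

primrec Ck_on :: "nat \<Rightarrow> 'a set \<Rightarrow> ('a::real_normed_vector \<Rightarrow> 'b::real_normed_vector) \<Rightarrow> bool" where
  "Ck_on 0 U f \<longleftrightarrow> continuous_on U f"
| "Ck_on (Suc k) U f \<longleftrightarrow> (\<forall>x\<in>U. f differentiable (at x)) \<and>
     (\<forall>v. Ck_on k U (\<lambda>x. frechet_derivative f (at x) v))"

definition smooth_on_S3 :: "(quat \<Rightarrow> 'b::real_normed_vector) \<Rightarrow> bool" where
  "smooth_on_S3 f \<longleftrightarrow>
     (\<exists>U F. open U \<and> S3 \<subseteq> U \<and> (\<forall>k. Ck_on k U F) \<and> (\<forall>x\<in>S3. F x = f x))"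


section \<open>The left-invariant metric and its scalar curvature\<close>

text \<open>Vector fields on \<^term>\<open>S3\<close> are represented as maps \<^typ>\<open>quat \<Rightarrow> quat\<close>, with \<open>V x\<close> tangent
  at \<open>x\<close> for \<open>x \<in> S3\<close>; values outside \<^term>\<open>S3\<close> are irrelevant.\<close>

type_synonym vfield = "quat \<Rightarrow> quat"
type_synonym metric = "quat \<Rightarrow> quat \<Rightarrow> quat \<Rightarrow> real"

definition left_invariant :: "quat \<Rightarrow> vfield" where
  "left_invariant u x = x \<bullet>\<^sub>H u"

definition frame :: "real \<Rightarrow> real \<Rightarrow> real \<Rightarrow> 3 \<Rightarrow> vfield" where
  "frame a b c l = left_invariant ((vector [a *\<^sub>R qi, b *\<^sub>R qj, c *\<^sub>R qk] :: quat ^ 3) $ l)"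

text \<open>Pull tangent vectors at \<open>x\<close> back to \<open>1\<close> by left translation with the inverse
  \<^term>\<open>qcnj x\<close> of \<open>x\<close>, and use the inner product on the span of \<open>i, j, k\<close> for which
  \<open>a i, b j, c k\<close> are orthonormal.\<close>

definition metric_abc :: "real \<Rightarrow> real \<Rightarrow> real \<Rightarrow> metric" where
  "metric_abc a b c x v w =
    (let v' = qcnj x \<bullet>\<^sub>H v; w' = qcnj x \<bullet>\<^sub>H w
     in v'$2 * w'$2 / a\<^sup>2 + v'$3 * w'$3 / b\<^sup>2 + v'$4 * w'$4 / c\<^sup>2)"

definition bracket :: "vfield \<Rightarrow> vfield \<Rightarrow> vfield" where
  "bracket V W x = tangent_deriv W x (V x) - tangent_deriv V x (W x)"

text \<open>The right-hand side of the Koszul formula for \<open>2 g(\<nabla>\<^sub>V W, Z)\<close>.\<close>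

definition koszul :: "metric \<Rightarrow> vfield \<Rightarrow> vfield \<Rightarrow> vfield \<Rightarrow> quat \<Rightarrow> real" where
  "koszul g V W Z x =
     tangent_deriv (\<lambda>y. g y (W y) (Z y)) x (V x)
   + tangent_deriv (\<lambda>y. g y (Z y) (V y)) x (W x)
   - tangent_deriv (\<lambda>y. g y (V y) (W y)) x (Z x)
   + g x (bracket V W x) (Z x)
   - g x (bracket W Z x) (V x)
   + g x (bracket Z V x) (W x)"

text \<open>Levi-Civita connection, curvature tensor and scalar curvature of \<open>g\<close>, expanded in
  a global \<open>g\<close>-orthonormal frame \<open>E\<close>.\<close>

definition levi_civita :: "metric \<Rightarrow> (3 \<Rightarrow> vfield) \<Rightarrow> vfield \<Rightarrow> vfield \<Rightarrow> vfield" where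
  "levi_civita g E V W x = (\<Sum>l\<in>UNIV. (koszul g V W (E l) x / 2) *\<^sub>R E l x)"

definition curvature :: "metric \<Rightarrow> (3 \<Rightarrow> vfield) \<Rightarrow> vfield \<Rightarrow> vfield \<Rightarrow> vfield \<Rightarrow> vfield" where
  "curvature g E V W Z x =
     levi_civita g E V (levi_civita g E W Z) x
   - levi_civita g E W (levi_civita g E V Z) x
   - levi_civita g E (bracket V W) Z x"

definition scalar_curvature :: "metric \<Rightarrow> (3 \<Rightarrow> vfield) \<Rightarrow> quat \<Rightarrow> real" where
  "scalar_curvature g E x =
     (\<Sum>i\<in>UNIV. \<Sum>j\<in>UNIV. g x (curvature g E (E i) (E j) (E j) x) (E i x))"

definition scal_abc :: "real \<Rightarrow> real \<Rightarrow> real \<Rightarrow> quat \<Rightarrow> real" where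
  "scal_abc a b c = scalar_curvature (metric_abc a b c) (frame a b c)"


section \<open>Dirac operators\<close>

type_synonym spinor = "complex ^ 2"

definition clifford :: "3 \<Rightarrow> complex ^ 2 ^ 2" where
  "clifford l = (vector
    [vector [vector [\<i>, 0], vector [0, - \<i>]],
     vector [vector [0, 1], vector [- 1, 0]],
     vector [vector [0, \<i>], vector [\<i>, 0]]] :: complex ^ 2 ^ 2 ^ 3) $ l"

definition C_abc :: "real \<Rightarrow> real \<Rightarrow> real \<Rightarrow> real" where
  "C_abc a b c = 1/2 * (a * b / c + b * c / a + c * a / b)"

text \<open>A spinor field on \<^term>\<open>S3\<close> is represented by its extension by zero to \<^typ>\<open>quat\<close>, so that
  spaces of spinor fields are genuine complex vector spaces of functions.\<close>

definition spinors :: "(quat \<Rightarrow> spinor) set" where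
  "spinors = {\<phi>. smooth_on_S3 \<phi> \<and> (\<forall>x. x \<notin> S3 \<longrightarrow> \<phi> x = 0)}"

text \<open>Spinor fields on \<open>SO(3) = S\<^sup>3/{\<plusminus>1}\<close> for its trivial and nontrivial spin structure,
  as equivariant spinor fields on \<open>S\<^sup>3\<close>.\<close>

definition spinors_trivial :: "(quat \<Rightarrow> spinor) set" where
  "spinors_trivial = {\<phi> \<in> spinors. \<forall>x\<in>S3. \<phi> (- x) = \<phi> x}"

definition spinors_nontrivial :: "(quat \<Rightarrow> spinor) set" where
  "spinors_nontrivial = {\<phi> \<in> spinors. \<forall>x\<in>S3. \<phi> (- x) = - \<phi> x}"

text \<open>The sign \<open>\<epsilon>\<close> encodes the orientation: \<open>1\<close> for the one in which \<open>i, j, k\<close> is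
  positively oriented, \<open>- 1\<close> for the opposite one. On \<open>SO(3)\<close> the Dirac operators are the
  restrictions of this operator to \<^term>\<open>spinors_trivial\<close> and \<^term>\<open>spinors_nontrivial\<close>.\<close>

definition dirac :: "real \<Rightarrow> real \<Rightarrow> real \<Rightarrow> real \<Rightarrow> (quat \<Rightarrow> spinor) \<Rightarrow> quat \<Rightarrow> spinor" where
  "dirac \<epsilon> a b c \<phi> x =
    (if x \<in> S3 then
       \<epsilon> *\<^sub>R ((\<Sum>l\<in>UNIV. clifford l *v tangent_deriv \<phi> x (frame a b c l x))
         + C_abc a b c *\<^sub>R (clifford 1 *v (clifford 2 *v (clifford 3 *v \<phi> x))))
     else 0)"


section \<open>Spectrum and multiplicities\<close>

definition spinor_scale :: "complex \<Rightarrow> (quat \<Rightarrow> spinor) \<Rightarrow> quat \<Rightarrow> spinor" where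
  "spinor_scale z \<phi> x = z *s \<phi> x"

lemma vector_space_spinor_scale: "vector_space spinor_scale"
  by unfold_locales
    (auto simp: spinor_scale_def fun_eq_iff vec_eq_iff algebra_simps)

definition eigenspace ::
  "(quat \<Rightarrow> spinor) set \<Rightarrow> ((quat \<Rightarrow> spinor) \<Rightarrow> quat \<Rightarrow> spinor) \<Rightarrow> complex \<Rightarrow> (quat \<Rightarrow> spinor) set"
where
  "eigenspace V T z = {\<phi> \<in> V. T \<phi> = spinor_scale z \<phi>}"

definition spec ::
  "(quat \<Rightarrow> spinor) set \<Rightarrow> ((quat \<Rightarrow> spinor) \<Rightarrow> quat \<Rightarrow> spinor) \<Rightarrow> complex set"
where
  "spec V T = {z. \<exists>\<phi>\<in>eigenspace V T z. \<phi> \<noteq> 0}"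

definition multiplicity_of ::
  "(quat \<Rightarrow> spinor) set \<Rightarrow> ((quat \<Rightarrow> spinor) \<Rightarrow> quat \<Rightarrow> spinor) \<Rightarrow> complex \<Rightarrow> nat"
where
  "multiplicity_of V T z = vector_space.dim spinor_scale (eigenspace V T z)"

definition is_minimum :: "real \<Rightarrow> real set \<Rightarrow> bool" where
  "is_minimum m A \<longleftrightarrow> m \<in> A \<and> (\<forall>r\<in>A. m \<le> r)"

definition smallest_eigenvalue ::
  "(quat \<Rightarrow> spinor) set \<Rightarrow> ((quat \<Rightarrow> spinor) \<Rightarrow> quat \<Rightarrow> spinor) \<Rightarrow> real \<Rightarrow> bool"
where
  "smallest_eigenvalue V T r \<longleftrightarrow>
     of_real r \<in> spec V T \<and> (\<forall>z\<in>spec V T. z \<in> \<real> \<and> r \<le> Re z)"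

end

theory Submission
  imports Defs
begin

text \<open>Write \<open>D = a T\<^sub>1 + b T\<^sub>2 + c T\<^sub>3 - C\<close> with \<open>T\<^sub>l = e\<^sub>l \<cdot> Y\<^sub>l\<close>, where \<open>Y\<^sub>l\<close> is the derivative along
  \<open>i\<close>, \<open>j\<close> or \<open>k\<close>. The \<open>T\<^sub>l\<close> are symmetric and \<open>T\<^sub>1 T\<^sub>2 + T\<^sub>2 T\<^sub>1 = 2 T\<^sub>3\<close> cyclically, so with
  \<open>k\<^sub>1 = a C - b c\<close> etc. \<open>D\<^sup>2 - C\<^sup>2 = \<Sum> (a\<^sub>l\<^sup>2 T\<^sub>l\<^sup>2 - 2 k\<^sub>l T\<^sub>l)\<close> is a sum of quadratic polynomials in
  the single \<open>T\<^sub>l\<close>. On even (odd) fields each \<open>T\<^sub>l\<close> has even (odd) integer spectrum, and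
  positivity of the scalar curvature, \<open>C\<^sup>2 < a\<^sup>2 + b\<^sup>2 + c\<^sup>2\<close>, means \<open>\<bar>k\<^sub>l\<bar> < a\<^sub>l\<^sup>2\<close>. On even fields each
  summand is therefore nonnegative, with equality only for constant fields. On odd fields
  \<open>D\<^sup>2 - \<mu>\<^sup>2 = \<Sum> (a\<^sub>l\<^sup>2 (T\<^sub>l\<^sup>2 - 1) - 2 k\<^sub>l (T\<^sub>l - 1))\<close>; if all \<open>k\<^sub>l \<ge> 0\<close> this is a nonnegative combination of
  \<open>T\<^sub>l\<^sup>2 - 1 \<ge> 0\<close> and \<open>(T\<^sub>l - 1)\<^sup>2\<close>, and if one of them, say \<open>k\<^sub>3\<close>, is negative (at most one is), then
  one splits off a square \<open>(u T\<^sub>1 + v T\<^sub>2 - (u + v))\<^sup>2\<close> with \<open>u v = - k\<^sub>3\<close>. Equality forces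
  \<open>T\<^sub>l f = f\<close> for all \<open>l\<close>, which is solved by the two-dimensional space of Killing spinors
  \<open>x \<mapsto> \<rho>(x)\<^sup>-\<^sup>1 v\<close>.\<close>


section \<open>Quaternions\<close>

text \<open>Eigenvalue bounds are read off from L2 bounds: an eigenfield satisfies |D f|^2 = |z|^2
  |f|^2, so |D f|^2 >= m^2 |f|^2 for all smooth fields of one parity bounds |z|, and explicit
  constant or Killing fields attain the bound. The integer spectrum of T_l enters in the same
  spirit, through two inequalities: |f|^2 <= |T_l f|^2 for odd fields and 2 |<T_l f, f>| <= |T_l
  f|^2 for even ones. The obstacle is the odd case with k_3 < 0. At T_3 = -1 the polynomial c^2
  (T_3^2 - 1) - 2 k_3 (T_3 - 1) takes the value 4 k_3 < 0, so the third summand is not nonnegative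
  by itself. The anticommutator allows a trade: the square of u T_1 + v T_2 - (u + v) contains the
  term 2 u v T_3, and its other terms are charged to T_1 and T_2. That enough remains there depends
  on |k_3| < c^2, hence on the scalar curvature. The even and the odd minimum, C and \<mu>, coincide
  exactly in the round case; then the two eigenspaces of dimension 2 add up to dimension 4.\<close>

lemma vector_4 [simp]:
  "(vector [x, y, z, w] :: 'a::zero ^ 4) $ 1 = x"
  "(vector [x, y, z, w] :: 'a ^ 4) $ 2 = y"
  "(vector [x, y, z, w] :: 'a ^ 4) $ 3 = z"
  "(vector [x, y, z, w] :: 'a ^ 4) $ 4 = w"
  by (simp_all add: vector_def)

lemma qmult_nth [simp]:
  "(x \<bullet>\<^sub>H y) $ 1 = x$1 * y$1 - x$2 * y$2 - x$3 * y$3 - x$4 * y$4"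
  "(x \<bullet>\<^sub>H y) $ 2 = x$1 * y$2 + x$2 * y$1 + x$3 * y$4 - x$4 * y$3"
  "(x \<bullet>\<^sub>H y) $ 3 = x$1 * y$3 - x$2 * y$4 + x$3 * y$1 + x$4 * y$2"
  "(x \<bullet>\<^sub>H y) $ 4 = x$1 * y$4 + x$2 * y$3 - x$3 * y$2 + x$4 * y$1"
  by (simp_all add: qmult_def)

lemma quat_nth [simp]:
  "qone $ 1 = 1" "qone $ 2 = 0" "qone $ 3 = 0" "qone $ 4 = 0"
  "qi $ 1 = 0" "qi $ 2 = 1" "qi $ 3 = 0" "qi $ 4 = 0"
  "qj $ 1 = 0" "qj $ 2 = 0" "qj $ 3 = 1" "qj $ 4 = 0"
  "qk $ 1 = 0" "qk $ 2 = 0" "qk $ 3 = 0" "qk $ 4 = 1"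
  "qcnj x $ 1 = x $ 1" "qcnj x $ 2 = - x $ 2" "qcnj x $ 3 = - x $ 3" "qcnj x $ 4 = - x $ 4"
  by (simp_all add: qone_def qi_def qj_def qk_def qcnj_def)

lemma quat_eq_iff: "x = y \<longleftrightarrow> x$1 = y$1 \<and> x$2 = y$2 \<and> x$3 = y$3 \<and> x$4 = y$4"
  for x y :: quat
  by (simp add: vec_eq_iff forall_4)

lemma inner_quat: "x \<bullet> y = x$1 * y$1 + x$2 * y$2 + x$3 * y$3 + x$4 * y$4"
  for x y :: quat
  by (simp add: inner_vec_def sum_4)

lemma qmult_assoc: "x \<bullet>\<^sub>H y \<bullet>\<^sub>H z = x \<bullet>\<^sub>H (y \<bullet>\<^sub>H z)"
  by (simp add: quat_eq_iff algebra_simps)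

lemma bounded_bilinear_qmult: "bounded_bilinear (\<bullet>\<^sub>H)"
  by (intro bilinear_conv_bounded_bilinear[THEN iffD1])
    (auto simp: bilinear_def intro!: linearI simp: quat_eq_iff algebra_simps)

interpretation qmult: bounded_bilinear "(\<bullet>\<^sub>H)"
  by (rule bounded_bilinear_qmult)

lemma qmult_one [simp]: "qone \<bullet>\<^sub>H x = x" "x \<bullet>\<^sub>H qone = x"
  by (simp_all add: quat_eq_iff)

text \<open>Euler's four-square identity.\<close>

lemma norm_qmult: "norm (x \<bullet>\<^sub>H y) = norm x * norm y"
proof -
  have "(x \<bullet>\<^sub>H y) \<bullet> (x \<bullet>\<^sub>H y) = (x \<bullet> x) * (y \<bullet> y)"
    by (simp add: inner_quat) algebra
  then show ?thesis
    by (simp add: norm_eq_sqrt_inner real_sqrt_mult)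
qed

lemma mem_S3_iff: "x \<in> S3 \<longleftrightarrow> norm x = 1"
proof -
  have "x \<in> S3 \<longleftrightarrow> x \<bullet> x = 1"
    by (auto simp: S3_def quat_eq_iff inner_quat algebra_simps)
  then show ?thesis
    by (simp add: norm_eq_sqrt_inner)
qed

lemma S3_eq_sphere: "S3 = sphere 0 1"
  by (auto simp: mem_S3_iff)

lemma compact_S3: "compact S3"
  by (simp add: S3_eq_sphere)

lemma S3_qmult: "x \<in> S3 \<Longrightarrow> y \<in> S3 \<Longrightarrow> x \<bullet>\<^sub>H y \<in> S3"
  by (simp add: mem_S3_iff norm_qmult)

lemma S3_uminus: "x \<in> S3 \<Longrightarrow> - x \<in> S3"
  by (simp add: mem_S3_iff)

lemma qone_in_S3: "qone \<in> S3"
  by (simp add: S3_def quat_eq_iff)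

lemma qcnj_qmult_cancel: "x \<in> S3 \<Longrightarrow> qcnj x \<bullet>\<^sub>H (x \<bullet>\<^sub>H y) = y"
proof -
  assume "x \<in> S3"
  then have "qcnj x \<bullet>\<^sub>H x = qone"
    by (auto simp: S3_def quat_eq_iff algebra_simps)
  then show ?thesis
    by (simp flip: qmult_assoc)
qed

lemma inner_qmult_left: "(x \<bullet>\<^sub>H y) \<bullet> (x \<bullet>\<^sub>H z) = (x \<bullet> x) * (y \<bullet> z)"
  by (simp add: inner_quat) algebra

lemma sgn_in_S3: "x \<noteq> 0 \<Longrightarrow> sgn x \<in> S3"
  by (simp add: mem_S3_iff norm_sgn)

section \<open>One-parameter subgroups: \<open>qexp u t\<close> is exp (t u) for an imaginary unit
  \<open>u\<close>\<close>

definition qexp :: "quat \<Rightarrow> real \<Rightarrow> quat" where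
  "qexp u t = cos t *\<^sub>R qone + sin t *\<^sub>R u"

lemma qexp_0 [simp]: "qexp u 0 = qone"
  by (simp add: qexp_def)

lemma qexp_pi [simp]: "x \<bullet>\<^sub>H qexp u pi = - x"
  by (simp add: qexp_def qmult.diff_right qmult.scaleR_right qmult.minus_right)

locale imaginary_unit =
  fixes u :: quat
  assumes re_zero: "u $ 1 = 0" and norm_one: "norm u = 1"
begin

lemma square: "u \<bullet>\<^sub>H u = - qone"
  using norm_one by (auto simp: norm_eq_sqrt_inner inner_quat quat_eq_iff re_zero algebra_simps)

lemma qexp_add: "qexp u (s + t) = qexp u s \<bullet>\<^sub>H qexp u t"
  by (simp add: qexp_def cos_add sin_add qmult.add_left qmult.add_right qmult.scaleR_left
      qmult.scaleR_right square algebra_simps)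

lemma qexp_in_S3: "qexp u t \<in> S3"
proof -
  have "norm u ^ 2 = 1"
    using norm_one by simp
  then have *: "u$2 * u$2 + u$3 * u$3 + u$4 * u$4 = 1"
    by (simp add: power2_norm_eq_inner inner_quat re_zero)
  have "qexp u t \<bullet> qexp u t = (cos t)\<^sup>2 + (sin t)\<^sup>2 * (u$2 * u$2 + u$3 * u$3 + u$4 * u$4)"
    unfolding qexp_def inner_quat by (simp add: re_zero power2_eq_square algebra_simps)
  then show ?thesis
    unfolding * by (simp add: mem_S3_iff norm_eq_sqrt_inner)
qed

lemma has_vector_derivative_qexp:
  "((\<lambda>t. x \<bullet>\<^sub>H qexp u t) has_vector_derivative (x \<bullet>\<^sub>H qexp u t) \<bullet>\<^sub>H u) (at t)"
proof -
  have "(qexp u has_vector_derivative (- sin t) *\<^sub>R qone + cos t *\<^sub>R u) (at t)"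
    unfolding qexp_def by (auto intro!: derivative_eq_intros)
  moreover have "(- sin t) *\<^sub>R qone + cos t *\<^sub>R u = qexp u t \<bullet>\<^sub>H u"
    by (simp add: qexp_def qmult.add_left qmult.scaleR_left square)
  ultimately have "((\<lambda>t. x \<bullet>\<^sub>H qexp u t) has_vector_derivative x \<bullet>\<^sub>H (qexp u t \<bullet>\<^sub>H u)) (at t)"
    using bounded_linear.has_vector_derivative[OF qmult.bounded_linear_right] by metis
  then show ?thesis
    by (simp add: qmult_assoc)
qed

end

lemma imaginary_unit_basis: "imaginary_unit qi" "imaginary_unit qj" "imaginary_unit qk"
  by (unfold_locales, simp_all add: norm_eq_sqrt_inner inner_quat)

text \<open>Polar form: the real part is cos t and the imaginary part has length sin t. It joins
  every point to \<open>qone\<close> by a one-parameter subgroup, which later serves as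
  connectedness of the sphere.\<close>

lemma S3_eq_qexp:
  assumes "x \<in> S3"
  obtains u t where "imaginary_unit u" "x = qexp u t"
proof -
  define w where "w = x - x$1 *\<^sub>R qone"
  have w: "w $ 1 = 0" "x = x$1 *\<^sub>R qone + w"
    by (simp_all add: w_def)
  have "x \<bullet> x = 1"
    using assms by (simp add: mem_S3_iff norm_eq_1)
  then have "(x$1)\<^sup>2 + (norm w)\<^sup>2 = 1"
    by (simp only: power2_norm_eq_inner inner_quat) (simp add: w_def power2_eq_square)
  then obtain t where t: "x$1 = cos t" "norm w = sin t"
    by (metis sincos_total_2pi)
  show thesis
  proof (cases "w = 0")
    case True
    \<comment> \<open>Here \<open>x\<close> is real and sin t = 0, so any imaginary unit
      serves.\<close>
    with t have "x = qexp qi t"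
      using w(2) by (simp add: qexp_def)
    then show thesis
      using that imaginary_unit_basis(1) by blast
  next
    case False
    then have "imaginary_unit (w /\<^sub>R norm w)"
      by unfold_locales (simp_all add: w)
    moreover have "x = qexp (w /\<^sub>R norm w) t"
      using w(2) False by (simp add: qexp_def flip: t)
    ultimately show thesis
      using that by blast
  qed
qed


section \<open>Smooth maps\<close>

lemma Ck_on_subset: "Ck_on k U f \<Longrightarrow> V \<subseteq> U \<Longrightarrow> Ck_on k V f"
  by (induction k arbitrary: f) (auto intro: continuous_on_subset)

text \<open>\<open>frechet_derivative\<close> is taken in the ambient space, so agreement on an open
  set passes to the derivatives. The main use is to replace the derivative of a compound map by its
  computed formula.\<close>

lemma Ck_on_cong:
  assumes "open U" "\<And>x. x \<in> U \<Longrightarrow> f x = g x" "Ck_on k U f"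
  shows "Ck_on k U g"
  using assms(2,3)
proof (induction k arbitrary: f g)
  case 0
  then show ?case
    using continuous_on_cong[of U U f g] by simp
next
  case (Suc k)
  have d: "(g has_derivative frechet_derivative f (at x)) (at x)" if "x \<in> U" for x
    using Suc.prems that assms(1) has_derivative_transform_within_open[of f _ x UNIV U g]
    by (simp add: frechet_derivative_works)
  then have "frechet_derivative g (at x) = frechet_derivative f (at x)" if "x \<in> U" for x
    using frechet_derivative_at that by metis
  with Suc.prems Suc.IH[of "\<lambda>x. frechet_derivative f (at x) v" "\<lambda>x. frechet_derivative g (at x) v" for v]
  show ?case
    by (auto simp: differentiable_def intro: d)
qed

text \<open>All orders at once: the product rule mixes a map with its derivatives, and an induction
  over \<open>k\<close> closes easily when every factor is known to be smooth to all orders.\<close>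

definition smooth_on :: "'a set \<Rightarrow> ('a::real_normed_vector \<Rightarrow> 'b::real_normed_vector) \<Rightarrow> bool" where
  "smooth_on U f \<longleftrightarrow> (\<forall>k. Ck_on k U f)"

lemma smooth_on_differentiable: "smooth_on U f \<Longrightarrow> x \<in> U \<Longrightarrow> f differentiable (at x)"
  unfolding smooth_on_def by (metis Ck_on.simps(2))

lemma smooth_on_has_derivative:
  "smooth_on U f \<Longrightarrow> x \<in> U \<Longrightarrow> (f has_derivative frechet_derivative f (at x)) (at x)"
  using smooth_on_differentiable frechet_derivative_works by blast

lemma smooth_on_frechet_derivative:
  "smooth_on U f \<Longrightarrow> smooth_on U (\<lambda>x. frechet_derivative f (at x) v)"
  unfolding smooth_on_def by (metis Ck_on.simps(2))

lemma smooth_on_continuous_on: "smooth_on U f \<Longrightarrow> continuous_on U f"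
  unfolding smooth_on_def by (metis Ck_on.simps(1))

lemma smooth_on_subset: "smooth_on U f \<Longrightarrow> V \<subseteq> U \<Longrightarrow> smooth_on V f"
  unfolding smooth_on_def using Ck_on_subset by blast

lemma smooth_on_cong:
  assumes "open U" "\<And>x. x \<in> U \<Longrightarrow> f x = g x" "smooth_on U f"
  shows "smooth_on U g"
  using Ck_on_cong[OF assms(1,2)] assms(3) by (simp add: smooth_on_def)

lemma smooth_on_const: "smooth_on U (\<lambda>x. c)"
proof -
  have "Ck_on k U (\<lambda>x. c)" for k
    by (induction k arbitrary: c) auto
  then show ?thesis
    by (simp add: smooth_on_def)
qed

lemma smooth_on_ident: "smooth_on U (\<lambda>x. x)"
proof -
  have "Ck_on k U (\<lambda>x. x)" for k
    by (cases k) (use smooth_on_const[unfolded smooth_on_def] in auto)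
  then show ?thesis
    by (simp add: smooth_on_def)
qed

lemma Ck_on_add:
  assumes U: "open U" and "Ck_on k U f" "Ck_on k U g"
  shows "Ck_on k U (\<lambda>x. f x + g x)"
  using assms(2,3)
proof (induction k arbitrary: f g)
  case 0
  then show ?case
    by (auto intro: continuous_intros)
next
  case (Suc k)
  then have d: "((\<lambda>x. f x + g x) has_derivative
      (\<lambda>v. frechet_derivative f (at x) v + frechet_derivative g (at x) v)) (at x)" if "x \<in> U" for x
    using that by (intro has_derivative_add) (auto simp flip: frechet_derivative_works)
  have "frechet_derivative f (at x) v + frechet_derivative g (at x) v
    = frechet_derivative (\<lambda>x. f x + g x) (at x) v" if "x \<in> U" for x v
    using frechet_derivative_at[OF d[OF that]] by metis
  moreover have "Ck_on k U (\<lambda>x. frechet_derivative f (at x) v + frechet_derivative g (at x) v)" for v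
    using Suc by simp
  ultimately have "Ck_on k U (\<lambda>x. frechet_derivative (\<lambda>x. f x + g x) (at x) v)" for v
    by (rule Ck_on_cong[OF U])
  then show ?case
    using d by (auto simp: differentiable_def)
qed

lemma smooth_on_add:
  "open U \<Longrightarrow> smooth_on U f \<Longrightarrow> smooth_on U g \<Longrightarrow> smooth_on U (\<lambda>x. f x + g x)"
  by (simp add: smooth_on_def Ck_on_add)

lemma smooth_on_bilinear:
  assumes h: "bounded_bilinear h" and U: "open U" and "smooth_on U f" "smooth_on U g"
  shows "smooth_on U (\<lambda>x. h (f x) (g x))"
proof -
  have "Ck_on k U (\<lambda>x. h (f x) (g x))" for k
    using assms(3,4)
  proof (induction k arbitrary: f g)
    case 0
    then show ?case
      by (simp add: bounded_bilinear.continuous_on[OF h] smooth_on_continuous_on)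
  next
    case (Suc k)
    have d: "((\<lambda>x. h (f x) (g x)) has_derivative
        (\<lambda>v. h (f x) (frechet_derivative g (at x) v) + h (frechet_derivative f (at x) v) (g x))) (at x)"
      if "x \<in> U" for x
      using that Suc.prems by (intro bounded_bilinear.FDERIV[OF h] smooth_on_has_derivative)
    have "h (f x) (frechet_derivative g (at x) v) + h (frechet_derivative f (at x) v) (g x)
      = frechet_derivative (\<lambda>x. h (f x) (g x)) (at x) v" if "x \<in> U" for x v
      using frechet_derivative_at[OF d[OF that]] by metis
    moreover have "Ck_on k U (\<lambda>x. h (f x) (frechet_derivative g (at x) v)
        + h (frechet_derivative f (at x) v) (g x))" for v
      using Suc by (intro Ck_on_add[OF U] Suc.IH smooth_on_frechet_derivative)
    ultimately have "Ck_on k U (\<lambda>x. frechet_derivative (\<lambda>x. h (f x) (g x)) (at x) v)" for v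
      by (rule Ck_on_cong[OF U])
    then show ?case
      using d by (auto simp: differentiable_def)
  qed
  then show ?thesis
    by (simp add: smooth_on_def)
qed

lemma smooth_on_bounded_linear:
  assumes h: "bounded_linear h" and U: "open U" and "smooth_on U f"
  shows "smooth_on U (\<lambda>x. h (f x))"
proof -
  \<comment> \<open>Pairing with the constant 1 reduces the linear case to the bilinear one.\<close>
  have "bounded_bilinear (\<lambda>r x. r *\<^sub>R h x)"
    by (rule bounded_bilinear.comp[OF bounded_bilinear_scaleR bounded_linear_ident h])
  from smooth_on_bilinear[OF this U smooth_on_const[of U "1"] assms(3)]
  show ?thesis by simp
qed

lemma smooth_on_compose_uminus:
  assumes "open U" "smooth_on U f"
  shows "smooth_on (uminus ` U) (\<lambda>x. f (- x))"
proof -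
  have *: "Ck_on k (uminus ` U) (\<lambda>x. f (- x))" if "smooth_on U f" for k f
    using that
  proof (induction k arbitrary: f)
    case 0
    have "continuous_on (uminus ` U) (\<lambda>x. f (- x))"
      by (rule continuous_on_compose2[OF smooth_on_continuous_on[OF 0]]) (auto intro: continuous_intros)
    then show ?case by simp
  next
    case (Suc k)
    have d: "((\<lambda>x. f (- x)) has_derivative (\<lambda>v. frechet_derivative f (at (- x)) (- v))) (at x)"
      if "x \<in> uminus ` U" for x
      using that
      by (intro has_derivative_compose[OF has_derivative_minus[OF has_derivative_ident]]
          smooth_on_has_derivative[OF Suc.prems]) auto
    have "frechet_derivative f (at (- x)) (- v) = frechet_derivative (\<lambda>x. f (- x)) (at x) v"
      if "x \<in> uminus ` U" for x v
      using frechet_derivative_at[OF d[OF that]] by metis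
    moreover have "Ck_on k (uminus ` U) (\<lambda>x. frechet_derivative f (at (- x)) (- v))" for v
      using Suc.IH[of "\<lambda>x. frechet_derivative f (at x) (- v)"] Suc.prems smooth_on_frechet_derivative
      by blast
    ultimately have "Ck_on k (uminus ` U) (\<lambda>x. frechet_derivative (\<lambda>x. f (- x)) (at x) v)" for v
      by (rule Ck_on_cong[OF open_negations[OF \<open>open U\<close>]])
    then show ?case
      using d by (auto simp: differentiable_def)
  qed
  show ?thesis
    using *[OF assms(2)] by (simp add: smooth_on_def)
qed

lemma smooth_on_sum:
  assumes "open U" "\<And>i. i \<in> A \<Longrightarrow> smooth_on U (f i)"
  shows "smooth_on U (\<lambda>x. \<Sum>i\<in>A. f i x)"
  using assms(2) by (induction A rule: infinite_finite_induct)
    (auto intro: smooth_on_add[OF assms(1)] smooth_on_const)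

section \<open>Point-dependent directions and symmetry of second derivatives\<close>

lemma frechet_derivative_euclidean:
  fixes f :: "'a::euclidean_space \<Rightarrow> 'b::real_normed_vector"
  assumes "f differentiable (at x)"
  shows "frechet_derivative f (at x) v = (\<Sum>b\<in>Basis. (v \<bullet> b) *\<^sub>R frechet_derivative f (at x) b)"
proof -
  interpret linear "frechet_derivative f (at x)"
    by (rule linear_frechet_derivative[OF assms])
  have "frechet_derivative f (at x) (\<Sum>b\<in>Basis. (v \<bullet> b) *\<^sub>R b)
    = (\<Sum>b\<in>Basis. (v \<bullet> b) *\<^sub>R frechet_derivative f (at x) b)"
    by (simp add: sum scale)
  then show ?thesis
    by (simp add: euclidean_representation)
qed

text \<open>\<open>Ck_on\<close> differentiates in constant directions, while a left-invariant field
  points in the direction \<open>x \<bullet>\<^sub>H u\<close>, which is linear in \<open>x\<close>.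
  Expansion in a basis reduces the latter to the former.\<close>

lemma smooth_on_frechet_derivative_linear:
  fixes f :: "'a::euclidean_space \<Rightarrow> 'b::real_normed_vector"
  assumes U: "open U" and f: "smooth_on U f" and L: "bounded_linear L"
  shows "smooth_on U (\<lambda>x. frechet_derivative f (at x) (L x))"
proof -
  have "smooth_on U (\<lambda>x. \<Sum>b\<in>Basis. (L x \<bullet> b) *\<^sub>R frechet_derivative f (at x) b)"
    using bounded_linear_compose[OF bounded_linear_inner_left L]
    by (intro smooth_on_sum[OF U] smooth_on_bilinear[OF bounded_bilinear_scaleR U]
        smooth_on_bounded_linear[OF _ U smooth_on_ident] smooth_on_frechet_derivative[OF f])
  moreover have "(\<Sum>b\<in>Basis. (L x \<bullet> b) *\<^sub>R frechet_derivative f (at x) b) = frechet_derivative f (at x) (L x)"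
    if "x \<in> U" for x
    using frechet_derivative_euclidean[OF smooth_on_differentiable[OF f that], of "L x"] by simp
  ultimately show ?thesis
    by (rule smooth_on_cong[OF U, rotated])
qed

lemma has_vector_derivative_along_line:
  assumes "f differentiable (at (x + t *\<^sub>R v))"
  shows "((\<lambda>t. f (x + t *\<^sub>R v)) has_vector_derivative frechet_derivative f (at (x + t *\<^sub>R v)) v) (at t)"
proof -
  have "((\<lambda>t. x + t *\<^sub>R v) has_derivative (\<lambda>s. s *\<^sub>R v)) (at t)"
    by (auto intro!: derivative_eq_intros)
  from has_derivative_compose[OF this] assms[unfolded frechet_derivative_works]
  have "((\<lambda>t. f (x + t *\<^sub>R v)) has_derivative (\<lambda>s. frechet_derivative f (at (x + t *\<^sub>R v)) (s *\<^sub>R v))) (at t)"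
    by blast
  then show ?thesis
    using linear_frechet_derivative[OF assms] by (simp add: has_vector_derivative_def linear_cmul)
qed

text \<open>The mean value theorem is applied to the second difference over a parallelogram, once in
  direction \<open>v\<close> and once in direction \<open>w\<close>. The second difference itself is
  symmetric in \<open>v\<close> and \<open>w\<close>.\<close>

lemma mixed_difference_mean_value:
  fixes f :: "'a::euclidean_space \<Rightarrow> real"
  assumes f: "smooth_on U f" and h: "h > 0"
    and U: "\<And>s t. \<lbrakk>0 \<le> s; s \<le> h; 0 \<le> t; t \<le> h\<rbrakk> \<Longrightarrow> x + s *\<^sub>R v + t *\<^sub>R w \<in> U"
  obtains s t where "0 < s" "s < h" "0 < t" "t < h"
    "f (x + h *\<^sub>R v + h *\<^sub>R w) - f (x + h *\<^sub>R v) - f (x + h *\<^sub>R w) + f x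
      = h\<^sup>2 * frechet_derivative (\<lambda>y. frechet_derivative f (at y) v) (at (x + s *\<^sub>R v + t *\<^sub>R w)) w"
proof -
  define \<phi> where "\<phi> s = f (x + h *\<^sub>R w + s *\<^sub>R v) - f (x + s *\<^sub>R v)" for s
  have d: "(\<phi> has_real_derivative frechet_derivative f (at (x + h *\<^sub>R w + s *\<^sub>R v)) v
      - frechet_derivative f (at (x + s *\<^sub>R v)) v) (at s)" if "0 \<le> s" "s \<le> h" for s
    unfolding \<phi>_def has_real_derivative_iff_has_vector_derivative
    using U[of s h] U[of s 0] that h
    by (intro has_vector_derivative_diff has_vector_derivative_along_line smooth_on_differentiable[OF f])
      (simp_all add: algebra_simps)
  obtain s where s: "0 < s" "s < h" and "\<phi> h - \<phi> 0 = h * (frechet_derivative f (at (x + h *\<^sub>R w + s *\<^sub>R v)) v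
      - frechet_derivative f (at (x + s *\<^sub>R v)) v)"
    using MVT2[OF h d] by auto
  define g where "g y = frechet_derivative f (at y) v" for y
  have g: "smooth_on U g"
    unfolding g_def by (rule smooth_on_frechet_derivative[OF f])
  have d': "((\<lambda>t. g (x + s *\<^sub>R v + t *\<^sub>R w)) has_real_derivative
      frechet_derivative g (at (x + s *\<^sub>R v + t *\<^sub>R w)) w) (at t)" if "0 \<le> t" "t \<le> h" for t
    unfolding has_real_derivative_iff_has_vector_derivative
    using U[of s t] that s
    by (intro has_vector_derivative_along_line smooth_on_differentiable[OF g]) simp
  obtain t where t: "0 < t" "t < h" and "g (x + s *\<^sub>R v + h *\<^sub>R w) - g (x + s *\<^sub>R v + 0 *\<^sub>R w)
      = h * frechet_derivative g (at (x + s *\<^sub>R v + t *\<^sub>R w)) w"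
    using MVT2[OF h d'] by auto
  with \<open>\<phi> h - \<phi> 0 = _\<close> have "\<phi> h - \<phi> 0 = h\<^sup>2 * frechet_derivative g (at (x + s *\<^sub>R v + t *\<^sub>R w)) w"
    by (simp add: g_def power2_eq_square algebra_simps)
  then show thesis
    using that[OF s t] unfolding \<phi>_def g_def by (simp add: algebra_simps)
qed

text \<open>Schwarz's theorem: one and the same second difference is h^2 times either mixed
  derivative at some point near \<open>x\<close>, and both mixed derivatives are continuous.\<close>

lemma frechet_derivative_commute_real:
  fixes f :: "'a::euclidean_space \<Rightarrow> real"
  assumes U: "open U" and f: "smooth_on U f" and x: "x \<in> U"
  shows "frechet_derivative (\<lambda>y. frechet_derivative f (at y) v) (at x) w
    = frechet_derivative (\<lambda>y. frechet_derivative f (at y) w) (at x) v"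
proof -
  define P Q where "P y = frechet_derivative (\<lambda>y. frechet_derivative f (at y) v) (at y) w"
    and "Q y = frechet_derivative (\<lambda>y. frechet_derivative f (at y) w) (at y) v" for y
  have "continuous_on U P" "continuous_on U Q"
    unfolding P_def Q_def by (intro smooth_on_continuous_on smooth_on_frechet_derivative f)+
  then have PQ: "isCont P x" "isCont Q x"
    using U x continuous_on_eq_continuous_at by blast+
  have "\<bar>P x - Q x\<bar> \<le> e" if e: "e > 0" for e
  proof -
    obtain d where d: "d > 0" "ball x d \<subseteq> U"
      "\<And>y. dist y x < d \<Longrightarrow> \<bar>P y - P x\<bar> < e / 2" "\<And>y. dist y x < d \<Longrightarrow> \<bar>Q y - Q x\<bar> < e / 2"
    proof -
      obtain d1 where "d1 > 0" "ball x d1 \<subseteq> U"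
        using U x openE by blast
      moreover obtain d2 where "d2 > 0" "\<And>y. dist y x < d2 \<Longrightarrow> \<bar>P y - P x\<bar> < e / 2"
        using PQ(1)[unfolded continuous_at_eps_delta] e by (metis dist_real_def half_gt_zero)
      moreover obtain d3 where "d3 > 0" "\<And>y. dist y x < d3 \<Longrightarrow> \<bar>Q y - Q x\<bar> < e / 2"
        using PQ(2)[unfolded continuous_at_eps_delta] e by (metis dist_real_def half_gt_zero)
      ultimately show thesis
        using that[of "min d1 (min d2 d3)"] subset_ball[of "min d1 (min d2 d3)" d1 x] by simp
    qed
    \<comment> \<open>With this step the parallelogram stays within d / 2 of \<open>x\<close>; the
      summand 1 keeps the denominator positive when v = w = 0.\<close>
    define h where "h = d / (2 * (norm v + norm w + 1))"
    have n: "norm v + norm w + 1 > 0"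
      by (smt (verit) norm_ge_zero)
    have h: "h > 0"
      using d n by (simp add: h_def)
    have near: "dist (x + s *\<^sub>R v + t *\<^sub>R w) x < d" "dist (x + t *\<^sub>R w + s *\<^sub>R v) x < d"
      if "0 \<le> s" "s \<le> h" "0 \<le> t" "t \<le> h" for s t
    proof -
      have "norm (s *\<^sub>R v + t *\<^sub>R w) \<le> h * norm v + h * norm w"
        using that by (intro norm_triangle_le add_mono) (auto intro: mult_right_mono)
      also have "\<dots> \<le> h * (norm v + norm w + 1)"
        using h by (simp add: algebra_simps)
      also have "\<dots> = d / 2"
        using n by (simp add: h_def field_simps)
      finally show "dist (x + s *\<^sub>R v + t *\<^sub>R w) x < d" "dist (x + t *\<^sub>R w + s *\<^sub>R v) x < d"
        using d(1) by (simp_all add: dist_norm algebra_simps)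
    qed
    obtain s t where 1: "0 < s" "s < h" "0 < t" "t < h"
      "f (x + h *\<^sub>R v + h *\<^sub>R w) - f (x + h *\<^sub>R v) - f (x + h *\<^sub>R w) + f x
        = h\<^sup>2 * P (x + s *\<^sub>R v + t *\<^sub>R w)"
      unfolding P_def
      by (rule mixed_difference_mean_value[OF f h, of x v w])
        (use near(1) d(2) in \<open>auto simp: subset_iff dist_commute\<close>)
    obtain s' t' where 2: "0 < s'" "s' < h" "0 < t'" "t' < h"
      "f (x + h *\<^sub>R w + h *\<^sub>R v) - f (x + h *\<^sub>R w) - f (x + h *\<^sub>R v) + f x
        = h\<^sup>2 * Q (x + s' *\<^sub>R w + t' *\<^sub>R v)"
      unfolding Q_def
      by (rule mixed_difference_mean_value[OF f h, of x w v])
        (use near(2) d(2) in \<open>auto simp: subset_iff dist_commute\<close>)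
    have "x + h *\<^sub>R w + h *\<^sub>R v = x + h *\<^sub>R v + h *\<^sub>R w"
      by simp
    with 1(5) 2(5) h have "P (x + s *\<^sub>R v + t *\<^sub>R w) = Q (x + s' *\<^sub>R w + t' *\<^sub>R v)"
      by (simp add: algebra_simps)
    moreover have "\<bar>P (x + s *\<^sub>R v + t *\<^sub>R w) - P x\<bar> < e / 2"
      using d(3) near(1)[of s t] 1 by simp
    moreover have "\<bar>Q (x + s' *\<^sub>R w + t' *\<^sub>R v) - Q x\<bar> < e / 2"
      using d(4) near(2)[of t' s'] 2 by simp
    ultimately show ?thesis
      by linarith
  qed
  then have "\<bar>P x - Q x\<bar> \<le> 0"
    by (rule field_le_epsilon) simp
  then show ?thesis
    by (simp add: P_def Q_def)
qed

lemma frechet_derivative_commute: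
  fixes f :: "'a::euclidean_space \<Rightarrow> 'b::euclidean_space"
  assumes U: "open U" and f: "smooth_on U f" and x: "x \<in> U"
  shows "frechet_derivative (\<lambda>y. frechet_derivative f (at y) v) (at x) w
    = frechet_derivative (\<lambda>y. frechet_derivative f (at y) w) (at x) v"
proof (rule euclidean_eqI)
  fix b :: 'b
  define g where "g y = f y \<bullet> b" for y
  have g: "smooth_on U g"
    unfolding g_def by (rule smooth_on_bounded_linear[OF bounded_linear_inner_left U f])
  have inner_out: "frechet_derivative (\<lambda>y. F y \<bullet> b) (at y) = (\<lambda>u. frechet_derivative F (at y) u \<bullet> b)"
    if "smooth_on U F" "y \<in> U" for F :: "'a \<Rightarrow> 'b" and y
    using frechet_derivative_at[OF bounded_linear.has_derivative[OF bounded_linear_inner_left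
          smooth_on_has_derivative[OF that]]] by simp
  have "frechet_derivative (\<lambda>y. frechet_derivative g (at y) u) (at x) u'
    = frechet_derivative (\<lambda>y. frechet_derivative f (at y) u) (at x) u' \<bullet> b" for u u'
  proof -
    have "frechet_derivative (\<lambda>y. frechet_derivative g (at y) u) (at x)
      = frechet_derivative (\<lambda>y. frechet_derivative f (at y) u \<bullet> b) (at x)"
      by (rule frechet_derivative_transform_within_open[OF _ U x])
        (simp_all add: smooth_on_differentiable[OF smooth_on_frechet_derivative[OF g] x]
          inner_out[OF f, folded g_def])
    then show ?thesis
      by (simp add: inner_out[OF smooth_on_frechet_derivative[OF f] x])
  qed
  then show "frechet_derivative (\<lambda>y. frechet_derivative f (at y) v) (at x) w \<bullet> b
      = frechet_derivative (\<lambda>y. frechet_derivative f (at y) w) (at x) v \<bullet> b"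
    using frechet_derivative_commute_real[OF U g x, of v w] by simp
qed


section \<open>Left-invariant derivatives on the sphere\<close>

lemma smooth_on_S3_iff:
  "smooth_on_S3 f \<longleftrightarrow> (\<exists>U F. open U \<and> S3 \<subseteq> U \<and> smooth_on U F \<and> (\<forall>x\<in>S3. F x = f x))"
  by (simp add: smooth_on_S3_def smooth_on_def)

lemma smooth_on_S3E:
  assumes "smooth_on_S3 f"
  obtains U F where "open U" "S3 \<subseteq> U" "smooth_on U F" "\<And>x. x \<in> S3 \<Longrightarrow> F x = f x"
  using assms unfolding smooth_on_S3_iff by blast

lemma smooth_on_S3I:
  "\<lbrakk>open U; S3 \<subseteq> U; smooth_on U F; \<And>x. x \<in> S3 \<Longrightarrow> F x = f x\<rbrakk> \<Longrightarrow> smooth_on_S3 f"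
  unfolding smooth_on_S3_iff by blast

lemma smooth_on_S3_cong: "smooth_on_S3 f \<Longrightarrow> (\<And>x. x \<in> S3 \<Longrightarrow> f x = g x) \<Longrightarrow> smooth_on_S3 g"
  by (metis smooth_on_S3E smooth_on_S3I)

lemma smooth_on_S3_continuous_on: "smooth_on_S3 f \<Longrightarrow> continuous_on S3 f"
  by (metis smooth_on_S3E smooth_on_continuous_on continuous_on_subset continuous_on_cong)

lemma smooth_on_S3_const: "smooth_on_S3 (\<lambda>x. c)"
  by (rule smooth_on_S3I[OF open_UNIV _ smooth_on_const]) auto

lemma smooth_on_S3_ident: "smooth_on_S3 (\<lambda>x. x)"
  by (rule smooth_on_S3I[OF open_UNIV _ smooth_on_ident]) auto

lemma smooth_on_S3_bounded_linear:
  assumes "bounded_linear h" "smooth_on_S3 f"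
  shows "smooth_on_S3 (\<lambda>x. h (f x))"
proof -
  obtain U F where F: "open U" "S3 \<subseteq> U" "smooth_on U F" "\<And>x. x \<in> S3 \<Longrightarrow> F x = f x"
    using assms(2) by (rule smooth_on_S3E) (rule that)
  then show ?thesis
    by (intro smooth_on_S3I[OF F(1,2) smooth_on_bounded_linear[OF assms(1) F(1,3)]]) simp
qed

lemma smooth_on_S3_extend2:
  assumes "smooth_on_S3 f" "smooth_on_S3 g"
  obtains U F G where "open U" "S3 \<subseteq> U" "smooth_on U F" "smooth_on U G"
    "\<And>x. x \<in> S3 \<Longrightarrow> F x = f x" "\<And>x. x \<in> S3 \<Longrightarrow> G x = g x"
proof -
  obtain U F where F: "open U" "S3 \<subseteq> U" "smooth_on U F" "\<And>x. x \<in> S3 \<Longrightarrow> F x = f x"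
    using assms(1) by (rule smooth_on_S3E) (rule that)
  obtain V G where G: "open V" "S3 \<subseteq> V" "smooth_on V G" "\<And>x. x \<in> S3 \<Longrightarrow> G x = g x"
    using assms(2) by (rule smooth_on_S3E) (rule that)
  show thesis
    by (rule that[of "U \<inter> V" F G])
      (use F G in \<open>auto intro: smooth_on_subset[OF F(3)] smooth_on_subset[OF G(3)]\<close>)
qed

lemma smooth_on_S3_bilinear:
  assumes "bounded_bilinear h" "smooth_on_S3 f" "smooth_on_S3 g"
  shows "smooth_on_S3 (\<lambda>x. h (f x) (g x))"
  using assms(2,3)
proof (rule smooth_on_S3_extend2)
  fix U F G
  assume *: "open U" "S3 \<subseteq> U" "smooth_on U F" "smooth_on U G"
    "\<And>x. x \<in> S3 \<Longrightarrow> F x = f x" "\<And>x. x \<in> S3 \<Longrightarrow> G x = g x"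
  show ?thesis
    by (rule smooth_on_S3I[OF *(1,2) smooth_on_bilinear[OF assms(1) *(1,3,4)]]) (simp add: *(5,6))
qed

lemma smooth_on_S3_add:
  assumes "smooth_on_S3 f" "smooth_on_S3 g"
  shows "smooth_on_S3 (\<lambda>x. f x + g x)"
  using assms
proof (rule smooth_on_S3_extend2)
  fix U F G
  assume *: "open U" "S3 \<subseteq> U" "smooth_on U F" "smooth_on U G"
    "\<And>x. x \<in> S3 \<Longrightarrow> F x = f x" "\<And>x. x \<in> S3 \<Longrightarrow> G x = g x"
  show ?thesis
    by (rule smooth_on_S3I[OF *(1,2) smooth_on_add[OF *(1,3,4)]]) (simp add: *(5,6))
qed

lemma smooth_on_S3_compose_uminus:
  assumes "smooth_on_S3 f"
  shows "smooth_on_S3 (\<lambda>x. f (- x))"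
proof -
  obtain U F where F: "open U" "S3 \<subseteq> U" "smooth_on U F" "\<And>x. x \<in> S3 \<Longrightarrow> F x = f x"
    using assms by (rule smooth_on_S3E) (rule that)
  have "S3 \<subseteq> uminus ` U"
  proof
    fix x assume "x \<in> S3"
    then show "x \<in> uminus ` U"
      using F(2) S3_uminus by (intro image_eqI[of x uminus "- x"]) auto
  qed
  then show ?thesis
    using F by (intro smooth_on_S3I[OF open_negations[OF F(1)] _ smooth_on_compose_uminus[OF F(1,3)]])
      (auto simp: S3_uminus)
qed

text \<open>Normalising is harmless to first order: as \<open>v\<close> is orthogonal to the unit
  vector \<open>x\<close>, the norm of x + t v is sqrt (1 + t^2 |v|^2), which is stationary at t =
  0.\<close>

lemma has_vector_derivative_tangent:
  assumes F: "open U" "S3 \<subseteq> U" "smooth_on U F" "\<And>x. x \<in> S3 \<Longrightarrow> F x = f x"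
    and x: "x \<in> S3" and v: "x \<bullet> v = 0"
  shows "((\<lambda>t. f (sgn (x + t *\<^sub>R v))) has_vector_derivative frechet_derivative F (at x) v) (at 0)"
proof -
  have xx: "x \<bullet> x = 1"
    using x by (simp add: mem_S3_iff norm_eq_1)
  have sgn_eq: "sgn (x + t *\<^sub>R v) = (1 / sqrt (1 + t\<^sup>2 * (v \<bullet> v))) *\<^sub>R (x + t *\<^sub>R v)" for t
    unfolding sgn_div_norm norm_eq_sqrt_inner
    using v xx by (simp add: inner_simps inner_commute power2_eq_square algebra_simps divide_inverse)
  have "x + t *\<^sub>R v \<noteq> 0" for t
  proof
    assume "x + t *\<^sub>R v = 0"
    then have "x \<bullet> (x + t *\<^sub>R v) = 0" by simp
    then show False using xx v by (simp add: inner_simps)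
  qed
  then have f_eq: "f (sgn (x + t *\<^sub>R v)) = F (sgn (x + t *\<^sub>R v))" for t
    using F(4) sgn_in_S3 by simp
  have "((\<lambda>t. sgn (x + t *\<^sub>R v)) has_vector_derivative v) (at 0)"
    unfolding sgn_eq by (auto intro!: derivative_eq_intros)
  then have "((\<lambda>t. sgn (x + t *\<^sub>R v)) has_derivative (\<lambda>s. s *\<^sub>R v)) (at 0)"
    by (simp add: has_vector_derivative_def)
  moreover have "sgn (x + 0 *\<^sub>R v) = x"
    using x by (simp add: mem_S3_iff sgn_div_norm)
  moreover have "(F has_derivative frechet_derivative F (at x)) (at x)"
    using F(2,3) x smooth_on_has_derivative by blast
  ultimately have "((\<lambda>t. F (sgn (x + t *\<^sub>R v))) has_derivative (\<lambda>s. frechet_derivative F (at x) (s *\<^sub>R v))) (at 0)"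
    using has_derivative_compose[of "\<lambda>t. sgn (x + t *\<^sub>R v)" "\<lambda>s. s *\<^sub>R v" 0 UNIV F] by simp
  moreover have "linear (frechet_derivative F (at x))"
    using F(2,3) x smooth_on_differentiable linear_frechet_derivative by blast
  ultimately show ?thesis
    by (simp add: f_eq has_vector_derivative_def linear_cmul)
qed

lemma tangent_deriv_eq:
  assumes "open U" "S3 \<subseteq> U" "smooth_on U F" "\<And>x. x \<in> S3 \<Longrightarrow> F x = f x"
    and "x \<in> S3" and "x \<bullet> v = 0"
  shows "tangent_deriv f x v = frechet_derivative F (at x) v"
  unfolding tangent_deriv_def by (rule vector_derivative_at[OF has_vector_derivative_tangent[OF assms]])

text \<open>The defining curve never leaves the sphere, so values off \<open>S3\<close>, such as the
  zero extension of a spinor field, have no influence.\<close>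

lemma tangent_deriv_cong:
  assumes "x \<in> S3" "x \<bullet> v = 0" and "\<And>y. y \<in> S3 \<Longrightarrow> f y = g y"
  shows "tangent_deriv f x v = tangent_deriv g x v"
proof -
  have xx: "x \<bullet> x = 1"
    using assms(1) by (simp add: mem_S3_iff norm_eq_1)
  have "x + t *\<^sub>R v \<noteq> 0" for t
  proof
    assume "x + t *\<^sub>R v = 0"
    then have "x \<bullet> (x + t *\<^sub>R v) = 0" by simp
    then show False using xx assms(2) by (simp add: inner_simps)
  qed
  then show ?thesis
    unfolding tangent_deriv_def using assms(3) sgn_in_S3 by simp
qed

text \<open>Derivative along the left-invariant field generated by \<open>u\<close>. This field is
  tangent to the sphere exactly for purely imaginary \<open>u\<close>, whence the condition
  \<open>u $ 1 = 0\<close> in what follows.\<close>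

definition lderiv :: "quat \<Rightarrow> (quat \<Rightarrow> 'b::real_normed_vector) \<Rightarrow> quat \<Rightarrow> 'b" where
  "lderiv u f x = tangent_deriv f x (x \<bullet>\<^sub>H u)"

lemma inner_qmult_imaginary: "u $ 1 = 0 \<Longrightarrow> x \<bullet> (x \<bullet>\<^sub>H u) = 0"
  using inner_qmult_left[of x qone u] by (simp add: inner_quat)

lemma lderiv_eq:
  assumes "open U" "S3 \<subseteq> U" "smooth_on U F" "\<And>x. x \<in> S3 \<Longrightarrow> F x = f x"
    and "x \<in> S3" and "u $ 1 = 0"
  shows "lderiv u f x = frechet_derivative F (at x) (x \<bullet>\<^sub>H u)"
  unfolding lderiv_def by (rule tangent_deriv_eq[OF assms(1-5) inner_qmult_imaginary[OF assms(6)]])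

lemma lderiv_cong:
  assumes "x \<in> S3" "u $ 1 = 0" "\<And>y. y \<in> S3 \<Longrightarrow> f y = g y"
  shows "lderiv u f x = lderiv u g x"
  unfolding lderiv_def using assms by (intro tangent_deriv_cong inner_qmult_imaginary)

text \<open>Left-invariant fields are invariant under the antipodal map; this is why the Dirac
  operator preserves parity.\<close>

lemma lderiv_compose_uminus: "lderiv u (\<lambda>x. f (- x)) x = lderiv u f (- x)"
proof -
  have "- x + t *\<^sub>R ((- x) \<bullet>\<^sub>H u) = - (x + t *\<^sub>R (x \<bullet>\<^sub>H u))" for t
    by (simp add: qmult.minus_left)
  then show ?thesis
    unfolding lderiv_def tangent_deriv_def by (simp only: sgn_minus)
qed

lemma smooth_on_S3_lderiv:
  assumes "smooth_on_S3 f" "u $ 1 = 0"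
  shows "smooth_on_S3 (lderiv u f)"
proof -
  obtain U F where F: "open U" "S3 \<subseteq> U" "smooth_on U F" "\<And>x. x \<in> S3 \<Longrightarrow> F x = f x"
    using assms(1) by (rule smooth_on_S3E) (rule that)
  show ?thesis
    by (rule smooth_on_S3I[OF F(1,2) smooth_on_frechet_derivative_linear[OF F(1,3)
            qmult.bounded_linear_left[of u]]])
      (simp add: lderiv_eq[OF F] assms(2))
qed

text \<open>The great circles \<open>x \<bullet>\<^sub>H qexp u t\<close> are the integral curves of
  the left-invariant field; on them \<open>lderiv u\<close> becomes a derivative in one real
  variable.\<close>

lemma (in imaginary_unit) lderiv_along:
  assumes "smooth_on_S3 f" "x \<in> S3"
  shows "((\<lambda>t. f (x \<bullet>\<^sub>H qexp u t)) has_vector_derivative lderiv u f (x \<bullet>\<^sub>H qexp u t)) (at t)"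
proof -
  obtain U F where F: "open U" "S3 \<subseteq> U" "smooth_on U F" "\<And>x. x \<in> S3 \<Longrightarrow> F x = f x"
    using assms(1) by (rule smooth_on_S3E) (rule that)
  have S3: "x \<bullet>\<^sub>H qexp u s \<in> S3" for s
    by (intro S3_qmult assms qexp_in_S3)
  then have d: "F differentiable (at (x \<bullet>\<^sub>H qexp u t))"
    using F(2,3) smooth_on_differentiable by blast
  have "((\<lambda>t. F (x \<bullet>\<^sub>H qexp u t)) has_derivative
      (\<lambda>s. frechet_derivative F (at (x \<bullet>\<^sub>H qexp u t)) (s *\<^sub>R (x \<bullet>\<^sub>H qexp u t \<bullet>\<^sub>H u)))) (at t)"
    using has_vector_derivative_qexp[of x t, unfolded has_vector_derivative_def]
      d[unfolded frechet_derivative_works] by (rule has_derivative_compose)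
  then show ?thesis
    using linear_frechet_derivative[OF d]
    by (simp add: has_vector_derivative_def linear_cmul F(4) S3 lderiv_eq[OF F S3 re_zero])
qed

lemma lderiv_bilinear:
  assumes h: "bounded_bilinear h" and "smooth_on_S3 f" "smooth_on_S3 g" and x: "x \<in> S3" "u $ 1 = 0"
  shows "lderiv u (\<lambda>x. h (f x) (g x)) x = h (f x) (lderiv u g x) + h (lderiv u f x) (g x)"
  using assms(2,3)
proof (rule smooth_on_S3_extend2)
  fix U F G
  assume *: "open U" "S3 \<subseteq> U" "smooth_on U F" "smooth_on U G"
    "\<And>x. x \<in> S3 \<Longrightarrow> F x = f x" "\<And>x. x \<in> S3 \<Longrightarrow> G x = g x"
  have d: "((\<lambda>x. h (F x) (G x)) has_derivative
      (\<lambda>v. h (F x) (frechet_derivative G (at x) v) + h (frechet_derivative F (at x) v) (G x))) (at x)"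
    using *(2) x(1) by (intro bounded_bilinear.FDERIV[OF h] smooth_on_has_derivative[OF *(3)]
        smooth_on_has_derivative[OF *(4)]) auto
  have "lderiv u (\<lambda>x. h (f x) (g x)) x = frechet_derivative (\<lambda>x. h (F x) (G x)) (at x) (x \<bullet>\<^sub>H u)"
    by (rule lderiv_eq[OF *(1,2) smooth_on_bilinear[OF h *(1,3,4)] _ x]) (simp add: *(5,6))
  also have "\<dots> = h (F x) (frechet_derivative G (at x) (x \<bullet>\<^sub>H u))
      + h (frechet_derivative F (at x) (x \<bullet>\<^sub>H u)) (G x)"
    by (simp flip: frechet_derivative_at[OF d])
  also have "\<dots> = h (f x) (lderiv u g x) + h (lderiv u f x) (g x)"
    by (simp add: lderiv_eq[OF *(1,2,3,5) x] lderiv_eq[OF *(1,2,4,6) x] *(5,6) x)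
  finally show ?thesis .
qed

lemma lderiv_add:
  assumes "smooth_on_S3 f" "smooth_on_S3 g" and x: "x \<in> S3" "u $ 1 = 0"
  shows "lderiv u (\<lambda>x. f x + g x) x = lderiv u f x + lderiv u g x"
  using assms(1,2)
proof (rule smooth_on_S3_extend2)
  fix U F G
  assume *: "open U" "S3 \<subseteq> U" "smooth_on U F" "smooth_on U G"
    "\<And>x. x \<in> S3 \<Longrightarrow> F x = f x" "\<And>x. x \<in> S3 \<Longrightarrow> G x = g x"
  have d: "((\<lambda>x. F x + G x) has_derivative
      (\<lambda>v. frechet_derivative F (at x) v + frechet_derivative G (at x) v)) (at x)"
    using *(2) x(1) by (intro has_derivative_add smooth_on_has_derivative[OF *(3)]
        smooth_on_has_derivative[OF *(4)]) auto
  have "lderiv u (\<lambda>x. f x + g x) x = frechet_derivative (\<lambda>x. F x + G x) (at x) (x \<bullet>\<^sub>H u)"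
    by (rule lderiv_eq[OF *(1,2) smooth_on_add[OF *(1,3,4)] _ x]) (simp add: *(5,6))
  also have "\<dots> = frechet_derivative F (at x) (x \<bullet>\<^sub>H u) + frechet_derivative G (at x) (x \<bullet>\<^sub>H u)"
    by (simp flip: frechet_derivative_at[OF d])
  also have "\<dots> = lderiv u f x + lderiv u g x"
    by (simp add: lderiv_eq[OF *(1,2,3,5) x] lderiv_eq[OF *(1,2,4,6) x])
  finally show ?thesis .
qed

lemma lderiv_const: "lderiv u (\<lambda>x. c) x = 0"
  by (simp add: lderiv_def tangent_deriv_def)

lemma lderiv_ident: "x \<in> S3 \<Longrightarrow> u $ 1 = 0 \<Longrightarrow> lderiv u (\<lambda>x. x) x = x \<bullet>\<^sub>H u"
  by (subst lderiv_eq[OF open_UNIV _ smooth_on_ident]) auto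

lemma lderiv_bounded_linear:
  assumes h: "bounded_linear h" and f: "smooth_on_S3 f" and x: "x \<in> S3" "u $ 1 = 0"
  shows "lderiv u (\<lambda>x. h (f x)) x = h (lderiv u f x)"
proof -
  have "bounded_bilinear (\<lambda>r x. r *\<^sub>R h x)"
    by (rule bounded_bilinear.comp[OF bounded_bilinear_scaleR bounded_linear_ident h])
  from lderiv_bilinear[OF this smooth_on_S3_const[of 1] f x] show ?thesis
    by (simp add: lderiv_const)
qed

lemma lderiv_linear_comb:
  assumes "smooth_on_S3 f" and x: "x \<in> S3" "u $ 1 = 0" "w $ 1 = 0"
  shows "lderiv (r *\<^sub>R u + s *\<^sub>R w) f x = r *\<^sub>R lderiv u f x + s *\<^sub>R lderiv w f x"
proof -
  obtain U F where F: "open U" "S3 \<subseteq> U" "smooth_on U F" "\<And>x. x \<in> S3 \<Longrightarrow> F x = f x"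
    using assms(1) by (rule smooth_on_S3E) (rule that)
  have "linear (frechet_derivative F (at x))"
    using F(2,3) x smooth_on_differentiable linear_frechet_derivative by blast
  then show ?thesis
    using x by (simp add: lderiv_eq[OF F] qmult.add_right qmult.scaleR_right linear_add linear_cmul)
qed

lemma lderiv_scaleR:
  "smooth_on_S3 f \<Longrightarrow> x \<in> S3 \<Longrightarrow> u $ 1 = 0 \<Longrightarrow> lderiv (r *\<^sub>R u) f x = r *\<^sub>R lderiv u f x"
  using lderiv_linear_comb[of f x u u r 0] by simp

text \<open>The second-order terms cancel by symmetry of the second derivative. What remains comes
  from differentiating the directions: x u w minus x w u.\<close>

lemma lderiv_commutator:
  fixes f :: "quat \<Rightarrow> 'b::euclidean_space"
  assumes f: "smooth_on_S3 f" and x: "x \<in> S3" and u: "u $ 1 = 0" and w: "w $ 1 = 0"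
  shows "lderiv u (lderiv w f) x - lderiv w (lderiv u f) x = lderiv (u \<bullet>\<^sub>H w - w \<bullet>\<^sub>H u) f x"
proof -
  obtain U F where F: "open U" "S3 \<subseteq> U" "smooth_on U F" "\<And>x. x \<in> S3 \<Longrightarrow> F x = f x"
    using f by (rule smooth_on_S3E) (rule that)
  have xU: "x \<in> U"
    using F(2) x by blast
  define D where "D b y = frechet_derivative F (at y) b" for b y
  have D: "smooth_on U (D b)" for b
    unfolding D_def by (rule smooth_on_frechet_derivative[OF F(3)])
  \<comment> \<open>Extends \<open>lderiv u' f\<close> off the sphere by the same formula, so that
    it can be differentiated in the ambient space.\<close>
  define E where "E u' = (\<lambda>y. D (y \<bullet>\<^sub>H u') y)" for u'
  have E: "smooth_on U (E u')" for u'
    unfolding E_def D_def by (intro smooth_on_frechet_derivative_linear F qmult.bounded_linear_left)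
  have E_f: "E u' y = lderiv u' f y" if "y \<in> S3" "u' $ 1 = 0" for u' y
    using lderiv_eq[OF F that] by (simp add: E_def D_def)
  have E_deriv: "frechet_derivative (E w') (at x) (x \<bullet>\<^sub>H u')
    = D (x \<bullet>\<^sub>H u' \<bullet>\<^sub>H w') x + frechet_derivative (D (x \<bullet>\<^sub>H u')) (at x) (x \<bullet>\<^sub>H w')" for u' w'
  proof -
    let ?v = "x \<bullet>\<^sub>H u'"
    have repr: "D v y = (\<Sum>b\<in>Basis. (v \<bullet> b) *\<^sub>R D b y)" if "y \<in> U" for v y
      unfolding D_def by (rule frechet_derivative_euclidean[OF smooth_on_differentiable[OF F(3) that]])
    have swap: "frechet_derivative (D b) (at x) ?v = frechet_derivative (D ?v) (at x) b" for b
      unfolding D_def by (rule frechet_derivative_commute[OF F(1,3) xU])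
    have "((\<lambda>y. ((y \<bullet>\<^sub>H w') \<bullet> b) *\<^sub>R D b y) has_derivative
        (\<lambda>v. ((x \<bullet>\<^sub>H w') \<bullet> b) *\<^sub>R frechet_derivative (D b) (at x) v + ((v \<bullet>\<^sub>H w') \<bullet> b) *\<^sub>R D b x)) (at x)" for b
      by (intro has_derivative_scaleR smooth_on_has_derivative[OF D xU]
          bounded_linear_imp_has_derivative bounded_linear_compose[OF bounded_linear_inner_left]
          qmult.bounded_linear_left)
    then have "((\<lambda>y. \<Sum>b\<in>Basis. ((y \<bullet>\<^sub>H w') \<bullet> b) *\<^sub>R D b y) has_derivative
        (\<lambda>v. \<Sum>b\<in>Basis. ((x \<bullet>\<^sub>H w') \<bullet> b) *\<^sub>R frechet_derivative (D b) (at x) v + ((v \<bullet>\<^sub>H w') \<bullet> b) *\<^sub>R D b x)) (at x)"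
      by (intro has_derivative_sum)
    then have "(E w' has_derivative
        (\<lambda>v. \<Sum>b\<in>Basis. ((x \<bullet>\<^sub>H w') \<bullet> b) *\<^sub>R frechet_derivative (D b) (at x) v + ((v \<bullet>\<^sub>H w') \<bullet> b) *\<^sub>R D b x)) (at x)"
      by (rule has_derivative_transform_within_open[OF _ F(1) xU]) (simp add: E_def flip: repr)
    then have "frechet_derivative (E w') (at x) ?v
      = (\<Sum>b\<in>Basis. ((x \<bullet>\<^sub>H w') \<bullet> b) *\<^sub>R frechet_derivative (D b) (at x) ?v) + D (?v \<bullet>\<^sub>H w') x"
      by (simp add: repr[OF xU, of "?v \<bullet>\<^sub>H w'"] sum.distrib flip: frechet_derivative_at)
    also have "(\<Sum>b\<in>Basis. ((x \<bullet>\<^sub>H w') \<bullet> b) *\<^sub>R frechet_derivative (D b) (at x) ?v)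
        = frechet_derivative (D ?v) (at x) (x \<bullet>\<^sub>H w')"
      unfolding swap by (rule frechet_derivative_euclidean[OF smooth_on_differentiable[OF D xU], symmetric])
    finally show ?thesis
      by simp
  qed
  have sym: "frechet_derivative (D (x \<bullet>\<^sub>H u)) (at x) (x \<bullet>\<^sub>H w) = frechet_derivative (D (x \<bullet>\<^sub>H w)) (at x) (x \<bullet>\<^sub>H u)"
    unfolding D_def by (rule frechet_derivative_commute[OF F(1,3) xU])
  have "lderiv u (lderiv w f) x - lderiv w (lderiv u f) x
    = D (x \<bullet>\<^sub>H u \<bullet>\<^sub>H w) x - D (x \<bullet>\<^sub>H w \<bullet>\<^sub>H u) x"
    using lderiv_eq[OF F(1,2) E E_f[OF _ w] x u] lderiv_eq[OF F(1,2) E E_f[OF _ u] x w]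
    by (simp add: E_deriv sym)
  also have "\<dots> = D (x \<bullet>\<^sub>H (u \<bullet>\<^sub>H w - w \<bullet>\<^sub>H u)) x"
    using linear_frechet_derivative[OF smooth_on_differentiable[OF F(3) xU]]
    by (simp add: D_def qmult_assoc qmult.diff_right linear_diff)
  also have "\<dots> = lderiv (u \<bullet>\<^sub>H w - w \<bullet>\<^sub>H u) f x"
    using u w by (simp add: D_def lderiv_eq[OF F x])
  finally show ?thesis .
qed

text \<open>Along the one-parameter subgroup from \<open>qone\<close> to \<open>x\<close> the
  derivative is a combination of the three vanishing ones.\<close>

lemma constant_if_lderiv_zero:
  assumes f: "smooth_on_S3 f" and x: "x \<in> S3"
    and 0: "\<And>y. y \<in> S3 \<Longrightarrow> lderiv qi f y = 0" "\<And>y. y \<in> S3 \<Longrightarrow> lderiv qj f y = 0"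
      "\<And>y. y \<in> S3 \<Longrightarrow> lderiv qk f y = 0"
  shows "f x = f qone"
proof -
  obtain u t where u: "imaginary_unit u" and x_eq: "x = qexp u t"
    using S3_eq_qexp[OF x] .
  interpret imaginary_unit u by (rule u)
  have u_eq: "u = 1 *\<^sub>R (u$2 *\<^sub>R qi + u$3 *\<^sub>R qj) + u$4 *\<^sub>R qk"
    by (simp add: quat_eq_iff re_zero)
  have "lderiv u f y = 0" if "y \<in> S3" for y
    by (subst u_eq) (simp add: lderiv_linear_comb[OF f that, where r=1, simplified]
        lderiv_linear_comb[OF f that] lderiv_scaleR[OF f that] 0[OF that])
  then have "((\<lambda>t. f (qone \<bullet>\<^sub>H qexp u t)) has_vector_derivative 0) (at t)" for t
    using lderiv_along[OF f qone_in_S3, of t] qexp_in_S3 by simp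
  then have "((\<lambda>t. f (qexp u t)) has_derivative (\<lambda>h. 0)) (at t within UNIV)" for t
    by (simp add: has_vector_derivative_def)
  then show ?thesis
    using has_derivative_zero_unique[of UNIV "\<lambda>t. f (qexp u t)" t 0] x_eq by simp
qed


section \<open>Invariant integration and Wirtinger's inequality\<close>

text \<open>A thickening of the sphere. Integrating radially constant extensions over it gives a
  positive multiple of the surface integral in terms of Lebesgue measure; 0 is kept out so that
  \<open>sgn\<close> is continuous.\<close>

definition shell :: "quat set" where
  "shell = cball 0 2 - ball 0 1"

lemma compact_shell: "compact shell"
  unfolding shell_def by (intro compact_diff compact_cball open_ball)

lemma sgn_shell: "x \<in> shell \<Longrightarrow> sgn x \<in> S3"
  by (rule sgn_in_S3) (auto simp: shell_def)

definition S3_integral :: "(quat \<Rightarrow> real) \<Rightarrow> real" where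
  "S3_integral f = integral shell (\<lambda>x. f (sgn x))"

lemma continuous_on_shell: "continuous_on S3 f \<Longrightarrow> continuous_on shell (\<lambda>x. f (sgn x))"
  by (rule continuous_on_compose2[of S3 f])
    (auto simp: sgn_shell intro!: continuous_intros, auto simp: shell_def)

lemma absolutely_integrable_on_shell:
  fixes f :: "quat \<Rightarrow> 'b::euclidean_space"
  assumes "continuous_on S3 f"
  shows "(\<lambda>x. f (sgn x)) absolutely_integrable_on shell"
proof -
  have "integrable lborel (\<lambda>x. indicator shell x *\<^sub>R f (sgn x))"
    by (rule borel_integrable_compact[OF compact_shell continuous_on_shell[OF assms]])
  then show ?thesis
    unfolding set_integrable_def by (simp add: integrable_completion borel_measurable_integrable)
qed

lemma integrable_on_shell:
  fixes f :: "quat \<Rightarrow> real"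
  shows "continuous_on S3 f \<Longrightarrow> (\<lambda>x. f (sgn x)) integrable_on shell"
  using absolutely_integrable_on_shell set_lebesgue_integral_eq_integral(1) by blast

lemma S3_integral_cong: "(\<And>x. x \<in> S3 \<Longrightarrow> f x = g x) \<Longrightarrow> S3_integral f = S3_integral g"
  unfolding S3_integral_def by (intro integral_cong) (simp add: sgn_shell)

lemma S3_integral_add:
  "continuous_on S3 f \<Longrightarrow> continuous_on S3 g \<Longrightarrow> S3_integral (\<lambda>x. f x + g x) = S3_integral f + S3_integral g"
  unfolding S3_integral_def by (intro integral_add integrable_on_shell)

lemma S3_integral_diff:
  "continuous_on S3 f \<Longrightarrow> continuous_on S3 g \<Longrightarrow> S3_integral (\<lambda>x. f x - g x) = S3_integral f - S3_integral g"
  unfolding S3_integral_def by (intro integral_diff integrable_on_shell)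

lemma S3_integral_cmult: "S3_integral (\<lambda>x. r * f x) = r * S3_integral f"
  unfolding S3_integral_def by simp

lemma S3_integral_mono:
  "continuous_on S3 f \<Longrightarrow> continuous_on S3 g \<Longrightarrow> (\<And>x. x \<in> S3 \<Longrightarrow> f x \<le> g x)
    \<Longrightarrow> S3_integral f \<le> S3_integral g"
  unfolding S3_integral_def by (intro integral_le integrable_on_shell) (auto simp: sgn_shell)

lemma S3_integral_nonneg:
  "continuous_on S3 f \<Longrightarrow> (\<And>x. x \<in> S3 \<Longrightarrow> 0 \<le> f x) \<Longrightarrow> 0 \<le> S3_integral f"
  unfolding S3_integral_def by (intro integral_nonneg integrable_on_shell) (auto simp: sgn_shell)

lemma S3_integral_le_bound:
  assumes "continuous_on S3 f" "\<And>x. x \<in> S3 \<Longrightarrow> f x \<le> B"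
  shows "S3_integral f \<le> B * S3_integral (\<lambda>x. 1)"
  using S3_integral_mono[OF assms(1) _ assms(2)] S3_integral_cmult[of B "\<lambda>x. 1"] by simp

lemma S3_integral_eq_0D:
  assumes f: "continuous_on S3 f" "\<And>x. x \<in> S3 \<Longrightarrow> 0 \<le> f x" and "S3_integral f = 0" and x: "x \<in> S3"
  shows "f x = 0"
proof -
  define A where "A = ball (0::quat) 2 - cball 0 1"
  \<comment> \<open>Radius 3/2 puts \<open>p\<close> in the interior of the shell, where a whole box
    around it is available.\<close>
  define p where "p = (3/2) *\<^sub>R x"
  have "norm x = 1"
    using x by (simp add: mem_S3_iff)
  then have p: "sgn p = x" "p \<in> A"
    by (simp_all add: p_def sgn_div_norm A_def)
  have "open A" "A \<subseteq> shell"
    by (auto simp: A_def shell_def)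
  then obtain a b where ab: "cbox a b \<subseteq> A" "p \<in> box a b"
    using open_contains_cbox[OF _ p(2)] by metis
  have sub: "cbox a b \<subseteq> shell"
    using ab \<open>A \<subseteq> shell\<close> by blast
  have c: "continuous_on (cbox a b) (\<lambda>x. f (sgn x))"
    by (rule continuous_on_subset[OF continuous_on_shell[OF f(1)] sub])
  have i: "(\<lambda>x. f (sgn x)) integrable_on cbox a b"
    by (rule integrable_continuous[OF c])
  have nonneg: "0 \<le> f (sgn y)" if "y \<in> shell" for y
    using f(2) sgn_shell[OF that] by blast
  have "integral (cbox a b) (\<lambda>x. f (sgn x)) \<le> S3_integral f"
    unfolding S3_integral_def
    by (intro integral_subset_le sub i integrable_on_shell f ballI nonneg)
  moreover have "0 \<le> integral (cbox a b) (\<lambda>x. f (sgn x))"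
    using sub nonneg by (intro integral_nonneg i) auto
  ultimately have "((\<lambda>x. f (sgn x)) has_integral 0) (cbox a b)"
    using integrable_integral[OF i] assms(3) by simp
  then have "f (sgn p) = 0"
    using ab(2) sub nonneg box_subset_cbox by (intro has_integral_0_cbox_imp_0[OF c]) blast+
  then show ?thesis
    by (simp add: p)
qed

lemma sgn_qmult: "g \<in> S3 \<Longrightarrow> sgn (x \<bullet>\<^sub>H g) = sgn x \<bullet>\<^sub>H g"
  by (simp add: sgn_div_norm norm_qmult mem_S3_iff qmult.scaleR_left)

lemma qmult_right_image_shell:
  assumes g: "g \<in> S3"
  shows "(\<lambda>x. x \<bullet>\<^sub>H g) ` shell = shell"
proof -
  have n: "norm g = 1" "norm (qcnj g) = 1"
    using g by (simp_all add: mem_S3_iff norm_eq_sqrt_inner inner_quat)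
  have "qcnj g \<bullet>\<^sub>H g = qone"
    using qcnj_qmult_cancel[OF g, of qone] by simp
  then have "y = (y \<bullet>\<^sub>H qcnj g) \<bullet>\<^sub>H g" for y
    by (simp add: qmult_assoc)
  moreover have "x \<bullet>\<^sub>H g \<in> shell \<longleftrightarrow> x \<in> shell" "x \<bullet>\<^sub>H qcnj g \<in> shell \<longleftrightarrow> x \<in> shell" for x
    by (simp_all add: shell_def norm_qmult n)
  ultimately show ?thesis
    by (metis (no_types, lifting) image_eqI image_subsetI subsetI subset_antisym)
qed

lemma continuous_on_qmult_right:
  fixes f :: "quat \<Rightarrow> 'b::topological_space"
  assumes "continuous_on S3 f" "g \<in> S3"
  shows "continuous_on S3 (\<lambda>x. f (x \<bullet>\<^sub>H g))"
  by (rule continuous_on_compose2[OF assms(1)])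
    (auto intro!: S3_qmult assms linear_continuous_on qmult.bounded_linear_left)

text \<open>Right multiplication by a unit quaternion is an orthogonal map of the ambient space; it
  preserves the shell and commutes with \<open>sgn\<close>.\<close>

lemma S3_integral_qmult_right:
  assumes f: "continuous_on S3 f" and g: "g \<in> S3"
  shows "S3_integral (\<lambda>x. f (x \<bullet>\<^sub>H g)) = S3_integral f"
proof -
  \<comment> \<open>The integrand is wrapped as a map into \<open>real ^ 1\<close>, the form in
    which the linear change of variables applies.\<close>
  let ?R = "\<lambda>x. x \<bullet>\<^sub>H g" and ?F = "\<lambda>x. (\<chi> i. f (sgn x)) :: real ^ 1"
  have R: "linear ?R"
    by (intro bounded_linear.linear qmult.bounded_linear_left)
  have "orthogonal_transformation ?R"
    using g by (simp add: orthogonal_transformation R norm_qmult mem_S3_iff)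
  then have det: "\<bar>det (matrix ?R)\<bar> = 1"
    by simp
  have "continuous_on S3 (\<lambda>x. (\<chi> i. f x) :: real ^ 1)"
    by (intro continuous_intros f)
  then have F: "?F absolutely_integrable_on shell"
    by (rule absolutely_integrable_on_shell)
  have "integral shell ?F = integral shell (\<lambda>x. ?F (?R x))"
    using integral_change_of_variables_linear[OF R, where f="?F" and S=shell] F
    by (simp add: qmult_right_image_shell[OF g] det o_def)
  then have "integral shell ?F $ 1 = integral shell (\<lambda>x. ?F (?R x)) $ 1"
    by simp
  moreover have "?F integrable_on shell"
    using F set_lebesgue_integral_eq_integral(1) by blast
  moreover have "(\<lambda>x. ?F (?R x)) absolutely_integrable_on shell"
    using F absolutely_integrable_change_of_variables_linear[OF R, where f="?F" and S=shell]
    by (simp add: qmult_right_image_shell[OF g] det)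
  then have "(\<lambda>x. ?F (?R x)) integrable_on shell"
    using set_lebesgue_integral_eq_integral(1) by blast
  ultimately show ?thesis
    unfolding S3_integral_def
    by (simp add: sgn_qmult[OF g] flip: integral_component_eq_cart)
qed

text \<open>For spinor fields this is the real part of the Hermitian L2 product. It is symmetric and
  makes \<open>f\<close> orthogonal to \<i> f; imaginary parts are recovered by testing against \<i>
  f.\<close>

definition sip :: "(quat \<Rightarrow> 'b::real_inner) \<Rightarrow> (quat \<Rightarrow> 'b) \<Rightarrow> real" where
  "sip f g = S3_integral (\<lambda>x. f x \<bullet> g x)"

lemma sip_commute: "sip f g = sip g f"
  by (simp add: sip_def inner_commute)

lemma sip_cong:
  "(\<And>x. x \<in> S3 \<Longrightarrow> f x = f' x) \<Longrightarrow> (\<And>x. x \<in> S3 \<Longrightarrow> g x = g' x) \<Longrightarrow> sip f g = sip f' g'"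
  unfolding sip_def by (intro S3_integral_cong) simp

lemma sip_add_left:
  "continuous_on S3 f \<Longrightarrow> continuous_on S3 g \<Longrightarrow> continuous_on S3 h \<Longrightarrow>
    sip (\<lambda>x. f x + g x) h = sip f h + sip g h"
  by (simp add: sip_def inner_add_left S3_integral_add continuous_on_inner)

lemma sip_scaleR_left: "sip (\<lambda>x. r *\<^sub>R f x) h = r * sip f h"
  by (simp add: sip_def S3_integral_cmult)

lemma sip_add_right:
  "continuous_on S3 f \<Longrightarrow> continuous_on S3 g \<Longrightarrow> continuous_on S3 h \<Longrightarrow>
    sip h (\<lambda>x. f x + g x) = sip h f + sip h g"
  by (simp add: sip_def inner_add_right S3_integral_add continuous_on_inner)

lemma sip_scaleR_right: "sip h (\<lambda>x. r *\<^sub>R f x) = r * sip h f"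
  by (simp add: sip_def S3_integral_cmult)

lemma sip_diff_left:
  "continuous_on S3 f \<Longrightarrow> continuous_on S3 g \<Longrightarrow> continuous_on S3 h \<Longrightarrow>
    sip (\<lambda>x. f x - g x) h = sip f h - sip g h"
  by (simp add: sip_def inner_diff_left S3_integral_diff continuous_on_inner)

lemma sip_diff_right:
  "continuous_on S3 f \<Longrightarrow> continuous_on S3 g \<Longrightarrow> continuous_on S3 h \<Longrightarrow>
    sip h (\<lambda>x. f x - g x) = sip h f - sip h g"
  by (simp add: sip_def inner_diff_right S3_integral_diff continuous_on_inner)

lemma sip_qmult_right:
  "continuous_on S3 f \<Longrightarrow> continuous_on S3 h \<Longrightarrow> g \<in> S3 \<Longrightarrow>
    sip (\<lambda>x. f (x \<bullet>\<^sub>H g)) (\<lambda>x. h (x \<bullet>\<^sub>H g)) = sip f h"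
  unfolding sip_def
  using S3_integral_qmult_right[of "\<lambda>x. f x \<bullet> h x" g] by (simp add: continuous_on_inner)

lemma sip_nonneg: "continuous_on S3 f \<Longrightarrow> 0 \<le> sip f f"
  unfolding sip_def by (intro S3_integral_nonneg) (auto intro: continuous_on_inner)

lemma sip_eq_0D: "continuous_on S3 f \<Longrightarrow> sip f f = 0 \<Longrightarrow> x \<in> S3 \<Longrightarrow> f x = 0"
  unfolding sip_def using S3_integral_eq_0D[of "\<lambda>x. f x \<bullet> f x" x] by (auto intro: continuous_on_inner)

lemma bounded_on_S3:
  fixes f :: "quat \<Rightarrow> 'b::real_normed_vector"
  assumes "continuous_on S3 f"
  obtains B where "B > 0" "\<And>x. x \<in> S3 \<Longrightarrow> norm (f x) \<le> B"
  using compact_imp_bounded[OF compact_continuous_image[OF assms compact_S3]]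
  unfolding bounded_pos by auto

section \<open>Integration by parts and Wirtinger's inequality along great circles\<close>

context imaginary_unit
begin

text \<open>Compactness makes the remainder uniform in \<open>x\<close>, so that the expansion can
  be integrated over the sphere.\<close>

lemma taylor_bound:
  assumes f: "smooth_on_S3 f"
  obtains B where "B > 0" "\<And>x t. x \<in> S3 \<Longrightarrow> t \<ge> 0 \<Longrightarrow>
    norm (f (x \<bullet>\<^sub>H qexp u t) - f x - t *\<^sub>R lderiv u f x) \<le> B * t\<^sup>2"
proof -
  have f': "smooth_on_S3 (lderiv u f)" and f'': "smooth_on_S3 (lderiv u (lderiv u f))"
    by (intro smooth_on_S3_lderiv f re_zero)+
  obtain B where B: "B > 0" "\<And>x. x \<in> S3 \<Longrightarrow> norm (lderiv u (lderiv u f) x) \<le> B"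
    using bounded_on_S3[OF smooth_on_S3_continuous_on[OF f'']] by blast
  show thesis
  proof (rule that[OF B(1)])
    fix x t assume x: "x \<in> S3" and t: "t \<ge> (0::real)"
    let ?c = "\<lambda>s. x \<bullet>\<^sub>H qexp u s"
    have lip: "norm (lderiv u f (?c s) - lderiv u f (?c 0)) \<le> B * norm (s - 0)" if "s \<in> {0..t}" for s
    proof (rule differentiable_bound[of "{0..t}" _ "\<lambda>r h. h *\<^sub>R lderiv u (lderiv u f) (?c r)"])
      show "((\<lambda>s. lderiv u f (?c s)) has_derivative (\<lambda>h. h *\<^sub>R lderiv u (lderiv u f) (?c r))) (at r within {0..t})" for r
        using lderiv_along[OF f' x, of r] unfolding has_vector_derivative_def
        by (rule has_derivative_at_withinI)
      show "onorm (\<lambda>h. h *\<^sub>R lderiv u (lderiv u f) (?c r)) \<le> B" for r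
        using B(2)[of "?c r"] x qexp_in_S3 S3_qmult
        by (intro onorm_le) (simp add: mult.commute[of B] mult_left_mono)
    qed (use that in auto)
    have *: "norm (lderiv u f (?c s) - lderiv u f (?c 0)) \<le> B * t" if "s \<in> {0..t}" for s
      by (rule order_trans[OF lip[OF that]]) (use that B(1) in simp)
    have "norm (f (?c t) - f (?c 0) - (t - 0) *\<^sub>R lderiv u f (?c 0)) \<le> norm (t - 0) * (B * t)"
      by (rule vector_differentiable_bound_linearization[of "{0..t}" _ "\<lambda>s. lderiv u f (?c s)"])
        (use * t has_vector_derivative_at_within[OF lderiv_along[OF f x]] in \<open>auto simp: closed_segment_eq_real_ivl\<close>)
    then show "norm (f (?c t) - f x - t *\<^sub>R lderiv u f x) \<le> B * t\<^sup>2"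
      using t by (simp add: power2_eq_square algebra_simps)
  qed
qed

text \<open>By translation invariance the Taylor remainder at step \<open>t\<close> integrates to -t
  times the integral in question, while the remainder itself is O(t^2).\<close>

lemma S3_integral_lderiv:
  assumes f: "smooth_on_S3 f"
  shows "S3_integral (lderiv u f) = 0"
proof -
  obtain B where B: "B > 0" "\<And>x t. x \<in> S3 \<Longrightarrow> t \<ge> 0 \<Longrightarrow>
      norm (f (x \<bullet>\<^sub>H qexp u t) - f x - t *\<^sub>R lderiv u f x) \<le> B * t\<^sup>2"
    using taylor_bound[OF f] by blast
  have c: "continuous_on S3 f" "continuous_on S3 (lderiv u f)"
    by (intro smooth_on_S3_continuous_on smooth_on_S3_lderiv f re_zero)+
  define V where "V = S3_integral (\<lambda>x. 1)"
  have V: "V \<ge> 0"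
    unfolding V_def by (intro S3_integral_nonneg) auto
  have lin: "\<bar>S3_integral (lderiv u f)\<bar> \<le> (B * V) * t" if t: "t > 0" for t
  proof -
    let ?r = "\<lambda>x. f (x \<bullet>\<^sub>H qexp u t) + (- 1) * f x + (- t) * lderiv u f x"
    have cs: "continuous_on S3 (\<lambda>x. f (x \<bullet>\<^sub>H qexp u t))"
      by (rule continuous_on_qmult_right[OF c(1) qexp_in_S3])
    have r: "continuous_on S3 (\<lambda>x. s * ?r x)" for s
      by (intro continuous_intros c cs)
    have "S3_integral ?r = - t * S3_integral (lderiv u f)"
      using S3_integral_qmult_right[OF c(1) qexp_in_S3, of t]
        S3_integral_cmult[of "- 1" f] S3_integral_cmult[of "- t" "lderiv u f"]
      by (subst S3_integral_add, (intro continuous_intros c cs)+)+ linarith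
    moreover have *: "s * ?r x \<le> B * t\<^sup>2" if "x \<in> S3" "s \<in> {1, -1}" for s x
      using B(2)[OF that(1), of t] that(2) t by auto
    have **: "S3_integral (\<lambda>x. s * ?r x) \<le> B * t\<^sup>2 * V" if "s \<in> {1, -1}" for s
      unfolding V_def by (rule S3_integral_le_bound[OF r *[OF _ that]])
    have "s * S3_integral ?r \<le> B * t\<^sup>2 * V" if "s \<in> {1, -1}" for s
      using **[OF that] by (simp only: S3_integral_cmult)
    from this[of 1] this[of "-1"] have "\<bar>S3_integral ?r\<bar> \<le> B * t\<^sup>2 * V"
      by simp
    ultimately have "t * \<bar>S3_integral (lderiv u f)\<bar> \<le> t * ((B * V) * t)"
      using t by (simp add: abs_mult power2_eq_square algebra_simps)
    then show ?thesis
      using t by simp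
  qed
  have "\<bar>S3_integral (lderiv u f)\<bar> \<le> 0 + e" if "e > 0" for e
  proof -
    have BV: "B * V + 1 > 0"
      using B(1) V by (simp add: add_nonneg_pos)
    have "\<bar>S3_integral (lderiv u f)\<bar> \<le> (B * V) * (e / (B * V + 1))"
      using BV that by (intro lin) simp
    also have "\<dots> \<le> e"
      using BV that by (simp add: field_simps)
    finally show ?thesis by simp
  qed
  then have "\<bar>S3_integral (lderiv u f)\<bar> \<le> 0"
    by (rule field_le_epsilon)
  then show ?thesis by simp
qed

lemma sip_lderiv:
  assumes "smooth_on_S3 f" "smooth_on_S3 g"
  shows "sip (lderiv u f) g = - sip f (lderiv u g)"
proof -
  have c: "continuous_on S3 f" "continuous_on S3 (lderiv u f)" "continuous_on S3 g" "continuous_on S3 (lderiv u g)"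
    by (intro smooth_on_S3_continuous_on smooth_on_S3_lderiv assms re_zero)+
  have "0 = S3_integral (lderiv u (\<lambda>x. f x \<bullet> g x))"
    by (simp add: S3_integral_lderiv smooth_on_S3_bilinear[OF bounded_bilinear_inner assms])
  also have "\<dots> = S3_integral (\<lambda>x. f x \<bullet> lderiv u g x + lderiv u f x \<bullet> g x)"
    by (intro S3_integral_cong lderiv_bilinear[OF bounded_bilinear_inner assms] re_zero)
  also have "\<dots> = sip f (lderiv u g) + sip (lderiv u f) g"
    unfolding sip_def by (intro S3_integral_add continuous_intros c)
  finally show ?thesis by simp
qed

text \<open>Autocorrelation of \<open>f\<close> under right translation along the circles. In terms
  of Fourier modes it is the sum of |f_n|^2 cos (n t).\<close>

definition corr :: "(quat \<Rightarrow> 'b::real_inner) \<Rightarrow> real \<Rightarrow> real" where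
  "corr f t = sip (\<lambda>x. f (x \<bullet>\<^sub>H qexp u t)) f"

lemma qmult_qexp_qexp: "x \<bullet>\<^sub>H qexp u s \<bullet>\<^sub>H qexp u t = x \<bullet>\<^sub>H qexp u (s + t)"
  by (simp add: qmult_assoc qexp_add)

lemma sip_shift:
  assumes "continuous_on S3 f"
  shows "sip (\<lambda>x. f (x \<bullet>\<^sub>H qexp u s)) (\<lambda>x. f (x \<bullet>\<^sub>H qexp u t)) = corr f (s - t)"
  using sip_qmult_right[OF continuous_on_qmult_right[OF assms qexp_in_S3, of "s - t"] assms qexp_in_S3, of t]
  by (simp add: corr_def qmult_qexp_qexp)

text \<open>Expands the squared norm of f_t + f_(-t) - 2 c f, where f_s denotes the translate of
  \<open>f\<close> by \<open>qexp u s\<close>.\<close>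

lemma corr_half_angle:
  assumes f: "continuous_on S3 f"
  shows "0 \<le> 2 * corr f 0 + 2 * corr f (2 * t) + 4 * c\<^sup>2 * corr f 0 - 8 * c * corr f t"
proof -
  let ?f = "\<lambda>s x. f (x \<bullet>\<^sub>H qexp u s)"
  have c: "continuous_on S3 (?f s)" for s
    by (rule continuous_on_qmult_right[OF f qexp_in_S3])
  have "corr f (- s) = corr f s" for s
    using sip_shift[OF f, of 0 s] sip_shift[OF f, of s 0] sip_commute[of "?f 0" "?f s"] by simp
  moreover have "0 \<le> sip (\<lambda>x. ?f t x + ?f (- t) x + (- 2 * c) *\<^sub>R ?f 0 x)
      (\<lambda>x. ?f t x + ?f (- t) x + (- 2 * c) *\<^sub>R ?f 0 x)"
    by (intro sip_nonneg continuous_intros c)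
  ultimately show ?thesis
    by (simp add: sip_add_left sip_add_right c continuous_on_add continuous_on_scaleR sip_scaleR_left
        sip_scaleR_right sip_shift[OF f] power2_eq_square algebra_simps
        del: qexp_0 scaleR_minus_left scaleR_left.minus)
qed

text \<open>An odd field has only odd modes, and cos (n t) <= cos t for odd n at these particular
  angles. The proof halves the angle repeatedly: by antiperiodicity the correlation vanishes at pi /
  2, and \<open>corr_half_angle\<close> passes from 2 t to t.\<close>

lemma corr_le_cos:
  assumes f: "continuous_on S3 f" and odd: "\<And>x. x \<in> S3 \<Longrightarrow> f (- x) = - f x"
  shows "corr f (pi / 2 ^ Suc m) \<le> cos (pi / 2 ^ Suc m) * corr f 0"
proof (induction m)
  case 0
  have shift: "corr f (s + pi) = - corr f s" for s
  proof -
    have "sip (\<lambda>x. f (x \<bullet>\<^sub>H qexp u (s + pi))) f = sip (\<lambda>x. (-1) *\<^sub>R f (x \<bullet>\<^sub>H qexp u s)) f"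
      using odd by (intro sip_cong) (simp_all add: S3_qmult qexp_in_S3 flip: qmult_qexp_qexp)
    then show ?thesis
      by (simp only: corr_def sip_scaleR_left)
  qed
  have "corr f (pi / 2) = - corr f (- pi / 2)"
    using shift[of "- pi / 2"] by (simp add: field_simps)
  also have "corr f (- pi / 2) = corr f (pi / 2)"
    using sip_shift[OF f, of 0 "pi / 2"] sip_shift[OF f, of "pi / 2" 0]
      sip_commute[of "\<lambda>x. f (x \<bullet>\<^sub>H qexp u 0)"] by simp
  finally show ?case
    by simp
next
  case (Suc m)
  define t where "t = pi / 2 ^ Suc (Suc m)"
  have t: "2 * t = pi / 2 ^ Suc m" "0 < t" "t < pi / 2"
    using one_le_power[of "2::real" m] by (simp_all add: t_def field_simps del: one_le_power)
  have pos: "cos t > 0"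
    using t by (intro cos_gt_zero) auto
  \<comment> \<open>With c = cos t the square behind \<open>corr_half_angle\<close> vanishes on the
    first harmonic; the right-hand side becomes 8 (cos t)^2 times \<open>corr f 0\<close>.\<close>
  have "8 * cos t * corr f t \<le> 2 * corr f 0 + 2 * corr f (2 * t) + 4 * (cos t)\<^sup>2 * corr f 0"
    using corr_half_angle[OF f, of t "cos t"] by simp
  also have "corr f (2 * t) \<le> (2 * (cos t)\<^sup>2 - 1) * corr f 0"
    using Suc t(1) cos_double_cos[of t] by simp
  finally have "8 * cos t * corr f t \<le> 8 * cos t * (cos t * corr f 0)"
    by (simp add: power2_eq_square algebra_simps)
  then show ?case
    using pos by (simp add: t_def)
qed

text \<open>Wirtinger's inequality: on each circle \<open>t \<mapsto> x \<bullet>\<^sub>H qexp u t\<close> an odd field is antiperiodic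
  with antiperiod \<open>\<pi>\<close>. Here it is obtained from difference quotients with steps \<open>\<pi> / 2 ^ m\<close>.\<close>

lemma wirtinger:
  fixes f :: "quat \<Rightarrow> 'b::euclidean_space"
  assumes f: "smooth_on_S3 f" and odd: "\<And>x. x \<in> S3 \<Longrightarrow> f (- x) = - f x"
  shows "sip f f \<le> sip (lderiv u f) (lderiv u f)"
proof -
  let ?f = "\<lambda>s x. f (x \<bullet>\<^sub>H qexp u s)"
  have c: "continuous_on S3 f" "continuous_on S3 (lderiv u f)" "continuous_on S3 (?f s)" for s
    by (intro continuous_on_qmult_right qexp_in_S3 smooth_on_S3_continuous_on smooth_on_S3_lderiv f re_zero)+
  obtain B where B: "B > 0" "\<And>x t. x \<in> S3 \<Longrightarrow> t \<ge> 0 \<Longrightarrow>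
      norm (f (x \<bullet>\<^sub>H qexp u t) - f x - t *\<^sub>R lderiv u f x) \<le> B * t\<^sup>2"
    using taylor_bound[OF f] by blast
  obtain M where M: "M > 0" "\<And>x. x \<in> S3 \<Longrightarrow> norm (lderiv u f x) \<le> M"
    using bounded_on_S3[OF c(2)] by blast
  define V where "V = S3_integral (\<lambda>x. 1)"
  define K where "K = V * (2 * M * B + B\<^sup>2)"
  have corr0: "corr f 0 = sip f f"
    by (simp add: corr_def)
  \<comment> \<open>The left-hand side is the squared norm of the increment of \<open>f\<close> over
    a step \<open>t\<close>; up to O(t^3) it is at most t^2 times that of the derivative.\<close>
  have bound: "2 * sip f f - 2 * corr f t \<le> t\<^sup>2 * (sip (lderiv u f) (lderiv u f) + K * t)"
    if t: "0 \<le> t" "t \<le> 1" for t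
  proof -
    let ?d = "\<lambda>x. ?f t x - f x"
    have "2 * sip f f - 2 * corr f t = sip ?d ?d"
      using sip_shift[OF c(1), of t t] sip_commute[of f "?f t"]
      by (simp add: sip_diff_left sip_diff_right c continuous_on_diff corr0 corr_def)
    also have "\<dots> \<le> S3_integral (\<lambda>x. t\<^sup>2 * (lderiv u f x \<bullet> lderiv u f x) + t\<^sup>2 * ((2 * M * B + B\<^sup>2) * t))"
      unfolding sip_def
    proof (rule S3_integral_mono)
      fix x assume x: "x \<in> S3"
      let ?n = "norm (lderiv u f x)"
      have "norm (?d x) \<le> norm (?d x - t *\<^sub>R lderiv u f x) + norm (t *\<^sub>R lderiv u f x)"
        by (metis diff_add_cancel norm_triangle_ineq)
      also have "\<dots> \<le> B * t\<^sup>2 + t * ?n"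
        using B(2)[OF x t(1)] t by simp
      finally have "norm (?d x) ^ 2 \<le> (B * t\<^sup>2 + t * ?n) ^ 2"
        by (rule power_mono) simp
      also have "\<dots> = t\<^sup>2 * ?n\<^sup>2 + t\<^sup>2 * (t * (2 * ?n * B + B\<^sup>2 * t))"
        by (simp add: power2_eq_square algebra_simps)
      also have "\<dots> \<le> t\<^sup>2 * ?n\<^sup>2 + t\<^sup>2 * (t * (2 * M * B + B\<^sup>2 * 1))"
        using M(2)[OF x] B(1) t by (intro add_left_mono mult_left_mono add_mono) auto
      finally show "?d x \<bullet> ?d x \<le> t\<^sup>2 * (lderiv u f x \<bullet> lderiv u f x) + t\<^sup>2 * ((2 * M * B + B\<^sup>2) * t)"
        by (simp add: power2_norm_eq_inner algebra_simps)
    qed (intro continuous_intros c)+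
    also have "\<dots> = S3_integral (\<lambda>x. t\<^sup>2 * (lderiv u f x \<bullet> lderiv u f x))
        + S3_integral (\<lambda>x. t\<^sup>2 * ((2 * M * B + B\<^sup>2) * t) * 1)"
      by (subst S3_integral_add) (auto intro!: continuous_intros c)
    also have "\<dots> = t\<^sup>2 * (sip (lderiv u f) (lderiv u f) + K * t)"
      unfolding S3_integral_cmult by (simp add: sip_def K_def V_def algebra_simps)
    finally show ?thesis .
  qed
  \<comment> \<open>The sequence starts at pi / 4 because \<open>bound\<close> applies to angles at
    most 1.\<close>
  define \<theta> where "\<theta> m = pi / 2 ^ Suc (Suc m)" for m :: nat
  have \<theta>: "\<theta> m > 0" "\<theta> m \<le> 1" for m
  proof -
    have "pi \<le> 4 * 2 ^ m"
      using pi_less_4 one_le_power[of "2::real" m] by linarith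
    then show "\<theta> m > 0" "\<theta> m \<le> 1"
      by (simp_all add: \<theta>_def field_simps)
  qed
  \<comment> \<open>The factor 2 (1 - cos t) / t^2 is the square of sin (t / 2) / (t / 2), which
    tends to 1.\<close>
  have key: "(sin (\<theta> m / 2) / (\<theta> m / 2))\<^sup>2 * sip f f \<le> sip (lderiv u f) (lderiv u f) + K * \<theta> m" for m
  proof -
    have "2 * (1 - cos (\<theta> m)) * sip f f \<le> 2 * sip f f - 2 * corr f (\<theta> m)"
      using corr_le_cos[OF c(1) odd, of "Suc m"] by (simp add: \<theta>_def corr0 algebra_simps)
    also have "\<dots> \<le> (\<theta> m)\<^sup>2 * (sip (lderiv u f) (lderiv u f) + K * \<theta> m)"
      using \<theta>[of m] by (intro bound) auto
    finally have "2 * (1 - cos (\<theta> m)) / (\<theta> m)\<^sup>2 * sip f f \<le> sip (lderiv u f) (lderiv u f) + K * \<theta> m"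
      using \<theta>(1)[of m] by (simp add: field_simps)
    also have "2 * (1 - cos (\<theta> m)) / (\<theta> m)\<^sup>2 = (sin (\<theta> m / 2) / (\<theta> m / 2))\<^sup>2"
      using cos_double_sin[of "\<theta> m / 2"] by (simp add: power_divide)
    finally show ?thesis .
  qed
  have "(\<lambda>m. pi / 4 * (1 / 2) ^ m) \<longlonglongrightarrow> pi / 4 * 0"
    by (intro tendsto_intros LIMSEQ_power_zero) simp
  then have \<theta>0: "\<theta> \<longlonglongrightarrow> 0"
    by (simp add: \<theta>_def[abs_def] power_divide)
  have "(\<lambda>h. (sin (0 + h) - sin 0) / h) \<midarrow>0\<rightarrow> cos (0::real)"
    using DERIV_sin[of 0] unfolding DERIV_def by simp
  then have sinc: "(\<lambda>h. sin h / h) \<midarrow>0\<rightarrow> (1::real)"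
    by simp
  have "filterlim (\<lambda>m. \<theta> m / 2) (at 0) sequentially"
    unfolding filterlim_at using \<theta>(1) tendsto_divide[OF \<theta>0 tendsto_const[of 2]]
    by (auto simp: less_imp_neq[symmetric])
  with sinc have "(\<lambda>m. sin (\<theta> m / 2) / (\<theta> m / 2)) \<longlonglongrightarrow> 1"
    by (rule filterlim_compose)
  then have "(\<lambda>m. (sin (\<theta> m / 2) / (\<theta> m / 2))\<^sup>2 * sip f f) \<longlonglongrightarrow> 1\<^sup>2 * sip f f"
    by (intro tendsto_intros)
  moreover have "(\<lambda>m. sip (lderiv u f) (lderiv u f) + K * \<theta> m) \<longlonglongrightarrow> sip (lderiv u f) (lderiv u f) + K * 0"
    by (intro tendsto_intros \<theta>0)
  ultimately have "1\<^sup>2 * sip f f \<le> sip (lderiv u f) (lderiv u f) + K * 0"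
    by (rule LIMSEQ_le) (use key in auto)
  then show ?thesis by simp
qed

end


section \<open>The parts of the Dirac operator\<close>

lemma clifford_mult:
  "clifford 1 *v v = vector [\<i> * v$1, - \<i> * v$2]"
  "clifford 2 *v v = vector [v$2, - v$1]"
  "clifford 3 *v v = vector [\<i> * v$2, \<i> * v$1]"
  by (simp_all add: clifford_def matrix_vector_mult_def vec_eq_iff forall_2 sum_2)

lemma spinor_eq_iff: "v = w \<longleftrightarrow> v$1 = w$1 \<and> v$2 = w$2" for v w :: spinor
  by (simp add: vec_eq_iff forall_2)

lemma inner_spinor: "v \<bullet> w = Re (v$1) * Re (w$1) + Im (v$1) * Im (w$1) + Re (v$2) * Re (w$2) + Im (v$2) * Im (w$2)"
  for v w :: spinor
  by (simp add: inner_vec_def sum_2 inner_complex_def)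

lemma clifford_square: "clifford l *v (clifford l *v v) = - v"
  using exhaust_3[of l] by (auto simp: clifford_mult spinor_eq_iff)

definition cyclic :: "3 \<Rightarrow> 3 \<Rightarrow> 3 \<Rightarrow> bool" where
  "cyclic l m k \<longleftrightarrow> (l, m, k) \<in> {(1, 2, 3), (2, 3, 1), (3, 1, 2)}"

text \<open>Reflects e_1 e_2 e_3 = -1: the Clifford generators multiply like i, j, k.\<close>

lemma clifford_cyclic:
  assumes "cyclic l m k"
  shows "clifford l *v (clifford m *v v) = clifford k *v v"
    "clifford m *v (clifford l *v v) = - (clifford k *v v)"
  using assms by (auto simp: cyclic_def clifford_mult spinor_eq_iff)

lemma bounded_linear_clifford: "bounded_linear ((*v) (clifford l))"
  using exhaust_3[of l]
  by (auto intro!: linearI simp: clifford_mult spinor_eq_iff algebra_simps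
      simp flip: linear_conv_bounded_linear)

lemma inner_clifford: "(clifford l *v v) \<bullet> w = - (v \<bullet> (clifford l *v w))"
  using exhaust_3[of l] by (auto simp: clifford_mult inner_spinor algebra_simps)

lemma inner_clifford_clifford: "(clifford l *v v) \<bullet> (clifford l *v w) = v \<bullet> w"
  by (simp add: inner_clifford clifford_square)

text \<open>The algebra homomorphism from the quaternions to complex 2 x 2 matrices under which i,
  j, k act as \<open>clifford 1\<close>, \<open>clifford 2\<close>, \<open>clifford 3\<close>; on
  \<open>S3\<close> it is the spin representation.\<close>

definition spin_rep :: "quat \<Rightarrow> spinor \<Rightarrow> spinor" where
  "spin_rep x v = x$1 *\<^sub>R v + x$2 *\<^sub>R (clifford 1 *v v) + x$3 *\<^sub>R (clifford 2 *v v) + x$4 *\<^sub>R (clifford 3 *v v)"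

lemma spin_rep_nth:
  "spin_rep x v $ 1 = Complex (x$1) (x$2) * v$1 + Complex (x$3) (x$4) * v$2"
  "spin_rep x v $ 2 = Complex (- x$3) (x$4) * v$1 + Complex (x$1) (- x$2) * v$2"
  by (simp_all add: spin_rep_def clifford_mult complex_eq_iff algebra_simps)

lemma bounded_bilinear_spin_rep: "bounded_bilinear spin_rep"
  by (intro bilinear_conv_bounded_bilinear[THEN iffD1])
    (auto simp: bilinear_def spinor_eq_iff spin_rep_nth complex_eq_iff algebra_simps intro!: linearI)

interpretation spin_rep: bounded_bilinear spin_rep
  by (rule bounded_bilinear_spin_rep)

lemma spin_rep_qmult: "spin_rep (x \<bullet>\<^sub>H y) v = spin_rep x (spin_rep y v)"
  by (simp add: spinor_eq_iff spin_rep_nth complex_eq_iff algebra_simps)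

lemma spin_rep_qone: "spin_rep qone v = v"
  by (simp add: spinor_eq_iff spin_rep_nth complex_eq_iff)

lemma inner_spin_rep: "spin_rep x v \<bullet> spin_rep x v = (x \<bullet> x) * (v \<bullet> v)"
  by (simp add: inner_spinor spin_rep_nth inner_quat) algebra

definition qbase :: "3 \<Rightarrow> quat" where
  "qbase l = (vector [qi, qj, qk] :: quat ^ 3) $ l"

lemma qbase_simps: "qbase 1 = qi" "qbase 2 = qj" "qbase 3 = qk"
  by (simp_all add: qbase_def)

lemma imaginary_unit_qbase: "imaginary_unit (qbase l)"
  using exhaust_3[of l] imaginary_unit_basis by (auto simp: qbase_simps)

lemma qbase_re [simp]: "qbase l $ 1 = 0"
  by (rule imaginary_unit.re_zero[OF imaginary_unit_qbase])

lemma qbase_cyclic: "cyclic l m k \<Longrightarrow> qbase l \<bullet>\<^sub>H qbase m - qbase m \<bullet>\<^sub>H qbase l = 2 *\<^sub>R qbase k"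
  by (auto simp: cyclic_def qbase_simps quat_eq_iff)

lemma spin_rep_qbase: "spin_rep (qbase l) v = clifford l *v v"
  using exhaust_3[of l] by (auto simp: spinor_eq_iff spin_rep_nth qbase_simps clifford_mult complex_eq_iff)

lemma spin_rep_qcnj:
  assumes "x \<in> S3"
  shows "spin_rep (qcnj x) (spin_rep x v) = v"
  using qcnj_qmult_cancel[OF assms, of qone] by (simp add: spin_rep_qone flip: spin_rep_qmult)

text \<open>The operator T_l, taken for the unscaled directions i, j, k and hence independent of the
  metric.\<close>

definition dpart :: "3 \<Rightarrow> (quat \<Rightarrow> spinor) \<Rightarrow> quat \<Rightarrow> spinor" where
  "dpart l f x = clifford l *v lderiv (qbase l) f x"

lemma smooth_on_S3_dpart: "smooth_on_S3 f \<Longrightarrow> smooth_on_S3 (dpart l f)"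
  unfolding dpart_def
  by (intro smooth_on_S3_bounded_linear[OF bounded_linear_clifford] smooth_on_S3_lderiv qbase_re)

lemma dpart_cong: "x \<in> S3 \<Longrightarrow> (\<And>y. y \<in> S3 \<Longrightarrow> f y = g y) \<Longrightarrow> dpart l f x = dpart l g x"
  unfolding dpart_def using lderiv_cong qbase_re by metis

text \<open>Clifford multiplication and \<open>lderiv\<close> are both skew and commute with each
  other, so their product is symmetric.\<close>

lemma sip_dpart:
  assumes "smooth_on_S3 f" "smooth_on_S3 g"
  shows "sip (dpart l f) g = sip f (dpart l g)"
proof -
  have cg: "smooth_on_S3 (\<lambda>x. (-1) *\<^sub>R (clifford l *v g x))"
    by (intro smooth_on_S3_bounded_linear[OF bounded_linear_scaleR_right]
        smooth_on_S3_bounded_linear[OF bounded_linear_clifford] assms)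
  have "sip (dpart l f) g = sip (lderiv (qbase l) f) (\<lambda>x. (-1) *\<^sub>R (clifford l *v g x))"
    unfolding sip_def dpart_def by (intro S3_integral_cong) (simp add: inner_clifford)
  also have "\<dots> = - sip f (lderiv (qbase l) (\<lambda>x. (-1) *\<^sub>R (clifford l *v g x)))"
    by (rule imaginary_unit.sip_lderiv[OF imaginary_unit_qbase assms(1) cg])
  also have "sip f (lderiv (qbase l) (\<lambda>x. (-1) *\<^sub>R (clifford l *v g x))) = sip f (\<lambda>x. (-1) *\<^sub>R dpart l g x)"
    unfolding dpart_def
    by (intro sip_cong refl)
      (simp only: lderiv_bounded_linear[OF bounded_linear_scaleR_right] qbase_re
        lderiv_bounded_linear[OF bounded_linear_clifford] assms(2)
        smooth_on_S3_bounded_linear[OF bounded_linear_clifford assms(2)])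
  finally show ?thesis
    by (simp only: sip_scaleR_right)
qed

lemma sip_dpart_self: "sip (dpart l f) (dpart l f) = sip (lderiv (qbase l) f) (lderiv (qbase l) f)"
  by (simp add: sip_def dpart_def inner_clifford_clifford)

lemma dpart_dpart:
  assumes "smooth_on_S3 f" "x \<in> S3"
  shows "dpart l (dpart m f) x = clifford l *v (clifford m *v lderiv (qbase l) (lderiv (qbase m) f) x)"
  unfolding dpart_def using assms
  by (subst lderiv_bounded_linear[OF bounded_linear_clifford]) (auto intro!: smooth_on_S3_lderiv)

text \<open>e_l and e_m anticommute with product e_k, so the sum is e_k applied to the commutator of
  the two derivatives, which is twice the k-th derivative.\<close>

lemma dpart_anticommutator:
  assumes "cyclic l m k" and f: "smooth_on_S3 f" and x: "x \<in> S3"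
  shows "dpart l (dpart m f) x + dpart m (dpart l f) x = 2 *\<^sub>R dpart k f x"
proof -
  have "dpart l (dpart m f) x + dpart m (dpart l f) x
    = clifford k *v (lderiv (qbase l) (lderiv (qbase m) f) x - lderiv (qbase m) (lderiv (qbase l) f) x)"
    using bounded_linear.linear[OF bounded_linear_clifford]
    by (simp add: dpart_dpart f x clifford_cyclic[OF assms(1)] linear_diff)
  also have "\<dots> = clifford k *v (2 *\<^sub>R lderiv (qbase k) f x)"
    using lderiv_commutator[OF f x] lderiv_scaleR[OF f x]
    by (simp add: qbase_cyclic[OF assms(1)])
  also have "\<dots> = 2 *\<^sub>R dpart k f x"
    using linear_cmul[OF bounded_linear.linear[OF bounded_linear_clifford]] by (simp add: dpart_def)
  finally show ?thesis .
qed

lemma continuous_on_dpart: "smooth_on_S3 f \<Longrightarrow> continuous_on S3 (dpart l f)"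
  by (intro smooth_on_S3_continuous_on smooth_on_S3_dpart)

text \<open>By symmetry of the operators, <T_l f, T_m f> equals both <f, T_l T_m f> and <f, T_m T_l
  f>, hence half the pairing of \<open>f\<close> with the anticommutator.\<close>

lemma sip_dpart_cyclic:
  assumes "cyclic l m k" and f: "smooth_on_S3 f"
  shows "sip (dpart l f) (dpart m f) = sip (dpart k f) f"
proof -
  note c = smooth_on_S3_continuous_on[OF f] continuous_on_dpart[OF f]
    continuous_on_dpart[OF smooth_on_S3_dpart[OF f]]
  have "sip f (dpart l (dpart m f)) + sip f (dpart m (dpart l f)) = sip f (\<lambda>x. 2 *\<^sub>R dpart k f x)"
    unfolding sip_add_right[OF c(3,3,1), symmetric]
    by (intro sip_cong refl dpart_anticommutator assms)
  then have "sip (dpart l f) (dpart m f) + sip (dpart m f) (dpart l f) = 2 * sip f (dpart k f)"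
    by (simp only: sip_scaleR_right sip_dpart[OF f smooth_on_S3_dpart[OF f]])
  then show ?thesis
    using sip_commute[of "dpart l f"] sip_commute[of f] by simp
qed

text \<open>The anticommutator relation becomes 2 f = 2 T_k f; two of the three equations therefore
  settle the extremal case.\<close>

lemma dpart_third:
  assumes "cyclic l m k" and f: "smooth_on_S3 f"
    and "\<And>x. x \<in> S3 \<Longrightarrow> dpart l f x = f x" "\<And>x. x \<in> S3 \<Longrightarrow> dpart m f x = f x" and x: "x \<in> S3"
  shows "dpart k f x = f x"
  using dpart_anticommutator[OF assms(1) f x] dpart_cong[OF x, of "dpart l f" f m]
    dpart_cong[OF x, of "dpart m f" f l] assms(3,4) x
  by (simp flip: scaleR_2)

definition even_on_S3 :: "(quat \<Rightarrow> 'b) \<Rightarrow> bool" where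
  "even_on_S3 f \<longleftrightarrow> (\<forall>x\<in>S3. f (- x) = f x)"

definition odd_on_S3 :: "(quat \<Rightarrow> 'b::uminus) \<Rightarrow> bool" where
  "odd_on_S3 f \<longleftrightarrow> (\<forall>x\<in>S3. f (- x) = - f x)"

lemma wirtinger_dpart:
  assumes "smooth_on_S3 f" "odd_on_S3 f"
  shows "sip f f \<le> sip (dpart l f) (dpart l f)"
  using imaginary_unit.wirtinger[OF imaginary_unit_qbase assms(1)] assms(2)
  by (simp add: sip_dpart_self odd_on_S3_def)

lemma sip_dpart_minus_id:
  assumes f: "smooth_on_S3 f"
  shows "sip (\<lambda>x. dpart l f x - f x) (\<lambda>x. dpart l f x - f x)
    = sip (dpart l f) (dpart l f) - 2 * sip (dpart l f) f + sip f f"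
  using sip_commute[of f "dpart l f"]
  by (simp add: sip_diff_left sip_diff_right continuous_on_dpart smooth_on_S3_continuous_on f
      continuous_on_diff)

lemma smooth_on_S3_spin_rep: "smooth_on_S3 f \<Longrightarrow> smooth_on_S3 (\<lambda>x. spin_rep x (f x))"
  by (rule smooth_on_S3_bilinear[OF bounded_bilinear_spin_rep smooth_on_S3_ident])

text \<open>Multiplication by \<open>spin_rep x\<close> adds the Clifford term to the derivative.
  Since \<open>spin_rep\<close> is odd in \<open>x\<close>, it also exchanges parities.\<close>

lemma lderiv_spin_rep:
  assumes "smooth_on_S3 f" "x \<in> S3"
  shows "lderiv (qbase l) (\<lambda>x. spin_rep x (f x)) x = spin_rep x (lderiv (qbase l) f x + clifford l *v f x)"
  by (subst lderiv_bilinear[OF bounded_bilinear_spin_rep smooth_on_S3_ident assms qbase_re])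
    (simp add: lderiv_ident assms spin_rep_qmult spin_rep_qbase spin_rep.add_right)

text \<open>The spin representation turns an even field into an odd one, to which Wirtinger's
  inequality applies; this shifts \<open>dpart l\<close> by \<open>1\<close>.\<close>

lemma two_dpart_le_even:
  assumes f: "smooth_on_S3 f" "even_on_S3 f"
  shows "2 * sip (dpart l f) f \<le> sip (dpart l f) (dpart l f)"
proof -
  let ?\<psi> = "\<lambda>x. spin_rep x (f x)"
  have "odd_on_S3 ?\<psi>"
    using f(2) by (simp add: even_on_S3_def odd_on_S3_def spin_rep.minus_left)
  then have "sip ?\<psi> ?\<psi> \<le> sip (lderiv (qbase l) ?\<psi>) (lderiv (qbase l) ?\<psi>)"
    by (intro imaginary_unit.wirtinger[OF imaginary_unit_qbase smooth_on_S3_spin_rep] f)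
      (auto simp: odd_on_S3_def)
  also have "sip ?\<psi> ?\<psi> = sip f f"
    unfolding sip_def by (intro S3_integral_cong) (simp add: inner_spin_rep mem_S3_iff norm_eq_1)
  also have "sip (lderiv (qbase l) ?\<psi>) (lderiv (qbase l) ?\<psi>) = sip (\<lambda>x. dpart l f x - f x) (\<lambda>x. dpart l f x - f x)"
    unfolding sip_def
  proof (rule S3_integral_cong)
    fix x assume x: "x \<in> S3"
    have "x \<bullet> x = 1"
      using x by (simp add: mem_S3_iff norm_eq_1)
    then have "lderiv (qbase l) ?\<psi> x \<bullet> lderiv (qbase l) ?\<psi> x
      = (lderiv (qbase l) f x + clifford l *v f x) \<bullet> (lderiv (qbase l) f x + clifford l *v f x)"
      by (simp add: lderiv_spin_rep[OF f(1) x] inner_spin_rep)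
    also have "\<dots> = (clifford l *v (lderiv (qbase l) f x + clifford l *v f x))
        \<bullet> (clifford l *v (lderiv (qbase l) f x + clifford l *v f x))"
      by (simp only: inner_clifford_clifford)
    also have "clifford l *v (lderiv (qbase l) f x + clifford l *v f x) = dpart l f x - f x"
      using linear_add[OF bounded_linear.linear[OF bounded_linear_clifford]]
      by (simp add: dpart_def clifford_square)
    finally show "lderiv (qbase l) ?\<psi> x \<bullet> lderiv (qbase l) ?\<psi> x = (dpart l f x - f x) \<bullet> (dpart l f x - f x)" .
  qed
  finally show ?thesis
    by (simp add: sip_dpart_minus_id[OF f(1)])
qed

text \<open>Apply the opposite estimate to e_m f with m different from l: e_m anticommutes with e_l
  and so with T_l, which flips the sign of <T_l f, f> and keeps |T_l f|.\<close>

lemma two_dpart_ge_even: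
  assumes f: "smooth_on_S3 f" "even_on_S3 f"
  shows "- 2 * sip (dpart l f) f \<le> sip (dpart l f) (dpart l f)"
proof -
  have "\<exists>m k. cyclic l m k"
    using exhaust_3[of l] by (auto simp: cyclic_def)
  then obtain m k where lmk: "cyclic l m k"
    by blast
  let ?g = "\<lambda>x. clifford m *v f x"
  have g: "smooth_on_S3 ?g" "even_on_S3 ?g"
    using f by (auto intro: smooth_on_S3_bounded_linear[OF bounded_linear_clifford] simp: even_on_S3_def)
  have "dpart l ?g x = - (clifford m *v dpart l f x)" if "x \<in> S3" for x
    using that unfolding dpart_def
    by (simp add: lderiv_bounded_linear[OF bounded_linear_clifford f(1)] clifford_cyclic[OF lmk])
  then have "sip (dpart l ?g) ?g = sip (\<lambda>x. (-1) *\<^sub>R dpart l f x) f"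
    "sip (dpart l ?g) (dpart l ?g) = sip (dpart l f) (dpart l f)"
    unfolding sip_def by (auto intro!: S3_integral_cong simp: inner_clifford_clifford)
  then show ?thesis
    using two_dpart_le_even[OF g, of l] by (simp only: sip_scaleR_left)
qed

section \<open>Constant and Killing fields as the extremal cases\<close>

definition const_field :: "spinor \<Rightarrow> quat \<Rightarrow> spinor" where
  "const_field v x = (if x \<in> S3 then v else 0)"

definition killing_field :: "spinor \<Rightarrow> quat \<Rightarrow> spinor" where
  "killing_field v x = (if x \<in> S3 then spin_rep (qcnj x) v else 0)"

lemma bounded_linear_qcnj_spin_rep: "bounded_linear (\<lambda>x. spin_rep (qcnj x) v)"
  by (auto intro!: linearI simp: spinor_eq_iff spin_rep_nth complex_eq_iff algebra_simps
      simp flip: linear_conv_bounded_linear)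

lemma smooth_on_S3_const_field: "smooth_on_S3 (const_field v)"
  by (rule smooth_on_S3_cong[OF smooth_on_S3_const]) (simp add: const_field_def)

lemma smooth_on_S3_killing_field: "smooth_on_S3 (killing_field v)"
  by (rule smooth_on_S3_cong[OF smooth_on_S3_bounded_linear[OF bounded_linear_qcnj_spin_rep
          smooth_on_S3_ident]]) (simp add: killing_field_def)

lemma dpart_const_field: "x \<in> S3 \<Longrightarrow> dpart l (const_field v) x = 0"
  using dpart_cong[of x "const_field v" "\<lambda>x. v" l]
  by (simp add: const_field_def dpart_def lderiv_const)

text \<open>The conjugate of x has derivative -q times itself along x q, for q =
  \<open>qbase l\<close>, and e_l squares to -1.\<close>

lemma dpart_killing_field:
  assumes x: "x \<in> S3"
  shows "dpart l (killing_field v) x = killing_field v x"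
proof -
  have "dpart l (killing_field v) x = dpart l (\<lambda>x. spin_rep (qcnj x) v) x"
    by (rule dpart_cong[OF x]) (simp add: killing_field_def)
  also have "\<dots> = clifford l *v (spin_rep (qcnj (x \<bullet>\<^sub>H qbase l)) v)"
    by (simp add: dpart_def lderiv_bounded_linear[OF bounded_linear_qcnj_spin_rep smooth_on_S3_ident x]
        lderiv_ident x)
  also have "qcnj (x \<bullet>\<^sub>H qbase l) = - (qbase l \<bullet>\<^sub>H qcnj x)"
    by (simp add: quat_eq_iff algebra_simps)
  also have "clifford l *v (spin_rep (- (qbase l \<bullet>\<^sub>H qcnj x)) v) = spin_rep (qcnj x) v"
    using linear_neg[OF bounded_linear.linear[OF bounded_linear_clifford]]
    by (simp add: spin_rep.minus_left spin_rep_qmult spin_rep_qbase clifford_square)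
  finally show ?thesis
    using x by (simp add: killing_field_def[of v x])
qed

lemma const_if_dpart_zero:
  assumes f: "smooth_on_S3 f" and "\<And>l x. x \<in> S3 \<Longrightarrow> dpart l f x = 0" and x: "x \<in> S3"
  shows "f x = f qone"
proof -
  have "lderiv (qbase l) f y = 0" if "y \<in> S3" for l y
    using assms(2)[OF that, of l] clifford_square[of l "lderiv (qbase l) f y"]
    by (simp add: dpart_def)
  from this[of _ 1] this[of _ 2] this[of _ 3] show ?thesis
    by (intro constant_if_lderiv_zero[OF f x]) (simp_all add: qbase_simps)
qed

text \<open>T_l f = f says that the derivative of \<open>f\<close> is -e_l f, which the Clifford
  term in \<open>lderiv_spin_rep\<close> cancels; so \<open>spin_rep x (f x)\<close> is
  constant.\<close>

lemma killing_if_dpart_id: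
  assumes f: "smooth_on_S3 f" and "\<And>l x. x \<in> S3 \<Longrightarrow> dpart l f x = f x" and x: "x \<in> S3"
  shows "f x = killing_field (f qone) x"
proof -
  have "lderiv (qbase l) (\<lambda>x. spin_rep x (f x)) y = 0" if "y \<in> S3" for l y
  proof -
    have "clifford l *v f y = clifford l *v dpart l f y"
      using assms(2)[OF that] by simp
    then show ?thesis
      by (simp add: lderiv_spin_rep[OF f that] dpart_def clifford_square spin_rep.zero_right)
  qed
  from this[of _ 1] this[of _ 2] this[of _ 3]
  have "spin_rep x (f x) = spin_rep qone (f qone)"
    by (intro constant_if_lderiv_zero[OF smooth_on_S3_spin_rep[OF f] x]) (simp_all add: qbase_simps)
  then have "spin_rep (qcnj x) (spin_rep x (f x)) = spin_rep (qcnj x) (f qone)"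
    by (simp add: spin_rep_qone)
  then show ?thesis
    using x by (simp add: spin_rep_qcnj killing_field_def)
qed


section \<open>The quadratic form of the squared Dirac operator\<close>

lemma C_abc_rotate: "C_abc b c a = C_abc a b c"
  by (simp add: C_abc_def algebra_simps)

lemma two_C_abc:
  assumes "a > 0" "b > 0" "c > 0"
  shows "2 * C_abc a b c * (a * b * c) = a\<^sup>2 * b\<^sup>2 + b\<^sup>2 * c\<^sup>2 + c\<^sup>2 * a\<^sup>2"
  using assms by (simp add: C_abc_def field_simps power2_eq_square)

text \<open>The formula for 2 a b c C gives (a C - b c)^2 = a^2 (C^2 - b^2 - c^2). The last
  hypothesis is positivity of the scalar curvature in algebraic form.\<close>

lemma C_abc_bound:
  assumes "a > 0" "b > 0" "c > 0" and S: "(C_abc a b c)\<^sup>2 < a\<^sup>2 + b\<^sup>2 + c\<^sup>2"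
  shows "\<bar>a * C_abc a b c - b * c\<bar> < a\<^sup>2"
proof -
  let ?C = "C_abc a b c"
  have "2 * a * ?C * (b * c) = a\<^sup>2 * b\<^sup>2 + b\<^sup>2 * c\<^sup>2 + c\<^sup>2 * a\<^sup>2"
    using two_C_abc[OF assms(1-3)] by (simp add: algebra_simps)
  then have "(a * ?C - b * c)\<^sup>2 = a\<^sup>2 * (?C\<^sup>2 - b\<^sup>2 - c\<^sup>2)"
    by (simp add: power2_eq_square algebra_simps)
  also have "\<dots> < a\<^sup>2 * a\<^sup>2"
    using S assms(1) by (intro mult_strict_left_mono) auto
  finally have "(a * ?C - b * c)\<^sup>2 < (a\<^sup>2)\<^sup>2"
    by (simp add: power2_eq_square)
  then show ?thesis
    by (metis abs_le_square_iff abs_of_nonneg linorder_not_le zero_le_power2)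
qed

text \<open>Multiplied by 2 a b c, the difference 2 C - (a + b + c) is the sum of the squared
  differences of a b, b c and c a. This compares \<mu> with C.\<close>

lemma half_sum_le_C_abc:
  assumes "a > 0" "b > 0" "c > 0"
  shows "a + b + c \<le> 2 * C_abc a b c"
    and "a + b + c = 2 * C_abc a b c \<longleftrightarrow> a = b \<and> b = c"
proof -
  have abc: "a * b * c > 0"
    using assms by simp
  have *: "2 * (2 * C_abc a b c - (a + b + c)) * (a * b * c)
    = (a * b - b * c)\<^sup>2 + (b * c - c * a)\<^sup>2 + (c * a - a * b)\<^sup>2"
    using two_C_abc[OF assms] by (simp add: power2_eq_square algebra_simps)
  have "0 \<le> 2 * (2 * C_abc a b c - (a + b + c)) * (a * b * c)"
    unfolding * by simp
  then have "0 \<le> (2 * C_abc a b c - (a + b + c)) * (a * b * c)"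
    by linarith
  then show "a + b + c \<le> 2 * C_abc a b c"
    using abc zero_le_mult_iff[of "2 * C_abc a b c - (a + b + c)" "a * b * c"] by auto
  show "a + b + c = 2 * C_abc a b c \<longleftrightarrow> a = b \<and> b = c"
  proof
    assume "a + b + c = 2 * C_abc a b c"
    with * have "(a * b - b * c)\<^sup>2 + (b * c - c * a)\<^sup>2 + (c * a - a * b)\<^sup>2 = 0"
      by simp
    then have "a * b - b * c = 0" "b * c - c * a = 0"
      by (simp_all add: add_nonneg_eq_0_iff)
    then show "a = b \<and> b = c"
      using assms by (auto simp: algebra_simps)
  next
    assume "a = b \<and> b = c"
    then show "a + b + c = 2 * C_abc a b c"
      using assms by (simp add: C_abc_def)
  qed
qed

text \<open>\<open>|D f|\<^sup>2\<close> for \<open>D = a T\<^sub>1 + b T\<^sub>2 + c T\<^sub>3 - C\<close> in terms of \<open>N\<^sub>l = |T\<^sub>l f|\<^sup>2\<close>,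
  \<open>t\<^sub>l = \<langle>T\<^sub>l f, f\<rangle>\<close> and \<open>n = |f|\<^sup>2\<close>, given that \<open>\<langle>T\<^sub>1 f, T\<^sub>2 f\<rangle> = t\<^sub>3\<close> and cyclically.\<close>

definition dirac_form :: "real \<Rightarrow> real \<Rightarrow> real \<Rightarrow> real \<Rightarrow> real \<Rightarrow> real \<Rightarrow> real \<Rightarrow> real \<Rightarrow> real \<Rightarrow> real \<Rightarrow> real" where
  "dirac_form a b c N1 N2 N3 t1 t2 t3 n =
    a\<^sup>2 * N1 + b\<^sup>2 * N2 + c\<^sup>2 * N3 + 2 * (b * c * t1 + c * a * t2 + a * b * t3)
    - 2 * C_abc a b c * (a * t1 + b * t2 + c * t3) + (C_abc a b c)\<^sup>2 * n"

lemma dirac_form_rotate: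
  "dirac_form b c a N2 N3 N1 t2 t3 t1 n = dirac_form a b c N1 N2 N3 t1 t2 t3 n"
  by (simp add: dirac_form_def C_abc_rotate algebra_simps)

text \<open>The directions decouple: as |t_l| <= N_l / 2, each contributes at least (a_l^2 - |k_l|)
  N_l, and this coefficient is positive.\<close>

lemma dirac_form_even:
  assumes "a > 0" "b > 0" "c > 0" and S: "(C_abc a b c)\<^sup>2 < a\<^sup>2 + b\<^sup>2 + c\<^sup>2"
    and N: "0 \<le> N1" "0 \<le> N2" "0 \<le> N3"
    and t: "2 * \<bar>t1\<bar> \<le> N1" "2 * \<bar>t2\<bar> \<le> N2" "2 * \<bar>t3\<bar> \<le> N3"
  shows "(C_abc a b c)\<^sup>2 * n \<le> dirac_form a b c N1 N2 N3 t1 t2 t3 n"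
    and "dirac_form a b c N1 N2 N3 t1 t2 t3 n = (C_abc a b c)\<^sup>2 * n \<Longrightarrow> N1 = 0 \<and> N2 = 0 \<and> N3 = 0"
proof -
  define C where "C = C_abc a b c"
  define k1 k2 k3 where "k1 = a * C - b * c" and "k2 = b * C - c * a" and "k3 = c * C - a * b"
  have k: "\<bar>k1\<bar> < a\<^sup>2" "\<bar>k2\<bar> < b\<^sup>2" "\<bar>k3\<bar> < c\<^sup>2"
    using C_abc_bound[of a b c] C_abc_bound[of b c a] C_abc_bound[of c a b] assms(1-4)
    by (simp_all add: k1_def k2_def k3_def C_def C_abc_rotate C_abc_rotate[of c a b] add_ac)
  have kt: "2 * k * t \<le> \<bar>k\<bar> * N" if "2 * \<bar>t\<bar> \<le> N" for k t N :: real
  proof -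
    have "2 * k * t \<le> \<bar>k\<bar> * (2 * \<bar>t\<bar>)"
      by (metis abs_le_D1 abs_mult abs_numeral mult.assoc mult.left_commute order_refl)
    also have "\<dots> \<le> \<bar>k\<bar> * N"
      using that by (intro mult_left_mono) auto
    finally show ?thesis .
  qed
  have "dirac_form a b c N1 N2 N3 t1 t2 t3 n - C\<^sup>2 * n
    = (a\<^sup>2 * N1 - 2 * k1 * t1) + (b\<^sup>2 * N2 - 2 * k2 * t2) + (c\<^sup>2 * N3 - 2 * k3 * t3)"
    by (simp add: dirac_form_def k1_def k2_def k3_def C_def power2_eq_square algebra_simps)
  also have "\<dots> \<ge> (a\<^sup>2 - \<bar>k1\<bar>) * N1 + (b\<^sup>2 - \<bar>k2\<bar>) * N2 + (c\<^sup>2 - \<bar>k3\<bar>) * N3"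
    using kt[OF t(1), of k1] kt[OF t(2), of k2] kt[OF t(3), of k3] by (simp add: algebra_simps)
  finally have *: "(a\<^sup>2 - \<bar>k1\<bar>) * N1 + (b\<^sup>2 - \<bar>k2\<bar>) * N2 + (c\<^sup>2 - \<bar>k3\<bar>) * N3
    \<le> dirac_form a b c N1 N2 N3 t1 t2 t3 n - C\<^sup>2 * n" .
  have nonneg: "0 \<le> (a\<^sup>2 - \<bar>k1\<bar>) * N1" "0 \<le> (b\<^sup>2 - \<bar>k2\<bar>) * N2" "0 \<le> (c\<^sup>2 - \<bar>k3\<bar>) * N3"
    using k N by simp_all
  with * show "(C_abc a b c)\<^sup>2 * n \<le> dirac_form a b c N1 N2 N3 t1 t2 t3 n"
    unfolding C_def by linarith
  assume "dirac_form a b c N1 N2 N3 t1 t2 t3 n = (C_abc a b c)\<^sup>2 * n"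
  with * nonneg have "(a\<^sup>2 - \<bar>k1\<bar>) * N1 = 0" "(b\<^sup>2 - \<bar>k2\<bar>) * N2 = 0" "(c\<^sup>2 - \<bar>k3\<bar>) * N3 = 0"
    unfolding C_def by linarith+
  then show "N1 = 0 \<and> N2 = 0 \<and> N3 = 0"
    using k by auto
qed

text \<open>The sign of k3 is left open. Either way the excess over the minimum is a nonnegative
  remainder plus strictly positive multiples of |T_1 f - f|^2 and |T_2 f - f|^2; from these two, T_3
  f = f will follow by the anticommutator.\<close>

lemma dirac_form_odd_aux:
  assumes "a > 0" "b > 0" "c > 0" and S: "(C_abc a b c)\<^sup>2 < a\<^sup>2 + b\<^sup>2 + c\<^sup>2"
    and k_pos: "a * C_abc a b c - b * c > 0" "b * C_abc a b c - c * a > 0"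
    and N: "n \<le> N1" "n \<le> N2" "n \<le> N3"
    and s: "0 \<le> N1 - 2 * t1 + n" "0 \<le> N2 - 2 * t2 + n" "0 \<le> N3 - 2 * t3 + n"
    and square: "\<And>u v. 0 \<le> u\<^sup>2 * N1 + v\<^sup>2 * N2 + 2 * u * v * t3 - 2 * (u + v) * (u * t1 + v * t2) + (u + v)\<^sup>2 * n"
  shows "(a + b + c - C_abc a b c)\<^sup>2 * n \<le> dirac_form a b c N1 N2 N3 t1 t2 t3 n \<and>
    (dirac_form a b c N1 N2 N3 t1 t2 t3 n = (a + b + c - C_abc a b c)\<^sup>2 * n \<longrightarrow>
      N1 - 2 * t1 + n = 0 \<and> N2 - 2 * t2 + n = 0)"
proof -
  define C where "C = C_abc a b c"
  define k1 k2 k3 where "k1 = a * C - b * c" and "k2 = b * C - c * a" and "k3 = c * C - a * b"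
  define F where "F = dirac_form a b c N1 N2 N3 t1 t2 t3 n - (a + b + c - C)\<^sup>2 * n"
  define s1 s2 s3 where "s1 = N1 - 2 * t1 + n" and "s2 = N2 - 2 * t2 + n" and "s3 = N3 - 2 * t3 + n"
  note defs = F_def dirac_form_def k1_def k2_def k3_def C_def[symmetric] s1_def s2_def s3_def
  have k: "\<bar>k1\<bar> < a\<^sup>2" "\<bar>k2\<bar> < b\<^sup>2" "\<bar>k3\<bar> < c\<^sup>2"
    using C_abc_bound[of a b c] C_abc_bound[of b c a] C_abc_bound[of c a b] assms(1-4)
    by (simp_all add: k1_def k2_def k3_def C_def C_abc_rotate C_abc_rotate[of c a b] add_ac)
  have pos: "0 \<le> s1" "0 \<le> s2" "0 \<le> s3" "k1 > 0" "k2 > 0"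
    using s k_pos by (simp_all add: s1_def s2_def s3_def k1_def k2_def C_def)
  have "\<exists>m1 m2 r. 0 < m1 \<and> 0 < m2 \<and> 0 \<le> r \<and> F = r + m1 * s1 + m2 * s2"
  proof (cases "k3 \<ge> 0")
    case True
    \<comment> \<open>In each direction, a^2 (T^2 - 1) - 2 k (T - 1) = (a^2 - k) (T^2 - 1) + k (T -
      1)^2.\<close>
    have "F = ((a\<^sup>2 - k1) * (N1 - n) + (b\<^sup>2 - k2) * (N2 - n) + (c\<^sup>2 - k3) * (N3 - n) + k3 * s3)
        + k1 * s1 + k2 * s2"
      unfolding defs by (simp add: power2_eq_square algebra_simps)
    moreover have "0 \<le> (a\<^sup>2 - k1) * (N1 - n) + (b\<^sup>2 - k2) * (N2 - n) + (c\<^sup>2 - k3) * (N3 - n) + k3 * s3"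
      using k N pos True by (intro add_nonneg_nonneg mult_nonneg_nonneg) auto
    ultimately show ?thesis
      using pos by blast
  next
    case False
    define j where "j = - k3"
    have j: "0 < j" "j < c\<^sup>2"
      using False k(3) by (auto simp: j_def)
    \<comment> \<open>A negative k3 means c C < a b, that is b^2 c^2 + c^2 a^2 < a^2 b^2, so
      \<open>c\<close> is strictly the smallest parameter.\<close>
    have ac: "c < a" and bc: "c < b"
    proof -
      have e: "2 * C * (a * b * c) = a\<^sup>2 * b\<^sup>2 + b\<^sup>2 * c\<^sup>2 + c\<^sup>2 * a\<^sup>2"
        unfolding C_def by (rule two_C_abc[OF assms(1-3)])
      have "c * C < a * b"
        using j by (simp add: j_def k3_def)
      then have "2 * (c * C) * (a * b) < 2 * (a * b) * (a * b)"
        using assms(1,2) by (intro mult_strict_right_mono) auto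
      with e have *: "b\<^sup>2 * c\<^sup>2 + c\<^sup>2 * a\<^sup>2 < a\<^sup>2 * b\<^sup>2"
        by (simp add: power2_eq_square algebra_simps)
      moreover have "0 < b\<^sup>2 * c\<^sup>2" "0 < c\<^sup>2 * a\<^sup>2"
        using assms(1-3) by simp_all
      ultimately have "b\<^sup>2 * c\<^sup>2 < a\<^sup>2 * b\<^sup>2" "c\<^sup>2 * a\<^sup>2 < a\<^sup>2 * b\<^sup>2"
        by linarith+
      then have "b\<^sup>2 * c\<^sup>2 < b\<^sup>2 * a\<^sup>2" "a\<^sup>2 * c\<^sup>2 < a\<^sup>2 * b\<^sup>2"
        by (simp_all only: mult.commute)
      then have "c\<^sup>2 < a\<^sup>2" "c\<^sup>2 < b\<^sup>2"
        by (simp_all add: mult_less_cancel_left)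
      then show "c < a" "c < b"
        using assms(1,2) power2_less_imp_less less_imp_le by blast+
    qed
    \<comment> \<open>The product u v = j makes the mixed term of the square equal to the
      troublesome 2 j T_3. The ratio u / v = a / b matches the lower bounds c^2 a / b and c^2 b / a
      for k1 - j and k2 - j found below.\<close>
    define u v where "u = sqrt (j * a / b)" and "v = sqrt (j * b / a)"
    have u2: "u\<^sup>2 = j * a / b" and v2: "v\<^sup>2 = j * b / a"
      using j assms(1,2) by (simp_all add: u_def v_def)
    have uv: "u * v = j"
      using j assms(1,2) by (simp add: u_def v_def flip: real_sqrt_mult)
    \<comment> \<open>What is left of k1 and k2 once the square has used up u^2 + u v and v^2 + u
      v.\<close>
    define m1 m2 where "m1 = k1 - u\<^sup>2 - j" and "m2 = k2 - v\<^sup>2 - j"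
    have C2: "C = (a * b / c + b * c / a + c * a / b) / 2"
      by (simp add: C_def C_abc_def)
    \<comment> \<open>This is k1 + k3 = (a + c) (C - b), with 2 (C - b) written as a square plus c a
      / b. Dropping the square and using a > c leaves c^2 a / b, which exceeds u^2 because j <
      c^2.\<close>
    have "k1 - j = (a + c) * ((a - c)\<^sup>2 * (b / (c * a)) + c * a / b) / 2"
      unfolding j_def k1_def k3_def C2 using assms(1-3) by (simp add: field_simps power2_eq_square)
    moreover have "(a + c) * (c * a / b) / 2
        \<le> (a + c) * ((a - c)\<^sup>2 * (b / (c * a)) + c * a / b) / 2"
      using assms(1-3) by (intro divide_right_mono mult_left_mono) auto
    moreover have "(2 * c) * (c * a / b) / 2 \<le> (a + c) * (c * a / b) / 2"
      using assms(1-3) ac by (intro divide_right_mono mult_right_mono) auto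
    ultimately have "(2 * c) * (c * a / b) / 2 \<le> k1 - j"
      by linarith
    then have "c\<^sup>2 * (a / b) \<le> k1 - j"
      by (simp add: power2_eq_square)
    moreover have "u\<^sup>2 < c\<^sup>2 * (a / b)"
      using j assms(1,2) by (simp add: u2 divide_strict_right_mono)
    ultimately have m1: "0 < m1"
      by (simp add: m1_def)
    have "k2 - j = (b + c) * ((b - c)\<^sup>2 * (a / (c * b)) + c * b / a) / 2"
      unfolding j_def k2_def k3_def C2 using assms(1-3) by (simp add: field_simps power2_eq_square)
    moreover have "(b + c) * (c * b / a) / 2
        \<le> (b + c) * ((b - c)\<^sup>2 * (a / (c * b)) + c * b / a) / 2"
      using assms(1-3) by (intro divide_right_mono mult_left_mono) auto
    moreover have "(2 * c) * (c * b / a) / 2 \<le> (b + c) * (c * b / a) / 2"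
      using assms(1-3) bc by (intro divide_right_mono mult_right_mono) auto
    ultimately have "(2 * c) * (c * b / a) / 2 \<le> k2 - j"
      by linarith
    then have "c\<^sup>2 * (b / a) \<le> k2 - j"
      by (simp add: power2_eq_square)
    moreover have "v\<^sup>2 < c\<^sup>2 * (b / a)"
      using j assms(1,2) by (simp add: v2 divide_strict_right_mono)
    ultimately have m2: "0 < m2"
      by (simp add: m2_def)
    define r where "r = (u\<^sup>2 * N1 + v\<^sup>2 * N2 + 2 * u * v * t3 - 2 * (u + v) * (u * t1 + v * t2) + (u + v)\<^sup>2 * n)
      + (a\<^sup>2 - u\<^sup>2 - m1) * (N1 - n) + (b\<^sup>2 - v\<^sup>2 - m2) * (N2 - n) + c\<^sup>2 * (N3 - n)"
    have "a\<^sup>2 - u\<^sup>2 - m1 \<ge> 0" "b\<^sup>2 - v\<^sup>2 - m2 \<ge> 0"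
      using k j by (simp_all add: m1_def m2_def)
    then have "0 \<le> r"
      unfolding r_def using N by (intro add_nonneg_nonneg mult_nonneg_nonneg square) auto
    moreover have "F = r + m1 * s1 + m2 * s2"
    proof -
      have k3: "k3 = - (u * v)"
        by (simp add: uv j_def)
      have "F = a\<^sup>2 * (N1 - n) + b\<^sup>2 * (N2 - n) + c\<^sup>2 * (N3 - n)
          - 2 * k1 * (t1 - n) - 2 * k2 * (t2 - n) - 2 * k3 * (t3 - n)"
        unfolding defs by (simp add: power2_eq_square algebra_simps)
      then show ?thesis
        unfolding r_def m1_def m2_def s1_def s2_def k3 uv[symmetric]
        by (simp add: power2_eq_square algebra_simps)
    qed
    ultimately show ?thesis
      using m1 m2 by blast
  qed
  then obtain m1 m2 r where F: "0 < m1" "0 < m2" "0 \<le> r" "F = r + m1 * s1 + m2 * s2"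
    by blast
  have ms: "0 \<le> m1 * s1" "0 \<le> m2 * s2"
    using F pos by simp_all
  have "0 \<le> F"
    using F(3,4) ms by simp
  moreover have "s1 = 0 \<and> s2 = 0" if "F = 0"
  proof -
    have "m1 * s1 = 0" "m2 * s2 = 0"
      using that F(3,4) ms by linarith+
    then show ?thesis
      using F(1,2) by simp
  qed
  ultimately show ?thesis
    unfolding F_def s1_def s2_def C_def by auto
qed

text \<open>At most one of the three k's fails to be positive, since y k_x + x k_y = x^2 y^2 / z for
  any two of them. Cyclic symmetry moves that one to the third place, as
  \<open>dirac_form_odd_aux\<close> expects.\<close>

lemma dirac_form_odd:
  assumes abc: "a > 0" "b > 0" "c > 0" and S: "(C_abc a b c)\<^sup>2 < a\<^sup>2 + b\<^sup>2 + c\<^sup>2"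
    and N: "n \<le> N1" "n \<le> N2" "n \<le> N3"
    and s: "0 \<le> N1 - 2 * t1 + n" "0 \<le> N2 - 2 * t2 + n" "0 \<le> N3 - 2 * t3 + n"
    and square:
      "\<And>u v. 0 \<le> u\<^sup>2 * N1 + v\<^sup>2 * N2 + 2 * u * v * t3 - 2 * (u + v) * (u * t1 + v * t2) + (u + v)\<^sup>2 * n"
      "\<And>u v. 0 \<le> u\<^sup>2 * N2 + v\<^sup>2 * N3 + 2 * u * v * t1 - 2 * (u + v) * (u * t2 + v * t3) + (u + v)\<^sup>2 * n"
      "\<And>u v. 0 \<le> u\<^sup>2 * N3 + v\<^sup>2 * N1 + 2 * u * v * t2 - 2 * (u + v) * (u * t3 + v * t1) + (u + v)\<^sup>2 * n"
  shows "(a + b + c - C_abc a b c)\<^sup>2 * n \<le> dirac_form a b c N1 N2 N3 t1 t2 t3 n"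
    and "dirac_form a b c N1 N2 N3 t1 t2 t3 n = (a + b + c - C_abc a b c)\<^sup>2 * n \<Longrightarrow>
      N1 - 2 * t1 + n = 0 \<and> N2 - 2 * t2 + n = 0 \<or> N2 - 2 * t2 + n = 0 \<and> N3 - 2 * t3 + n = 0
      \<or> N3 - 2 * t3 + n = 0 \<and> N1 - 2 * t1 + n = 0"
proof -
  let ?C = "C_abc a b c"
  have rot: "C_abc b c a = ?C" "C_abc c a b = ?C"
    by (simp_all add: C_abc_rotate C_abc_rotate[of c a b])
  have sum_pos: "0 < y * (x * C_abc x y z - y * z) + x * (y * C_abc x y z - z * x)"
    if "x > 0" "y > 0" "z > 0" for x y z
  proof -
    have "y * (x * C_abc x y z - y * z) + x * (y * C_abc x y z - z * x) = x\<^sup>2 * y\<^sup>2 / z"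
      using that by (simp add: C_abc_def field_simps power2_eq_square)
    then show ?thesis
      using that by simp
  qed
  have both: "0 < x * C_abc x y z - y * z \<or> 0 < y * C_abc x y z - z * x"
    if "x > 0" "y > 0" "z > 0" for x y z
  proof (rule ccontr)
    assume "\<not> ?thesis"
    then have "y * (x * C_abc x y z - y * z) \<le> 0" "x * (y * C_abc x y z - z * x) \<le> 0"
      using that by (simp_all add: mult_nonneg_nonpos)
    then show False
      using sum_pos[OF that] by linarith
  qed
  consider "0 < a * ?C - b * c" "0 < b * ?C - c * a" | "0 < b * ?C - c * a" "0 < c * ?C - a * b"
    | "0 < c * ?C - a * b" "0 < a * ?C - b * c"
    using both[OF abc] both[OF abc(2,3,1)] both[OF abc(3,1,2)] unfolding rot by blast
  then have "(a + b + c - ?C)\<^sup>2 * n \<le> dirac_form a b c N1 N2 N3 t1 t2 t3 n \<and>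
    (dirac_form a b c N1 N2 N3 t1 t2 t3 n = (a + b + c - ?C)\<^sup>2 * n \<longrightarrow>
      N1 - 2 * t1 + n = 0 \<and> N2 - 2 * t2 + n = 0 \<or> N2 - 2 * t2 + n = 0 \<and> N3 - 2 * t3 + n = 0
      \<or> N3 - 2 * t3 + n = 0 \<and> N1 - 2 * t1 + n = 0)"
  proof cases
    case 1
    then show ?thesis
      using dirac_form_odd_aux[OF abc S _ _ N s square(1)] by blast
  next
    case 2
    have eq: "b + c + a - ?C = a + b + c - ?C"
      by simp
    have "(C_abc b c a)\<^sup>2 < b\<^sup>2 + c\<^sup>2 + a\<^sup>2" "0 < b * C_abc b c a - c * a" "0 < c * C_abc b c a - a * b"
      using S 2 by (simp_all add: rot)
    from dirac_form_odd_aux[OF abc(2,3,1) this N(2,3,1) s(2,3,1) square(2)] show ?thesis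
      unfolding rot eq dirac_form_rotate[of b c a] by blast
  next
    case 3
    have eq: "c + a + b - ?C = a + b + c - ?C"
      by simp
    have "(C_abc c a b)\<^sup>2 < c\<^sup>2 + a\<^sup>2 + b\<^sup>2" "0 < c * C_abc c a b - a * b" "0 < a * C_abc c a b - b * c"
      using S 3 by (simp_all add: rot)
    from dirac_form_odd_aux[OF abc(3,1,2) this N(3,1,2) s(3,1,2) square(3)] show ?thesis
      unfolding rot eq dirac_form_rotate[of c a b] dirac_form_rotate[of b c a] by blast
  qed
  then show "(a + b + c - C_abc a b c)\<^sup>2 * n \<le> dirac_form a b c N1 N2 N3 t1 t2 t3 n"
    "dirac_form a b c N1 N2 N3 t1 t2 t3 n = (a + b + c - C_abc a b c)\<^sup>2 * n \<Longrightarrow>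
      N1 - 2 * t1 + n = 0 \<and> N2 - 2 * t2 + n = 0 \<or> N2 - 2 * t2 + n = 0 \<and> N3 - 2 * t3 + n = 0
      \<or> N3 - 2 * t3 + n = 0 \<and> N1 - 2 * t1 + n = 0"
    by blast+
qed


section \<open>The spectrum of the Dirac operator\<close>

text \<open>The frame consists of scaled basis directions, and e_1 e_2 e_3 = -1 turns the
  zeroth-order term into -C.\<close>

lemma dirac_eq:
  assumes "smooth_on_S3 f" "x \<in> S3"
  shows "dirac \<epsilon> a b c f x = \<epsilon> *\<^sub>R (a *\<^sub>R dpart 1 f x + b *\<^sub>R dpart 2 f x + c *\<^sub>R dpart 3 f x - C_abc a b c *\<^sub>R f x)"
proof -
  have e: "clifford l *v lderiv (r *\<^sub>R qbase l) f x = r *\<^sub>R dpart l f x" for l r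
    using lderiv_scaleR[OF assms qbase_re] linear_cmul[OF bounded_linear.linear[OF bounded_linear_clifford]]
    by (simp add: dpart_def)
  have "clifford 1 *v (clifford 2 *v (clifford 3 *v f x)) = - f x"
    by (simp add: clifford_mult spinor_eq_iff)
  then show ?thesis
    using assms(2) e[of 1 a] e[of 2 b] e[of 3 c]
    by (simp add: dirac_def sum_3 frame_def left_invariant_def qbase_simps flip: lderiv_def)
qed

lemma dirac_outside: "x \<notin> S3 \<Longrightarrow> dirac \<epsilon> a b c f x = 0"
  by (simp add: dirac_def)

lemma smooth_on_S3_dirac:
  assumes "smooth_on_S3 f"
  shows "smooth_on_S3 (dirac \<epsilon> a b c f)"
proof (rule smooth_on_S3_cong)
  show "smooth_on_S3 (\<lambda>x. \<epsilon> *\<^sub>R (a *\<^sub>R dpart 1 f x + b *\<^sub>R dpart 2 f x + c *\<^sub>R dpart 3 f x + (- C_abc a b c) *\<^sub>R f x))"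
    by (intro smooth_on_S3_add smooth_on_S3_bounded_linear[OF bounded_linear_scaleR_right]
        smooth_on_S3_dpart assms)
qed (simp add: dirac_eq[OF assms])

lemma sip_dirac:
  assumes "smooth_on_S3 f" "smooth_on_S3 g"
  shows "sip (dirac \<epsilon> a b c f) g = sip f (dirac \<epsilon> a b c g)"
proof -
  let ?E = "\<lambda>f x. \<epsilon> *\<^sub>R (a *\<^sub>R dpart 1 f x + b *\<^sub>R dpart 2 f x + c *\<^sub>R dpart 3 f x - C_abc a b c *\<^sub>R f x)"
  note c = smooth_on_S3_continuous_on[OF assms(1)] smooth_on_S3_continuous_on[OF assms(2)]
    continuous_on_dpart[OF assms(1)] continuous_on_dpart[OF assms(2)]
  have "sip (dirac \<epsilon> a b c f) g = sip (?E f) g"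
    by (intro sip_cong refl dirac_eq assms)
  also have "\<dots> = sip f (?E g)"
    by (simp add: sip_scaleR_left sip_scaleR_right sip_add_left sip_add_right sip_diff_left
        sip_diff_right c continuous_on_add continuous_on_diff continuous_on_scaleR sip_dpart[OF assms])
  also have "\<dots> = sip f (dirac \<epsilon> a b c g)"
    by (intro sip_cong refl dirac_eq[symmetric] assms)
  finally show ?thesis .
qed

lemma sip_dirac_dirac:
  assumes f: "smooth_on_S3 f" and "\<epsilon> \<in> {1, - 1}"
  shows "sip (dirac \<epsilon> a b c f) (dirac \<epsilon> a b c f)
    = dirac_form a b c (sip (dpart 1 f) (dpart 1 f)) (sip (dpart 2 f) (dpart 2 f))
        (sip (dpart 3 f) (dpart 3 f)) (sip (dpart 1 f) f) (sip (dpart 2 f) f) (sip (dpart 3 f) f) (sip f f)"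
proof -
  let ?E = "\<lambda>x. a *\<^sub>R dpart 1 f x + b *\<^sub>R dpart 2 f x + c *\<^sub>R dpart 3 f x - C_abc a b c *\<^sub>R f x"
  note c = smooth_on_S3_continuous_on[OF f] continuous_on_dpart[OF f]
  have cross: "sip (dpart 1 f) (dpart 2 f) = sip (dpart 3 f) f" "sip (dpart 2 f) (dpart 1 f) = sip (dpart 3 f) f"
    "sip (dpart 2 f) (dpart 3 f) = sip (dpart 1 f) f" "sip (dpart 3 f) (dpart 2 f) = sip (dpart 1 f) f"
    "sip (dpart 3 f) (dpart 1 f) = sip (dpart 2 f) f" "sip (dpart 1 f) (dpart 3 f) = sip (dpart 2 f) f"
    "sip f (dpart l f) = sip (dpart l f) f" for l
    using sip_dpart_cyclic[OF _ f, of 1 2 3] sip_dpart_cyclic[OF _ f, of 2 3 1]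
      sip_dpart_cyclic[OF _ f, of 3 1 2] sip_commute[of "dpart 2 f" "dpart 1 f"]
      sip_commute[of "dpart 3 f" "dpart 2 f"] sip_commute[of "dpart 1 f" "dpart 3 f"]
    by (simp_all add: cyclic_def sip_commute[of f])
  have "sip (dirac \<epsilon> a b c f) (dirac \<epsilon> a b c f) = sip (\<lambda>x. \<epsilon> *\<^sub>R ?E x) (\<lambda>x. \<epsilon> *\<^sub>R ?E x)"
    by (intro sip_cong refl dirac_eq f)
  also have "\<dots> = sip ?E ?E"
    using assms(2) by (auto simp: sip_def)
  also have "\<dots> = dirac_form a b c (sip (dpart 1 f) (dpart 1 f)) (sip (dpart 2 f) (dpart 2 f))
        (sip (dpart 3 f) (dpart 3 f)) (sip (dpart 1 f) f) (sip (dpart 2 f) f) (sip (dpart 3 f) f) (sip f f)"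
    by (simp add: sip_scaleR_left sip_scaleR_right sip_add_left sip_add_right sip_diff_left
        sip_diff_right c continuous_on_add continuous_on_diff continuous_on_scaleR cross
        dirac_form_def power2_eq_square algebra_simps)
  finally show ?thesis .
qed

text \<open>The squared norm of u T_l f + v T_m f - (u + v) f, expanded; it supplies the hypothesis
  \<open>square\<close> of \<open>dirac_form_odd\<close>.\<close>

lemma sip_square_dpart:
  assumes "cyclic l m k" and f: "smooth_on_S3 f"
  shows "0 \<le> u\<^sup>2 * sip (dpart l f) (dpart l f) + v\<^sup>2 * sip (dpart m f) (dpart m f)
    + 2 * u * v * sip (dpart k f) f - 2 * (u + v) * (u * sip (dpart l f) f + v * sip (dpart m f) f)
    + (u + v)\<^sup>2 * sip f f"
proof -
  note c = smooth_on_S3_continuous_on[OF f] continuous_on_dpart[OF f]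
  have cross: "sip (dpart l f) (dpart m f) = sip (dpart k f) f" "sip (dpart m f) (dpart l f) = sip (dpart k f) f"
    "sip f (dpart l' f) = sip (dpart l' f) f" for l'
    using sip_dpart_cyclic[OF assms] sip_commute[of "dpart m f" "dpart l f"] by (simp_all add: sip_commute[of f])
  let ?E = "\<lambda>x. u *\<^sub>R dpart l f x + v *\<^sub>R dpart m f x - (u + v) *\<^sub>R f x"
  have "0 \<le> sip ?E ?E"
    by (intro sip_nonneg continuous_intros c)
  also have "sip ?E ?E = u\<^sup>2 * sip (dpart l f) (dpart l f) + v\<^sup>2 * sip (dpart m f) (dpart m f)
    + 2 * u * v * sip (dpart k f) f - 2 * (u + v) * (u * sip (dpart l f) f + v * sip (dpart m f) f)
    + (u + v)\<^sup>2 * sip f f"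
    by (simp add: sip_scaleR_left sip_scaleR_right sip_add_left sip_add_right sip_diff_left
        sip_diff_right c continuous_on_add continuous_on_diff continuous_on_scaleR cross
        power2_eq_square algebra_simps del: scaleR_left.add)
  finally show ?thesis .
qed

section \<open>Spinor fields and their parity decomposition\<close>

lemma spinors_smooth: "f \<in> spinors \<Longrightarrow> smooth_on_S3 f"
  by (simp add: spinors_def)

lemma spinors_eqI: "f \<in> spinors \<Longrightarrow> g \<in> spinors \<Longrightarrow> (\<And>x. x \<in> S3 \<Longrightarrow> f x = g x) \<Longrightarrow> f = g"
  by (rule ext, rename_tac x, case_tac "x \<in> S3") (simp_all add: spinors_def)

lemma dirac_in_spinors: "f \<in> spinors \<Longrightarrow> dirac \<epsilon> a b c f \<in> spinors"
  by (simp add: spinors_def smooth_on_S3_dirac dirac_outside)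

lemma const_field_in_spinors: "const_field v \<in> spinors_trivial"
  by (simp add: spinors_trivial_def spinors_def smooth_on_S3_const_field const_field_def S3_uminus)

lemma killing_field_in_spinors: "killing_field v \<in> spinors_nontrivial"
proof -
  have "qcnj (- x) = - qcnj x" for x
    by (simp add: quat_eq_iff)
  then show ?thesis
    by (auto simp add: spinors_nontrivial_def spinors_def smooth_on_S3_killing_field killing_field_def
        S3_uminus spin_rep.minus_left)
qed

lemma bounded_linear_spinor_scale: "bounded_linear ((*s) z :: spinor \<Rightarrow> spinor)"
  by (auto intro!: linearI simp: spinor_eq_iff algebra_simps simp flip: linear_conv_bounded_linear)

lemma spinor_scale_in_spinors: "f \<in> spinors \<Longrightarrow> spinor_scale z f \<in> spinors"
  unfolding spinors_def spinor_scale_def[abs_def]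
  using smooth_on_S3_bounded_linear[OF bounded_linear_spinor_scale] by auto

lemma add_in_spinors: "f \<in> spinors \<Longrightarrow> g \<in> spinors \<Longrightarrow> f + g \<in> spinors"
  unfolding spinors_def plus_fun_def using smooth_on_S3_add by auto

lemma uminus_comp_in_spinors: "f \<in> spinors \<Longrightarrow> (\<lambda>x. f (- x)) \<in> spinors"
  unfolding spinors_def using smooth_on_S3_compose_uminus S3_uminus[of "- x" for x] by fastforce

text \<open>Collects what the parity decomposition relies on, so that it applies to D and to D^2
  alike.\<close>

locale spinor_operator =
  fixes T :: "(quat \<Rightarrow> spinor) \<Rightarrow> quat \<Rightarrow> spinor"
  assumes closed: "f \<in> spinors \<Longrightarrow> T f \<in> spinors"
    and add: "f \<in> spinors \<Longrightarrow> g \<in> spinors \<Longrightarrow> T (f + g) = T f + T g"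
    and scale: "f \<in> spinors \<Longrightarrow> T (spinor_scale z f) = spinor_scale z (T f)"
    and uminus_comp: "f \<in> spinors \<Longrightarrow> T (\<lambda>x. f (- x)) = (\<lambda>x. T f (- x))"

lemma spinor_operator_square:
  assumes "spinor_operator T"
  shows "spinor_operator (T ^^ 2)"
proof -
  interpret spinor_operator T by fact
  show ?thesis
    by unfold_locales (simp_all add: numeral_2_eq_2 closed add scale uminus_comp)
qed

lemma clifford_spinor_scale: "clifford l *v (z *s v) = z *s (clifford l *v v)"
  using exhaust_3[of l] by (auto simp: clifford_mult spinor_eq_iff)

lemma spinor_operator_dirac: "spinor_operator (dirac \<epsilon> a b c)"
proof
  fix f g :: "quat \<Rightarrow> spinor" and z :: complex
  assume f: "f \<in> spinors"
  show "dirac \<epsilon> a b c f \<in> spinors"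
    by (rule dirac_in_spinors[OF f])
  note smooth = spinors_smooth[OF f]
  show "dirac \<epsilon> a b c (f + g) = dirac \<epsilon> a b c f + dirac \<epsilon> a b c g" if g: "g \<in> spinors"
  proof (rule spinors_eqI)
    fix x assume x: "x \<in> S3"
    have d: "dpart l (f + g) x = dpart l f x + dpart l g x" for l
      using linear_add[OF bounded_linear.linear[OF bounded_linear_clifford]]
      by (simp add: dpart_def plus_fun_def lderiv_add[OF smooth spinors_smooth[OF g] x])
    show "dirac \<epsilon> a b c (f + g) x = (dirac \<epsilon> a b c f + dirac \<epsilon> a b c g) x"
      using spinors_smooth[OF add_in_spinors[OF f g]] smooth spinors_smooth[OF g]
      by (simp add: dirac_eq x d algebra_simps)
  qed (intro dirac_in_spinors add_in_spinors f g)+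
  show "dirac \<epsilon> a b c (spinor_scale z f) = spinor_scale z (dirac \<epsilon> a b c f)"
  proof (rule spinors_eqI)
    fix x assume x: "x \<in> S3"
    have d: "dpart l (spinor_scale z f) x = z *s dpart l f x" for l
      by (simp add: dpart_def spinor_scale_def[abs_def] clifford_spinor_scale
          lderiv_bounded_linear[OF bounded_linear_spinor_scale smooth x])
    show "dirac \<epsilon> a b c (spinor_scale z f) x = spinor_scale z (dirac \<epsilon> a b c f) x"
      using spinors_smooth[OF spinor_scale_in_spinors[OF f]]
      by (simp add: dirac_eq x d smooth spinor_scale_def spinor_eq_iff algebra_simps)
  qed (intro dirac_in_spinors spinor_scale_in_spinors f)+
  show "dirac \<epsilon> a b c (\<lambda>x. f (- x)) = (\<lambda>x. dirac \<epsilon> a b c f (- x))"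
  proof (rule spinors_eqI)
    fix x assume x: "x \<in> S3"
    show "dirac \<epsilon> a b c (\<lambda>x. f (- x)) x = dirac \<epsilon> a b c f (- x)"
      using spinors_smooth[OF uminus_comp_in_spinors[OF f]] x S3_uminus[OF x]
      by (simp add: dirac_eq smooth dpart_def lderiv_compose_uminus)
  qed (intro dirac_in_spinors uminus_comp_in_spinors f)+
qed

definition even_part :: "(quat \<Rightarrow> spinor) \<Rightarrow> quat \<Rightarrow> spinor" where
  "even_part f = spinor_scale (1 / 2) (f + (\<lambda>x. f (- x)))"

definition odd_part :: "(quat \<Rightarrow> spinor) \<Rightarrow> quat \<Rightarrow> spinor" where
  "odd_part f = spinor_scale (1 / 2) (f + spinor_scale (- 1) (\<lambda>x. f (- x)))"

lemma even_part_add_odd_part: "even_part f + odd_part f = f"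
  by (auto simp: fun_eq_iff even_part_def odd_part_def spinor_scale_def spinor_eq_iff algebra_simps)

lemma even_part_in_spinors: "f \<in> spinors \<Longrightarrow> even_part f \<in> spinors_trivial"
  unfolding spinors_trivial_def
  by (auto simp: even_part_def intro!: spinor_scale_in_spinors add_in_spinors uminus_comp_in_spinors)
    (simp add: spinor_scale_def add.commute)

lemma odd_part_in_spinors: "f \<in> spinors \<Longrightarrow> odd_part f \<in> spinors_nontrivial"
  unfolding spinors_nontrivial_def
  by (auto simp: odd_part_def intro!: spinor_scale_in_spinors add_in_spinors uminus_comp_in_spinors)
    (simp add: spinor_scale_def spinor_eq_iff)

context spinor_operator
begin

lemma eigenspace_even_part:
  assumes "f \<in> eigenspace spinors T z"
  shows "even_part f \<in> eigenspace spinors_trivial T z"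
proof -
  have f: "f \<in> spinors" "T f = spinor_scale z f"
    using assms by (auto simp: eigenspace_def)
  have "T (even_part f) = spinor_scale (1 / 2) (T f + (\<lambda>x. T f (- x)))"
    by (simp add: even_part_def scale add uminus_comp f(1) add_in_spinors uminus_comp_in_spinors)
  also have "\<dots> = spinor_scale z (even_part f)"
    by (auto simp: f(2) even_part_def fun_eq_iff spinor_scale_def spinor_eq_iff algebra_simps)
  finally show ?thesis
    using even_part_in_spinors[OF f(1)] by (simp add: eigenspace_def)
qed

lemma eigenspace_odd_part:
  assumes "f \<in> eigenspace spinors T z"
  shows "odd_part f \<in> eigenspace spinors_nontrivial T z"
proof -
  have f: "f \<in> spinors" "T f = spinor_scale z f"
    using assms by (auto simp: eigenspace_def)
  have "T (odd_part f) = spinor_scale (1 / 2) (T f + spinor_scale (- 1) (\<lambda>x. T f (- x)))"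
    by (simp add: odd_part_def scale add uminus_comp f(1) add_in_spinors uminus_comp_in_spinors
        spinor_scale_in_spinors)
  also have "\<dots> = spinor_scale z (odd_part f)"
    by (auto simp: f(2) odd_part_def fun_eq_iff spinor_scale_def spinor_eq_iff algebra_simps)
  finally show ?thesis
    using odd_part_in_spinors[OF f(1)] by (simp add: eigenspace_def)
qed

text \<open>Both parity components of an eigenfield solve the same eigenvalue equation, and they
  cannot both vanish.\<close>

lemma spec_spinors: "spec spinors T = spec spinors_trivial T \<union> spec spinors_nontrivial T"
proof (intro equalityI subsetI)
  fix z assume "z \<in> spec spinors T"
  then obtain f where f: "f \<in> eigenspace spinors T z" "f \<noteq> 0"
    by (auto simp: spec_def)
  then have "even_part f \<noteq> 0 \<or> odd_part f \<noteq> 0"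
    using even_part_add_odd_part[of f] by auto
  then show "z \<in> spec spinors_trivial T \<union> spec spinors_nontrivial T"
    unfolding spec_def using eigenspace_even_part[OF f(1)] eigenspace_odd_part[OF f(1)] by auto
next
  fix z assume "z \<in> spec spinors_trivial T \<union> spec spinors_nontrivial T"
  then show "z \<in> spec spinors T"
    unfolding spec_def eigenspace_def spinors_trivial_def spinors_nontrivial_def by blast
qed

end

section \<open>From L2 bounds to eigenvalue bounds\<close>

lemma inner_complex_scale:
  fixes v :: spinor
  shows "(z *s v) \<bullet> v = Re z * (v \<bullet> v)" "(z *s v) \<bullet> (\<i> *s v) = Im z * (v \<bullet> v)"
    "(z *s v) \<bullet> (z *s v) = (cmod z)\<^sup>2 * (v \<bullet> v)" "v \<bullet> (\<i> *s v) = 0"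
  unfolding inner_spinor cmod_power2 by (simp_all add: power2_eq_square algebra_simps)

lemma sip_spinor_scale:
  "sip (spinor_scale z f) f = Re z * sip f f"
  "sip (spinor_scale z f) (spinor_scale \<i> f) = Im z * sip f f"
  "sip (spinor_scale z f) (spinor_scale z f) = (cmod z)\<^sup>2 * sip f f"
  "sip f (spinor_scale \<i> f) = 0"
  unfolding sip_def spinor_scale_def inner_complex_scale
  by (simp_all only: S3_integral_cmult) (simp add: S3_integral_def)

lemma sip_spinors_pos:
  assumes "f \<in> spinors" "f \<noteq> 0"
  shows "0 < sip f f"
proof -
  have c: "continuous_on S3 f"
    using assms(1) by (intro smooth_on_S3_continuous_on spinors_smooth)
  have "sip f f \<noteq> 0"
  proof
    assume "sip f f = 0"
    then have "f = 0"
      using sip_eq_0D[OF c] assms(1) by (intro ext) (auto simp: spinors_def)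
    then show False using assms(2) by simp
  qed
  then show ?thesis
    using sip_nonneg[OF c] by simp
qed

text \<open>For an eigenfield |D f|^2 = |z|^2 |f|^2, so the L2 bound passes directly to |z|.\<close>

lemma spec_lower_bound:
  assumes V: "V \<subseteq> spinors" and m: "0 \<le> m"
    and bound: "\<And>f. f \<in> V \<Longrightarrow> m\<^sup>2 * sip f f \<le> sip (dirac \<epsilon> a b c f) (dirac \<epsilon> a b c f)"
    and z: "z \<in> spec V (dirac \<epsilon> a b c)"
  shows "m \<le> cmod z"
proof -
  obtain f where f: "f \<in> V" "f \<noteq> 0" "dirac \<epsilon> a b c f = spinor_scale z f"
    using z by (auto simp: spec_def eigenspace_def)
  then have "m\<^sup>2 * sip f f \<le> (cmod z)\<^sup>2 * sip f f"
    using bound[OF f(1)] by (simp add: sip_spinor_scale)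
  moreover have "0 < sip f f"
    using f V sip_spinors_pos by blast
  ultimately show ?thesis
    using m by (simp add: power2_le_iff_abs_le)
qed

text \<open>Pair D^2 f = z f with f and with \<i> f and move one D across; the second pairing ends
  in <D f, \<i> D f> = 0.\<close>

lemma dirac_square_eigen:
  assumes f: "f \<in> spinors" "(dirac \<epsilon> a b c ^^ 2) f = spinor_scale z f"
  shows "sip (dirac \<epsilon> a b c f) (dirac \<epsilon> a b c f) = Re z * sip f f" "Im z * sip f f = 0"
proof -
  interpret spinor_operator "dirac \<epsilon> a b c"
    by (rule spinor_operator_dirac)
  note s = spinors_smooth[OF f(1)] spinors_smooth[OF closed[OF f(1)]]
    spinors_smooth[OF spinor_scale_in_spinors[OF f(1)]]
  have D2: "(dirac \<epsilon> a b c ^^ 2) f = dirac \<epsilon> a b c (dirac \<epsilon> a b c f)"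
    by (simp add: numeral_2_eq_2)
  show "sip (dirac \<epsilon> a b c f) (dirac \<epsilon> a b c f) = Re z * sip f f"
    using sip_dirac[OF s(2,1), of \<epsilon> a b c] f(2) unfolding D2 by (simp add: sip_spinor_scale)
  have "Im z * sip f f = sip (dirac \<epsilon> a b c (dirac \<epsilon> a b c f)) (spinor_scale \<i> f)"
    using f(2) unfolding D2 by (simp add: sip_spinor_scale)
  also have "\<dots> = sip (dirac \<epsilon> a b c f) (spinor_scale \<i> (dirac \<epsilon> a b c f))"
    by (simp add: sip_dirac[OF s(2,3)] scale f(1))
  finally show "Im z * sip f f = 0"
    by (simp add: sip_spinor_scale)
qed

lemma spec_square_lower_bound:
  assumes V: "V \<subseteq> spinors"
    and bound: "\<And>f. f \<in> V \<Longrightarrow> m\<^sup>2 * sip f f \<le> sip (dirac \<epsilon> a b c f) (dirac \<epsilon> a b c f)"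
    and z: "z \<in> spec V (dirac \<epsilon> a b c ^^ 2)"
  shows "z \<in> \<real> \<and> m\<^sup>2 \<le> Re z"
proof -
  obtain f where f: "f \<in> V" "f \<noteq> 0" "(dirac \<epsilon> a b c ^^ 2) f = spinor_scale z f"
    using z by (auto simp: spec_def eigenspace_def)
  have pos: "0 < sip f f"
    using f V sip_spinors_pos by blast
  note e = dirac_square_eigen[OF subsetD[OF V f(1)] f(3)]
  have "m\<^sup>2 * sip f f \<le> Re z * sip f f"
    using bound[OF f(1)] e(1) by simp
  then show ?thesis
    using e(2) pos by (simp add: complex_is_Real_iff)
qed

interpretation spinor_fields: vector_space spinor_scale
  by (rule vector_space_spinor_scale)

lemma dim_spinor_range:
  fixes L :: "complex ^ 'n \<Rightarrow> quat \<Rightarrow> spinor"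
  assumes add: "\<And>v w. L (v + w) = L v + L w" and scale: "\<And>z v. L (z *s v) = spinor_scale z (L v)"
    and inj: "\<And>v. L v = 0 \<Longrightarrow> v = 0"
  shows "spinor_fields.dim (range L) = CARD('n)"
proof -
  interpret finite_dimensional_vector_space_pair_1 "(*s)" "cart_basis :: (complex ^ 'n) set" spinor_scale
    by unfold_locales
  have lin: "Vector_Spaces.linear (*s) spinor_scale L"
    by unfold_locales (simp_all add: add scale)
  have "inj L"
    using inj by (simp add: linear_inj_iff_eq_0[OF lin])
  then have "inj_on L (vec.span UNIV)"
    by (simp add: inj_on_def inj_def)
  from dim_image_eq[OF lin this] show ?thesis
    unfolding vec_dim_card .
qed

lemma const_field_linear:
  "const_field (v + w) = const_field v + const_field w"
  "const_field (z *s v) = spinor_scale z (const_field v)"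
  by (auto simp: const_field_def spinor_scale_def fun_eq_iff)

lemma killing_field_linear:
  "killing_field (v + w) = killing_field v + killing_field w"
  "killing_field (z *s v) = spinor_scale z (killing_field v)"
  by (auto simp: killing_field_def spinor_scale_def fun_eq_iff spin_rep.add_right spinor_eq_iff
      spin_rep_nth algebra_simps)

lemma field_at_qone: "const_field v qone = v" "killing_field v qone = v"
proof -
  have "qcnj qone = qone"
    by (simp add: quat_eq_iff)
  then show "const_field v qone = v" "killing_field v qone = v"
    by (simp_all add: const_field_def killing_field_def qone_in_S3 spin_rep_qone)
qed

lemma field_eq_0D: "const_field v = 0 \<Longrightarrow> v = 0" "killing_field v = 0 \<Longrightarrow> v = 0"
  using field_at_qone[of v] by (metis zero_fun_apply)+

lemma dirac_const_field: "dirac \<epsilon> a b c (const_field v) = spinor_scale (of_real (\<epsilon> * (- C_abc a b c))) (const_field v)"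
proof -
  have "const_field v \<in> spinors"
    using const_field_in_spinors by (auto simp: spinors_trivial_def)
  then show ?thesis
    by (intro spinors_eqI dirac_in_spinors spinor_scale_in_spinors)
      (simp_all add: dirac_eq smooth_on_S3_const_field dpart_const_field spinor_scale_def
        spinor_eq_iff scaleR_conv_of_real[where 'a=complex])
qed

lemma dirac_killing_field:
  "dirac \<epsilon> a b c (killing_field v) = spinor_scale (of_real (\<epsilon> * (a + b + c - C_abc a b c))) (killing_field v)"
proof -
  have "killing_field v \<in> spinors"
    using killing_field_in_spinors by (auto simp: spinors_nontrivial_def)
  then show ?thesis
    by (intro spinors_eqI dirac_in_spinors spinor_scale_in_spinors)
      (simp_all add: dirac_eq smooth_on_S3_killing_field dpart_killing_field spinor_scale_def
        spinor_eq_iff scaleR_conv_of_real[where 'a=complex] algebra_simps)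
qed

section \<open>Minimal eigenvalues under \<open>C_less\<close>, the algebraic form of positive
  scalar curvature\<close>

locale positive_scal =
  fixes a b c \<epsilon> :: real
  assumes abc: "a > 0" "b > 0" "c > 0" and orientation: "\<epsilon> \<in> {1, - 1}"
    and C_less: "(C_abc a b c)\<^sup>2 < a\<^sup>2 + b\<^sup>2 + c\<^sup>2"
begin

abbreviation "D \<equiv> dirac \<epsilon> a b c"
abbreviation "C \<equiv> C_abc a b c"
abbreviation "\<mu> \<equiv> a + b + c - C"

sublocale D: spinor_operator D
  by (rule spinor_operator_dirac)

sublocale D2: spinor_operator "D ^^ 2"
  by (rule spinor_operator_square[OF spinor_operator_dirac])

lemma C_pos: "C > 0"
  using abc by (simp add: C_abc_def add_pos_pos)

text \<open>C^2 < a^2 + b^2 + c^2 < (a + b + c)^2.\<close>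

lemma mu_pos: "\<mu> > 0"
proof -
  have e: "(a + b + c)\<^sup>2 = a\<^sup>2 + b\<^sup>2 + c\<^sup>2 + 2 * (a * b + b * c + a * c)"
    by (simp add: power2_eq_square algebra_simps)
  have "0 < a * b + b * c + a * c"
    by (intro add_pos_pos mult_pos_pos abc)
  then have "C\<^sup>2 < (a + b + c)\<^sup>2"
    unfolding e using C_less by simp
  then have "C < a + b + c"
    using abc by (intro power2_less_imp_less[of C "a + b + c"]) auto
  then show ?thesis by simp
qed

lemma mu_le_C: "\<mu> \<le> C"
  using half_sum_le_C_abc(1)[OF abc] by simp

lemma mu_eq_C_iff: "\<mu> = C \<longleftrightarrow> a = b \<and> b = c"
  using half_sum_le_C_abc(2)[OF abc] by auto

lemma spinors_subset: "spinors_trivial \<subseteq> spinors" "spinors_nontrivial \<subseteq> spinors"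
  by (auto simp: spinors_trivial_def spinors_nontrivial_def)

lemma even_bound:
  assumes f: "f \<in> spinors_trivial"
  shows "C\<^sup>2 * sip f f \<le> sip (D f) (D f)"
    and "sip (D f) (D f) = C\<^sup>2 * sip f f \<Longrightarrow> f = const_field (f qone)"
proof -
  have smooth: "smooth_on_S3 f" and even: "even_on_S3 f" and f': "f \<in> spinors"
    using f by (auto simp: spinors_trivial_def spinors_def even_on_S3_def)
  have N: "0 \<le> sip (dpart l f) (dpart l f)" for l
    by (rule sip_nonneg[OF continuous_on_dpart[OF smooth]])
  have t: "2 * \<bar>sip (dpart l f) f\<bar> \<le> sip (dpart l f) (dpart l f)" for l
    using two_dpart_le_even[OF smooth even, of l] two_dpart_ge_even[OF smooth even, of l] by linarith
  note form = dirac_form_even[OF abc C_less N N N t t t]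
  show "C\<^sup>2 * sip f f \<le> sip (D f) (D f)"
    unfolding sip_dirac_dirac[OF smooth orientation] by (rule form(1))
  assume "sip (D f) (D f) = C\<^sup>2 * sip f f"
  from form(2)[OF this[unfolded sip_dirac_dirac[OF smooth orientation]]]
  have "sip (dpart l f) (dpart l f) = 0" for l
    using exhaust_3[of l] by auto
  then have "dpart l f x = 0" if "x \<in> S3" for l x
    using sip_eq_0D[OF continuous_on_dpart[OF smooth] _ that] by blast
  then have "f x = const_field (f qone) x" if "x \<in> S3" for x
    using const_if_dpart_zero[OF smooth _ that] that by (simp add: const_field_def)
  then show "f = const_field (f qone)"
    using f' const_field_in_spinors spinors_subset by (blast intro: spinors_eqI)
qed

text \<open>In the equality case two of the three norms |T_l f - f| vanish, and
  \<open>dpart_third\<close> supplies the third.\<close>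

lemma odd_bound:
  assumes f: "f \<in> spinors_nontrivial"
  shows "\<mu>\<^sup>2 * sip f f \<le> sip (D f) (D f)"
    and "sip (D f) (D f) = \<mu>\<^sup>2 * sip f f \<Longrightarrow> f = killing_field (f qone)"
proof -
  have smooth: "smooth_on_S3 f" and odd: "odd_on_S3 f" and f': "f \<in> spinors"
    using f by (auto simp: spinors_nontrivial_def spinors_def odd_on_S3_def)
  let ?s = "\<lambda>l. sip (dpart l f) (dpart l f) - 2 * sip (dpart l f) f + sip f f"
  have N: "sip f f \<le> sip (dpart l f) (dpart l f)" for l
    by (rule wirtinger_dpart[OF smooth odd])
  have c: "continuous_on S3 (\<lambda>x. dpart l f x - f x)" for l
    by (intro continuous_on_diff continuous_on_dpart smooth_on_S3_continuous_on smooth)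
  have s: "0 \<le> ?s l" for l
    unfolding sip_dpart_minus_id[OF smooth, symmetric] by (rule sip_nonneg[OF c])
  have cyc: "cyclic 1 2 3" "cyclic 2 3 1" "cyclic 3 1 2"
    by (simp_all add: cyclic_def)
  note form = dirac_form_odd[OF abc C_less N N N s s s sip_square_dpart[OF cyc(1) smooth]
      sip_square_dpart[OF cyc(2) smooth] sip_square_dpart[OF cyc(3) smooth]]
  show "\<mu>\<^sup>2 * sip f f \<le> sip (D f) (D f)"
    unfolding sip_dirac_dirac[OF smooth orientation] by (rule form(1))
  assume "sip (D f) (D f) = \<mu>\<^sup>2 * sip f f"
  from form(2)[OF this[unfolded sip_dirac_dirac[OF smooth orientation]]]
  have two: "?s 1 = 0 \<and> ?s 2 = 0 \<or> ?s 2 = 0 \<and> ?s 3 = 0 \<or> ?s 3 = 0 \<and> ?s 1 = 0" .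
  have id: "dpart l f x = f x" if "?s l = 0" "x \<in> S3" for l x
    using sip_eq_0D[OF c _ that(2), of l] that(1) sip_dpart_minus_id[OF smooth, of l] by simp
  have third: "dpart k f x = f x" if "cyclic l m k" "?s l = 0" "?s m = 0" "x \<in> S3" for l m k x
    by (rule dpart_third[OF that(1) smooth id[OF that(2)] id[OF that(3)] that(4)])
  have "dpart l f x = f x" if x: "x \<in> S3" for l x
    using two
  proof (elim disjE conjE)
    assume "?s 1 = 0" "?s 2 = 0"
    then show ?thesis
      using id[OF _ x] third[OF cyc(1) _ _ x] exhaust_3[of l] by blast
  next
    assume "?s 2 = 0" "?s 3 = 0"
    then show ?thesis
      using id[OF _ x] third[OF cyc(2) _ _ x] exhaust_3[of l] by blast
  next
    assume "?s 3 = 0" "?s 1 = 0"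
    then show ?thesis
      using id[OF _ x] third[OF cyc(3) _ _ x] exhaust_3[of l] by blast
  qed
  then have "f x = killing_field (f qone) x" if "x \<in> S3" for x
    using killing_if_dpart_id[OF smooth _ that] by blast
  then show "f = killing_field (f qone)"
    using f' killing_field_in_spinors spinors_subset by (blast intro: spinors_eqI)
qed

lemma epsilon_square: "\<epsilon> * \<epsilon> = 1"
  using orientation by auto

lemma D2_field:
  "(D ^^ 2) (const_field v) = spinor_scale (of_real (C\<^sup>2)) (const_field v)"
  "(D ^^ 2) (killing_field v) = spinor_scale (of_real (\<mu>\<^sup>2)) (killing_field v)"
proof -
  have in_sp: "const_field v \<in> spinors" "killing_field v \<in> spinors"
    using const_field_in_spinors killing_field_in_spinors spinors_subset by blast+
  \<comment> \<open>Squaring removes the orientation sign.\<close>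
  have twice: "spinor_scale (of_real (\<epsilon> * r)) (spinor_scale (of_real (\<epsilon> * r)) f) = spinor_scale (of_real (r\<^sup>2)) f" for r f
  proof -
    have "complex_of_real (\<epsilon> * r) * of_real (\<epsilon> * r) = of_real ((\<epsilon> * \<epsilon>) * r\<^sup>2)"
      by (simp add: power2_eq_square flip: of_real_mult)
    then show ?thesis
      unfolding epsilon_square by (simp add: spinor_fields.scale_scale)
  qed
  have square: "(D ^^ 2) f = D (D f)" for f
    by (simp add: numeral_2_eq_2)
  show "(D ^^ 2) (const_field v) = spinor_scale (of_real (C\<^sup>2)) (const_field v)"
    unfolding square dirac_const_field D.scale[OF in_sp(1)] twice by (simp only: power2_minus)
  show "(D ^^ 2) (killing_field v) = spinor_scale (of_real (\<mu>\<^sup>2)) (killing_field v)"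
    unfolding square dirac_killing_field D.scale[OF in_sp(2)] twice ..
qed

lemma spec_const: "of_real (\<epsilon> * (- C)) \<in> spec spinors_trivial D" "of_real (C\<^sup>2) \<in> spec spinors_trivial (D ^^ 2)"
  and spec_killing: "of_real (\<epsilon> * \<mu>) \<in> spec spinors_nontrivial D" "of_real (\<mu>\<^sup>2) \<in> spec spinors_nontrivial (D ^^ 2)"
proof -
  define v :: spinor where "v = 1"
  have "v \<noteq> 0"
    by (simp add: v_def)
  then have "const_field v \<noteq> 0" "killing_field v \<noteq> 0"
    using field_eq_0D by blast+
  then show "of_real (\<epsilon> * (- C)) \<in> spec spinors_trivial D" "of_real (C\<^sup>2) \<in> spec spinors_trivial (D ^^ 2)"
    "of_real (\<epsilon> * \<mu>) \<in> spec spinors_nontrivial D" "of_real (\<mu>\<^sup>2) \<in> spec spinors_nontrivial (D ^^ 2)"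
    unfolding spec_def eigenspace_def
    using const_field_in_spinors killing_field_in_spinors D2_field dirac_const_field dirac_killing_field
    by blast+
qed

lemma cmod_epsilon: "cmod (of_real (\<epsilon> * (- C))) = C" "cmod (of_real (\<epsilon> * \<mu>)) = \<mu>"
proof -
  have "\<bar>\<epsilon>\<bar> = 1"
    using orientation by auto
  then show "cmod (of_real (\<epsilon> * (- C))) = C" "cmod (of_real (\<epsilon> * \<mu>)) = \<mu>"
    unfolding norm_of_real abs_mult abs_minus using C_pos mu_pos by simp_all
qed

lemma is_minimum_trivial: "is_minimum C (cmod ` spec spinors_trivial D)"
  unfolding is_minimum_def
proof (intro conjI ballI)
  show "C \<in> cmod ` spec spinors_trivial D"
    using spec_const(1) cmod_epsilon(1) by (intro image_eqI) auto
qed (use spec_lower_bound[OF spinors_subset(1) less_imp_le[OF C_pos] even_bound(1)] in blast)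

lemma is_minimum_nontrivial: "is_minimum \<mu> (cmod ` spec spinors_nontrivial D)"
  unfolding is_minimum_def
proof (intro conjI ballI)
  show "\<mu> \<in> cmod ` spec spinors_nontrivial D"
    using spec_killing(1) cmod_epsilon(2) by (intro image_eqI) auto
qed (use spec_lower_bound[OF spinors_subset(2) less_imp_le[OF mu_pos] odd_bound(1)] in blast)

lemma is_minimum_spinors: "is_minimum \<mu> (cmod ` spec spinors D)"
  using is_minimum_trivial is_minimum_nontrivial mu_le_C
  unfolding is_minimum_def D.spec_spinors by (force simp: image_Un)

lemma smallest_eigenvalue_trivial: "smallest_eigenvalue spinors_trivial (D ^^ 2) (C\<^sup>2)"
  unfolding smallest_eigenvalue_def
  using spec_square_lower_bound[OF spinors_subset(1) even_bound(1)] spec_const(2) by blast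

lemma smallest_eigenvalue_nontrivial: "smallest_eigenvalue spinors_nontrivial (D ^^ 2) (\<mu>\<^sup>2)"
  unfolding smallest_eigenvalue_def
  using spec_square_lower_bound[OF spinors_subset(2) odd_bound(1)] spec_killing(2) by blast

lemma mu2_le_C2: "\<mu>\<^sup>2 \<le> C\<^sup>2"
  using mu_le_C mu_pos by (intro power_mono) auto

lemma smallest_eigenvalue_spinors: "smallest_eigenvalue spinors (D ^^ 2) (\<mu>\<^sup>2)"
  using smallest_eigenvalue_trivial smallest_eigenvalue_nontrivial mu2_le_C2
  unfolding smallest_eigenvalue_def D2.spec_spinors by force

section \<open>Eigenspaces and multiplicities\<close>

lemma eigenspace_trivial: "eigenspace spinors_trivial (D ^^ 2) (of_real (C\<^sup>2)) = range const_field"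
proof (intro equalityI subsetI)
  fix f assume "f \<in> eigenspace spinors_trivial (D ^^ 2) (of_real (C\<^sup>2))"
  then have f: "f \<in> spinors_trivial" "(D ^^ 2) f = spinor_scale (of_real (C\<^sup>2)) f"
    by (auto simp: eigenspace_def)
  have "sip (D f) (D f) = C\<^sup>2 * sip f f"
    using dirac_square_eigen(1)[OF subsetD[OF spinors_subset(1) f(1)] f(2)] by simp
  then show "f \<in> range const_field"
    using even_bound(2)[OF f(1)] by blast
next
  fix f assume "f \<in> range const_field"
  then show "f \<in> eigenspace spinors_trivial (D ^^ 2) (of_real (C\<^sup>2))"
    unfolding eigenspace_def using const_field_in_spinors D2_field(1) by blast
qed

lemma eigenspace_nontrivial: "eigenspace spinors_nontrivial (D ^^ 2) (of_real (\<mu>\<^sup>2)) = range killing_field"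
proof (intro equalityI subsetI)
  fix f assume "f \<in> eigenspace spinors_nontrivial (D ^^ 2) (of_real (\<mu>\<^sup>2))"
  then have f: "f \<in> spinors_nontrivial" "(D ^^ 2) f = spinor_scale (of_real (\<mu>\<^sup>2)) f"
    by (auto simp: eigenspace_def)
  have "sip (D f) (D f) = \<mu>\<^sup>2 * sip f f"
    using dirac_square_eigen(1)[OF subsetD[OF spinors_subset(2) f(1)] f(2)] by simp
  then show "f \<in> range killing_field"
    using odd_bound(2)[OF f(1)] by blast
next
  fix f assume "f \<in> range killing_field"
  then show "f \<in> eigenspace spinors_nontrivial (D ^^ 2) (of_real (\<mu>\<^sup>2))"
    unfolding eigenspace_def using killing_field_in_spinors D2_field(2) by blast
qed

lemma multiplicity_trivial: "multiplicity_of spinors_trivial (D ^^ 2) (of_real (C\<^sup>2)) = 2"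
  unfolding multiplicity_of_def eigenspace_trivial
  by (subst dim_spinor_range) (simp_all add: const_field_linear field_eq_0D)

lemma multiplicity_nontrivial: "multiplicity_of spinors_nontrivial (D ^^ 2) (of_real (\<mu>\<^sup>2)) = 2"
  unfolding multiplicity_of_def eigenspace_nontrivial
  by (subst dim_spinor_range) (simp_all add: killing_field_linear field_eq_0D)

text \<open>As \<mu> < C, a nonzero even part would be an even eigenfield below the even minimum; so
  only the odd eigenspace remains.\<close>

lemma multiplicity_spinors_generic:
  assumes "\<mu> \<noteq> C"
  shows "multiplicity_of spinors (D ^^ 2) (of_real (\<mu>\<^sup>2)) = 2"
proof -
  have less: "\<mu>\<^sup>2 < C\<^sup>2"
    using assms mu_le_C mu_pos by (intro power_strict_mono) auto
  have "eigenspace spinors (D ^^ 2) (of_real (\<mu>\<^sup>2)) = eigenspace spinors_nontrivial (D ^^ 2) (of_real (\<mu>\<^sup>2))"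
  proof (intro equalityI subsetI)
    fix f assume f: "f \<in> eigenspace spinors (D ^^ 2) (of_real (\<mu>\<^sup>2))"
    have "even_part f = 0"
    proof (rule ccontr)
      assume "even_part f \<noteq> 0"
      then have "of_real (\<mu>\<^sup>2) \<in> spec spinors_trivial (D ^^ 2)"
        using D2.eigenspace_even_part[OF f] by (auto simp: spec_def)
      then have "C\<^sup>2 \<le> Re (of_real (\<mu>\<^sup>2))"
        using smallest_eigenvalue_trivial unfolding smallest_eigenvalue_def by blast
      with less show False by simp
    qed
    then have "f = odd_part f"
      using even_part_add_odd_part[of f] by simp
    then show "f \<in> eigenspace spinors_nontrivial (D ^^ 2) (of_real (\<mu>\<^sup>2))"
      using D2.eigenspace_odd_part[OF f] by simp
  qed (use spinors_subset in \<open>auto simp: eigenspace_def\<close>)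
  then show ?thesis
    using multiplicity_nontrivial by (simp add: multiplicity_of_def)
qed

text \<open>The even and the odd minimum coincide, so constant and Killing fields together fill the
  eigenspace. It is parametrised by complex 4-vectors cut into two halves.\<close>

lemma multiplicity_spinors_round:
  assumes eq: "\<mu> = C"
  shows "multiplicity_of spinors (D ^^ 2) (of_real (\<mu>\<^sup>2)) = 4"
proof -
  define p q :: "complex ^ 4 \<Rightarrow> spinor" where "p v = vector [v$1, v$2]" and "q v = vector [v$3, v$4]" for v
  have pq: "p (v + w) = p v + p w" "q (v + w) = q v + q w" "p (z *s v) = z *s p v" "q (z *s v) = z *s q v"
    for v w z
    by (simp_all add: p_def q_def spinor_eq_iff)
  define L where "L v = const_field (p v) + killing_field (q v)" for v
  have "eigenspace spinors (D ^^ 2) (of_real (\<mu>\<^sup>2)) = range L"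
  proof (intro equalityI subsetI)
    fix f assume f: "f \<in> eigenspace spinors (D ^^ 2) (of_real (\<mu>\<^sup>2))"
    obtain v where v: "even_part f = const_field v"
      using D2.eigenspace_even_part[OF f] eigenspace_trivial unfolding eq by auto
    obtain w where w: "odd_part f = killing_field w"
      using D2.eigenspace_odd_part[OF f] eigenspace_nontrivial by auto
    have eta: "vector [y$1, y$2] = y" for y :: spinor
      by (simp add: spinor_eq_iff)
    have "L (vector [v$1, v$2, w$1, w$2]) = const_field v + killing_field w"
      by (simp add: L_def p_def q_def eta)
    also have "\<dots> = f"
      using even_part_add_odd_part[of f] v w by simp
    finally show "f \<in> range L"
      by blast
  next
    fix f assume "f \<in> range L"
    then obtain v w where f: "f = const_field v + killing_field w"
      by (auto simp: L_def)
    have sp: "const_field v \<in> spinors" "killing_field w \<in> spinors"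
      using const_field_in_spinors killing_field_in_spinors spinors_subset by blast+
    have "(D ^^ 2) f = spinor_scale (of_real (C\<^sup>2)) (const_field v) + spinor_scale (of_real (\<mu>\<^sup>2)) (killing_field w)"
      unfolding f D2.add[OF sp] D2_field ..
    also have "\<dots> = spinor_scale (of_real (\<mu>\<^sup>2)) f"
      unfolding eq f by (rule spinor_fields.scale_right_distrib[symmetric])
    finally show "f \<in> eigenspace spinors (D ^^ 2) (of_real (\<mu>\<^sup>2))"
      unfolding eigenspace_def using sp by (auto simp: f intro: add_in_spinors)
  qed
  moreover have "spinor_fields.dim (range L) = CARD(4)"
  proof (rule dim_spinor_range)
    show "L (v + w) = L v + L w" for v w
      by (simp add: L_def pq const_field_linear killing_field_linear)
    show "L (z *s v) = spinor_scale z (L v)" for z v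
      by (simp add: L_def pq const_field_linear killing_field_linear spinor_fields.scale_right_distrib)
    fix v assume L0: "L v = 0"
    have "p v + q v = 0"
      using fun_cong[OF L0, of qone] by (simp add: L_def field_at_qone)
    \<comment> \<open>Constant fields are even and Killing fields odd, so the values at
      \<open>qone\<close> and at its antipode separate the two summands.\<close>
    moreover have "p v - q v = 0"
    proof -
      have "const_field (p v) (- qone) = p v" "killing_field (q v) (- qone) = - q v"
        using const_field_in_spinors[of "p v"] killing_field_in_spinors[of "q v"] qone_in_S3
        by (simp_all add: spinors_trivial_def spinors_nontrivial_def field_at_qone)
      then show ?thesis
        using fun_cong[OF L0, of "- qone"] by (simp add: L_def)
    qed
    ultimately have "p v = 0" "q v = 0"
      by (simp_all add: spinor_eq_iff)
    then show "v = 0"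
      by (simp add: vec_eq_iff forall_4 p_def q_def forall_2)
  qed
  ultimately show ?thesis
    by (simp add: multiplicity_of_def)
qed

end


section \<open>Scalar curvature of the left-invariant metric\<close>

text \<open>Agreement is asked for on the sphere, where brackets and covariant derivatives of
  invariant fields are controlled. The generator \<open>v\<close> reduces the curvature computation
  to algebra at the identity.\<close>

definition invariant_on_S3 :: "vfield \<Rightarrow> quat \<Rightarrow> bool" where
  "invariant_on_S3 V v \<longleftrightarrow> v $ 1 = 0 \<and> (\<forall>x\<in>S3. V x = x \<bullet>\<^sub>H v)"

lemma invariant_on_S3D: "invariant_on_S3 V v \<Longrightarrow> v $ 1 = 0" "invariant_on_S3 V v \<Longrightarrow> x \<in> S3 \<Longrightarrow> V x = x \<bullet>\<^sub>H v"
  by (auto simp: invariant_on_S3_def)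

definition commutator :: "quat \<Rightarrow> quat \<Rightarrow> quat" where
  "commutator v w = v \<bullet>\<^sub>H w - w \<bullet>\<^sub>H v"

lemma commutator_re [simp]: "commutator v w $ 1 = 0"
  by (simp add: commutator_def)

lemma invariant_bracket:
  assumes "invariant_on_S3 V v" "invariant_on_S3 W w"
  shows "invariant_on_S3 (bracket V W) (commutator v w)"
proof -
  have d: "tangent_deriv W x (V x) = x \<bullet>\<^sub>H v \<bullet>\<^sub>H w"
    if "invariant_on_S3 V v" "invariant_on_S3 W w" "x \<in> S3" for V W v w x
  proof -
    have "tangent_deriv W x (V x) = lderiv v W x"
      using that by (simp add: lderiv_def invariant_on_S3D)
    also have "\<dots> = lderiv v (\<lambda>y. y \<bullet>\<^sub>H w) x"
      using that by (intro lderiv_cong) (auto simp: invariant_on_S3D)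
    also have "\<dots> = x \<bullet>\<^sub>H v \<bullet>\<^sub>H w"
      using that lderiv_bounded_linear[OF qmult.bounded_linear_left smooth_on_S3_ident]
      by (simp add: lderiv_ident invariant_on_S3D)
    finally show ?thesis .
  qed
  show ?thesis
    unfolding invariant_on_S3_def bracket_def
    using d[OF assms] d[OF assms(2,1)] by (simp add: commutator_def qmult_assoc qmult.diff_right)
qed

context
  fixes a b c :: real
  assumes abc: "a > 0" "b > 0" "c > 0"
begin

definition frame_at_one :: "3 \<Rightarrow> quat" where
  "frame_at_one l = (vector [a *\<^sub>R qi, b *\<^sub>R qj, c *\<^sub>R qk] :: quat ^ 3) $ l"

definition metric_at_one :: "quat \<Rightarrow> quat \<Rightarrow> real" where
  "metric_at_one v w = v$2 * w$2 / a\<^sup>2 + v$3 * w$3 / b\<^sup>2 + v$4 * w$4 / c\<^sup>2"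

text \<open>Invariant fields have constant inner products, so the three derivative terms of the
  Koszul formula vanish; these are the bracket terms.\<close>

definition koszul_at_one :: "quat \<Rightarrow> quat \<Rightarrow> quat \<Rightarrow> real" where
  "koszul_at_one v w z = metric_at_one (commutator v w) z - metric_at_one (commutator w z) v
    + metric_at_one (commutator z v) w"

definition connection_at_one :: "quat \<Rightarrow> quat \<Rightarrow> quat" where
  "connection_at_one v w = (\<Sum>l\<in>UNIV. (koszul_at_one v w (frame_at_one l) / 2) *\<^sub>R frame_at_one l)"

definition curvature_at_one :: "quat \<Rightarrow> quat \<Rightarrow> quat \<Rightarrow> quat" where
  "curvature_at_one v w z = connection_at_one v (connection_at_one w z)
    - connection_at_one w (connection_at_one v z) - connection_at_one (commutator v w) z"

lemma frame_at_one_simps: "frame_at_one 1 = a *\<^sub>R qi" "frame_at_one 2 = b *\<^sub>R qj" "frame_at_one 3 = c *\<^sub>R qk"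
  by (simp_all add: frame_at_one_def)

lemma invariant_frame: "invariant_on_S3 (frame a b c l) (frame_at_one l)"
  using exhaust_3[of l]
  by (auto simp: invariant_on_S3_def frame_def left_invariant_def frame_at_one_def)

lemma connection_at_one_re: "connection_at_one v w $ 1 = 0"
proof -
  have "frame_at_one l $ 1 = 0" for l
    by (rule invariant_on_S3D[OF invariant_frame])
  then show ?thesis
    by (simp add: connection_at_one_def)
qed

lemma metric_eq:
  "x \<in> S3 \<Longrightarrow> metric_abc a b c x (x \<bullet>\<^sub>H v) (x \<bullet>\<^sub>H w) = metric_at_one v w"
  by (simp add: metric_abc_def metric_at_one_def qcnj_qmult_cancel)

lemma tangent_deriv_metric:
  assumes "invariant_on_S3 V v" "invariant_on_S3 W w" "invariant_on_S3 Z z" "x \<in> S3"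
  shows "tangent_deriv (\<lambda>y. metric_abc a b c y (V y) (W y)) x (Z x) = 0"
proof -
  have "tangent_deriv (\<lambda>y. metric_abc a b c y (V y) (W y)) x (Z x)
    = lderiv z (\<lambda>y. metric_abc a b c y (V y) (W y)) x"
    using assms by (simp add: lderiv_def invariant_on_S3D)
  also have "\<dots> = lderiv z (\<lambda>y. metric_at_one v w) x"
    using assms by (intro lderiv_cong) (auto simp: invariant_on_S3D metric_eq)
  finally show ?thesis
    by (simp add: lderiv_const)
qed

lemma koszul_eq:
  assumes V: "invariant_on_S3 V v" and W: "invariant_on_S3 W w" and Z: "invariant_on_S3 Z z" and x: "x \<in> S3"
  shows "koszul (metric_abc a b c) V W Z x = koszul_at_one v w z"
  unfolding koszul_def koszul_at_one_def tangent_deriv_metric[OF W Z V x]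
    tangent_deriv_metric[OF Z V W x] tangent_deriv_metric[OF V W Z x]
  unfolding invariant_on_S3D(2)[OF V x] invariant_on_S3D(2)[OF W x] invariant_on_S3D(2)[OF Z x]
    invariant_on_S3D(2)[OF invariant_bracket[OF V W] x]
    invariant_on_S3D(2)[OF invariant_bracket[OF W Z] x]
    invariant_on_S3D(2)[OF invariant_bracket[OF Z V] x] metric_eq[OF x]
  by simp

lemma invariant_levi_civita:
  assumes "invariant_on_S3 V v" "invariant_on_S3 W w"
  shows "invariant_on_S3 (levi_civita (metric_abc a b c) (frame a b c) V W) (connection_at_one v w)"
  unfolding invariant_on_S3_def
proof (intro conjI ballI connection_at_one_re)
  fix x assume x: "x \<in> S3"
  show "levi_civita (metric_abc a b c) (frame a b c) V W x = x \<bullet>\<^sub>H connection_at_one v w"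
    unfolding levi_civita_def connection_at_one_def koszul_eq[OF assms invariant_frame x]
      invariant_on_S3D(2)[OF invariant_frame x]
    by (simp add: qmult.sum_right qmult.scaleR_right)
qed

lemma curvature_eq:
  assumes V: "invariant_on_S3 V v" and W: "invariant_on_S3 W w" and Z: "invariant_on_S3 Z z" and x: "x \<in> S3"
  shows "curvature (metric_abc a b c) (frame a b c) V W Z x = x \<bullet>\<^sub>H curvature_at_one v w z"
  unfolding curvature_def curvature_at_one_def
    invariant_on_S3D(2)[OF invariant_levi_civita[OF V invariant_levi_civita[OF W Z]] x]
    invariant_on_S3D(2)[OF invariant_levi_civita[OF W invariant_levi_civita[OF V Z]] x]
    invariant_on_S3D(2)[OF invariant_levi_civita[OF invariant_bracket[OF V W] Z] x]
  by (simp add: qmult.diff_right)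

lemma commutator_frame:
  "commutator (frame_at_one 1) (frame_at_one 2) = (2 * (a * b / c)) *\<^sub>R frame_at_one 3"
  "commutator (frame_at_one 2) (frame_at_one 3) = (2 * (b * c / a)) *\<^sub>R frame_at_one 1"
  "commutator (frame_at_one 3) (frame_at_one 1) = (2 * (c * a / b)) *\<^sub>R frame_at_one 2"
  "commutator (frame_at_one 2) (frame_at_one 1) = (- 2 * (a * b / c)) *\<^sub>R frame_at_one 3"
  "commutator (frame_at_one 3) (frame_at_one 2) = (- 2 * (b * c / a)) *\<^sub>R frame_at_one 1"
  "commutator (frame_at_one 1) (frame_at_one 3) = (- 2 * (c * a / b)) *\<^sub>R frame_at_one 2"
  "commutator v v = 0"
  using abc by (simp_all add: commutator_def frame_at_one_simps quat_eq_iff)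

lemma metric_frame: "metric_at_one (frame_at_one l) (frame_at_one m) = (if l = m then 1 else 0)"
  using abc exhaust_3[of l] exhaust_3[of m]
  by (auto simp: metric_at_one_def frame_at_one_simps power2_eq_square)

lemma metric_linear:
  "metric_at_one (r *\<^sub>R v) w = r * metric_at_one v w" "metric_at_one v (r *\<^sub>R w) = r * metric_at_one v w"
  "metric_at_one (v + v') w = metric_at_one v w + metric_at_one v' w"
  "metric_at_one (v - v') w = metric_at_one v w - metric_at_one v' w"
  "metric_at_one 0 w = 0" "metric_at_one (- v) w = - metric_at_one v w"
  by (simp_all add: metric_at_one_def algebra_simps add_divide_distrib diff_divide_distrib)

text \<open>Brackets and covariant derivatives of frame vectors are multiples of frame vectors, so
  iterating them amounts to moving scalars out.\<close>

lemma connection_scale: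
  "connection_at_one (r *\<^sub>R v) w = r *\<^sub>R connection_at_one v w"
  "connection_at_one v (r *\<^sub>R w) = r *\<^sub>R connection_at_one v w"
proof -
  have c: "commutator (r *\<^sub>R v) w = r *\<^sub>R commutator v w" "commutator v (r *\<^sub>R w) = r *\<^sub>R commutator v w" for v w
    by (simp_all add: commutator_def qmult.scaleR_left qmult.scaleR_right scaleR_diff_right)
  have "koszul_at_one (r *\<^sub>R v) w z = r * koszul_at_one v w z" "koszul_at_one v (r *\<^sub>R w) z = r * koszul_at_one v w z" for z
    by (simp_all add: koszul_at_one_def c metric_linear algebra_simps)
  then show "connection_at_one (r *\<^sub>R v) w = r *\<^sub>R connection_at_one v w"
    "connection_at_one v (r *\<^sub>R w) = r *\<^sub>R connection_at_one v w"
    by (simp_all add: connection_at_one_def scaleR_sum_right)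
qed

text \<open>With the structure constants l_1 = 2 b c / a, l_2 = 2 c a / b, l_3 = 2 a b / c, these
  are Milnor's constants m_i = (l_1 + l_2 + l_3) / 2 - l_i.\<close>

lemma connection_frame:
  defines "m1 \<equiv> a * b / c + c * a / b - b * c / a" and "m2 \<equiv> a * b / c + b * c / a - c * a / b"
    and "m3 \<equiv> b * c / a + c * a / b - a * b / c"
  shows "connection_at_one (frame_at_one 1) (frame_at_one 2) = m1 *\<^sub>R frame_at_one 3"
    "connection_at_one (frame_at_one 1) (frame_at_one 3) = (- m1) *\<^sub>R frame_at_one 2"
    "connection_at_one (frame_at_one 2) (frame_at_one 3) = m2 *\<^sub>R frame_at_one 1"
    "connection_at_one (frame_at_one 2) (frame_at_one 1) = (- m2) *\<^sub>R frame_at_one 3"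
    "connection_at_one (frame_at_one 3) (frame_at_one 1) = m3 *\<^sub>R frame_at_one 2"
    "connection_at_one (frame_at_one 3) (frame_at_one 2) = (- m3) *\<^sub>R frame_at_one 1"
    "connection_at_one (frame_at_one l) (frame_at_one l) = 0"
  using exhaust_3[of l]
  by (auto simp: connection_at_one_def koszul_at_one_def sum_3 commutator_frame metric_linear
      metric_frame m1_def m2_def m3_def diff_divide_distrib add_divide_distrib)

lemma scal_abc_eq:
  assumes x: "x \<in> S3"
  shows "scal_abc a b c x = 8 * (a\<^sup>2 + b\<^sup>2 + c\<^sup>2 - (C_abc a b c)\<^sup>2)"
proof -
  define m1 m2 m3 where "m1 = a * b / c + c * a / b - b * c / a" and "m2 = a * b / c + b * c / a - c * a / b"
    and "m3 = b * c / a + c * a / b - a * b / c"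
  note conn = connection_frame[folded m1_def m2_def m3_def]
  have conn_minus: "connection_at_one (- v) w = - connection_at_one v w"
    "connection_at_one v (- w) = - connection_at_one v w" for v w
    using connection_scale(1)[of "-1"] connection_scale(2)[of _ "-1"] by simp_all
  have conn0: "connection_at_one v 0 = 0" "connection_at_one 0 v = 0" for v
    using connection_scale(2)[of v 0 0] connection_scale(1)[of 0 0 v] by simp_all
  have "scal_abc a b c x
    = (\<Sum>i\<in>UNIV. \<Sum>j\<in>UNIV. metric_at_one
        (curvature_at_one (frame_at_one i) (frame_at_one j) (frame_at_one j)) (frame_at_one i))"
    unfolding scal_abc_def scalar_curvature_def
      curvature_eq[OF invariant_frame invariant_frame invariant_frame x]
      invariant_on_S3D(2)[OF invariant_frame x] metric_eq[OF x] ..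
  \<comment> \<open>Because m1 + m2 = 2 a b / c and cyclically, this equals 2 (m1 m2 + m2 m3 + m3
    m1).\<close>
  also have "\<dots> = 4 * (a * b / c) * m3 + 4 * (b * c / a) * m1 + 4 * (c * a / b) * m2
      - 2 * (m1 * m2 + m2 * m3 + m3 * m1)"
    by (simp add: sum_3 curvature_at_one_def commutator_frame conn conn0 conn_minus connection_scale metric_linear
        metric_frame algebra_simps)
  \<comment> \<open>For p = a b / c, q = b c / a, r = c a / b one has p q = b^2, q r = c^2, r p =
    a^2 and p + q + r = 2 C.\<close>
  also have "\<dots> = 8 * (a\<^sup>2 + b\<^sup>2 + c\<^sup>2 - (C_abc a b c)\<^sup>2)"
    unfolding m1_def m2_def m3_def C_abc_def using abc
    by (simp add: power2_eq_square field_simps)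
  finally show ?thesis .
qed

end

theorem theorem1:
  fixes a b c C \<mu> \<epsilon> :: real
  assumes "a > 0" and "b > 0" and "c > 0"
    and "\<epsilon> \<in> {1, - 1}"
    and "C = C_abc a b c"
    and "\<mu> = a + b + c - C"
    and "\<forall>x\<in>S3. scal_abc a b c x > 0"
  shows
    "is_minimum \<mu> (cmod ` spec spinors (dirac \<epsilon> a b c)) \<and> \<mu> > 0
     \<and> is_minimum C (cmod ` spec spinors_trivial (dirac \<epsilon> a b c)) \<and> C \<ge> \<mu>
     \<and> is_minimum \<mu> (cmod ` spec spinors_nontrivial (dirac \<epsilon> a b c))
     \<and> (\<exists>r. smallest_eigenvalue spinors (dirac \<epsilon> a b c ^^ 2) r
          \<and> multiplicity_of spinors (dirac \<epsilon> a b c ^^ 2) (of_real r)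
              = (if a = b \<and> b = c then 4 else 2))
     \<and> (\<exists>r. smallest_eigenvalue spinors_trivial (dirac \<epsilon> a b c ^^ 2) r
          \<and> multiplicity_of spinors_trivial (dirac \<epsilon> a b c ^^ 2) (of_real r) = 2)
     \<and> (\<exists>r. smallest_eigenvalue spinors_nontrivial (dirac \<epsilon> a b c ^^ 2) r
          \<and> multiplicity_of spinors_nontrivial (dirac \<epsilon> a b c ^^ 2) (of_real r) = 2)"
proof -
  have "0 < scal_abc a b c qone"
    using assms(7) qone_in_S3 by blast
  \<comment> \<open>The scalar curvature is constant, so its value at \<open>qone\<close> already
    yields \<open>C_less\<close>.\<close>
  then interpret positive_scal a b c \<epsilon>
    using assms(1-4) scal_abc_eq[OF assms(1-3) qone_in_S3] by unfold_locales auto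
  have "multiplicity_of spinors (dirac \<epsilon> a b c ^^ 2) (of_real ((a + b + c - C_abc a b c)\<^sup>2))
      = (if a = b \<and> b = c then 4 else 2)"
    using multiplicity_spinors_round multiplicity_spinors_generic unfolding mu_eq_C_iff by presburger
  then show ?thesis
    unfolding assms(5,6)
    using is_minimum_spinors is_minimum_trivial is_minimum_nontrivial mu_pos mu_le_C
      smallest_eigenvalue_spinors smallest_eigenvalue_trivial smallest_eigenvalue_nontrivial
      multiplicity_trivial multiplicity_nontrivial
    by blast
qed

end
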